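(* For each $k\in\mathbb{N}$, there is a polynomial-time certifying algorithm for $k$-Coloring of (co-gem, dart)-free graphs.
   Context: All graphs are finite, simple and undirected; $\mathbb{N}=\{1,2,3,\ldots\}$. For a fixed $k$, the $k$-Coloring problem asks whether a given graph $G$ is $k$-colorable (i.e. $\chi(G)\le k$). A graph $G$ is $m$-vertex-critical if $\chi(G)=m$ and $\chi(G-v)<m$ for all $v\in V(G)$. An algorithm is certifying if with each output it returns a certificate of correctness that can be verified in polynomial time; for $k$-Coloring, such an algorithm outputs a $k$-coloring of $G$ when $G$ is $k$-colorable, and a $(k+1)$-vertex-critical induced subgraph of $G$ otherwise. A graph is $(H_1,H_2)$-free if it contains neither $H_1$ nor $H_2$ as an induced subgraph. The co-gem is $P_4+P_1$, the disjoint union of a chordless path on four vertices and an isolated vertex. The dart is the five-vertex graph with vertices $a,b,c,d,p$ and edges $ab, ac, bc, bd, cd, bp$ (a diamond, i.e. $K_4$ minus an edge, with a pendant vertex attached to one of its degree-3 vertices). *)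

theory Defs
  imports Main "HOL-Computational_Algebra.Polynomial"
begin

section \<open>Finite simple graphs\<close>

datatype 'a graph = Graph (verts: "'a set") (edges: "'a set set")

definition simple_graph :: "'a graph \<Rightarrow> bool" where
  "simple_graph G \<longleftrightarrow>
     finite (verts G) \<and> edges G \<subseteq> {{u, v} | u v. u \<in> verts G \<and> v \<in> verts G \<and> u \<noteq> v}"

definition induced :: "'a graph \<Rightarrow> 'a set \<Rightarrow> 'a graph" where
  "induced G S = Graph S {e \<in> edges G. e \<subseteq> S}"

definition delete_vertex :: "'a graph \<Rightarrow> 'a \<Rightarrow> 'a graph" where
  "delete_vertex G v = induced G (verts G - {v})"

definition graph_iso :: "'a graph \<Rightarrow> 'b graph \<Rightarrow> bool" where
  "graph_iso G H \<longleftrightarrow>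
     (\<exists>f. bij_betw f (verts G) (verts H) \<and>
          (\<forall>u\<in>verts G. \<forall>v\<in>verts G. {u, v} \<in> edges G \<longleftrightarrow> {f u, f v} \<in> edges H))"

definition induced_free :: "'b graph \<Rightarrow> 'a graph \<Rightarrow> bool" where
  "induced_free H G \<longleftrightarrow> \<not> (\<exists>S\<subseteq>verts G. graph_iso H (induced G S))"

text \<open>The path \<open>0-1-2-3\<close> together with the isolated vertex \<open>4\<close>.\<close>
definition co_gem :: "nat graph" where
  "co_gem = Graph {0, 1, 2, 3, 4} {{0, 1}, {1, 2}, {2, 3}}"

text \<open>The vertices \<open>a, b, c, d, p\<close> are \<open>0, 1, 2, 3, 4\<close>.\<close>
definition dart :: "nat graph" where
  "dart = Graph {0, 1, 2, 3, 4} {{0, 1}, {0, 2}, {1, 2}, {1, 3}, {2, 3}, {1, 4}}"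

definition proper_coloring :: "nat \<Rightarrow> 'a graph \<Rightarrow> ('a \<Rightarrow> nat) \<Rightarrow> bool" where
  "proper_coloring k G c \<longleftrightarrow>
     (\<forall>v\<in>verts G. c v < k) \<and>
     (\<forall>u\<in>verts G. \<forall>v\<in>verts G. {u, v} \<in> edges G \<longrightarrow> c u \<noteq> c v)"

definition chromatic_number :: "'a graph \<Rightarrow> nat" where
  "chromatic_number G = (LEAST k. \<exists>c. proper_coloring k G c)"

definition colorable :: "nat \<Rightarrow> 'a graph \<Rightarrow> bool" where
  "colorable k G \<longleftrightarrow> chromatic_number G \<le> k"

definition vertex_critical :: "nat \<Rightarrow> 'a graph \<Rightarrow> bool" where
  "vertex_critical m G \<longleftrightarrow>
     chromatic_number G = m \<and> (\<forall>v\<in>verts G. chromatic_number (delete_vertex G v) < m)"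


section \<open>Random access programs and their running time\<close>

text \<open>
  The machine model is a structured random access machine: a store consists of named
  arrays of natural numbers (a scalar variable is cell 0 of an array), and a program is a
  fixed command, so it mentions only finitely many arrays and each of its expressions has
  constant size.  Hence every assignment and test is charged one unit of time.  The only
  arithmetic is addition and truncated subtraction, so in \<open>t\<close> steps the bit length of the
  stored numbers and addresses grows by at most a constant multiple of \<open>t\<close>.  Therefore
  polynomial time in this model is polynomial time on Turing machines.  Unit-cost
  multiplication would break this.
\<close>

type_synonym store = "string \<Rightarrow> nat \<Rightarrow> nat"

datatype aexp =
    Const nat
  | Cell string aexp
  | Plus aexp aexp
  | Minus aexp aexp

datatype bexp =
    Less aexp aexp
  | Neg bexp
  | Conj bexp bexp

datatype com =
    Skip
  | Assign string aexp aexp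
  | Seq com com
  | Cond bexp com com
  | While bexp com

primrec aval :: "aexp \<Rightarrow> store \<Rightarrow> nat" where
  "aval (Const m) s = m"
| "aval (Cell x a) s = s x (aval a s)"
| "aval (Plus a b) s = aval a s + aval b s"
| "aval (Minus a b) s = aval a s - aval b s"

primrec bval :: "bexp \<Rightarrow> store \<Rightarrow> bool" where
  "bval (Less a b) s \<longleftrightarrow> aval a s < aval b s"
| "bval (Neg b) s \<longleftrightarrow> \<not> bval b s"
| "bval (Conj b c) s \<longleftrightarrow> bval b s \<and> bval c s"

text \<open>\<open>exec c s t s'\<close>: started in store \<open>s\<close>, the program \<open>c\<close> halts after exactly \<open>t\<close> steps
  in store \<open>s'\<close>.\<close>
inductive exec :: "com \<Rightarrow> store \<Rightarrow> nat \<Rightarrow> store \<Rightarrow> bool" where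
  exec_Skip: "exec Skip s 1 s"
| exec_Assign: "exec (Assign x a b) s 1 (s(x := (s x)(aval a s := aval b s)))"
| exec_Seq: "exec c s t s' \<Longrightarrow> exec d s' u s'' \<Longrightarrow> exec (Seq c d) s (t + u) s''"
| exec_Cond_True: "bval b s \<Longrightarrow> exec c s t s' \<Longrightarrow> exec (Cond b c d) s (t + 1) s'"
| exec_Cond_False: "\<not> bval b s \<Longrightarrow> exec d s t s' \<Longrightarrow> exec (Cond b c d) s (t + 1) s'"
| exec_While_False: "\<not> bval b s \<Longrightarrow> exec (While b c) s 1 s"
| exec_While_True: "bval b s \<Longrightarrow> exec c s t s' \<Longrightarrow> exec (While b c) s' u s'' \<Longrightarrow>
    exec (While b c) s (t + u + 1) s''"

inductive_cases exec_SkipE: "exec Skip s t s'"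
inductive_cases exec_AssignE: "exec (Assign x a b) s t s'"
inductive_cases exec_SeqE: "exec (Seq c d) s t s'"
inductive_cases exec_CondE: "exec (Cond b c d) s t s'"
inductive_cases exec_WhileE: "exec (While b c) s t s'"

lemma exec_deterministic:
  "exec c s t s' \<Longrightarrow> exec c s u s'' \<Longrightarrow> u = t \<and> s'' = s'"
proof (induction arbitrary: u s'' rule: exec.induct)
  case (exec_Skip s)
  then show ?case by (rule exec_SkipE) simp
next
  case (exec_Assign x a b s)
  then show ?case by (rule exec_AssignE) simp
next
  case (exec_Seq c s t s' d u1 s1)
  from exec_Seq.prems show ?case
    by (rule exec_SeqE) (metis exec_Seq.IH)
next
  case (exec_Cond_True b s c t s' d)
  from exec_Cond_True.prems show ?case
    by (rule exec_CondE) (metis exec_Cond_True.IH exec_Cond_True.hyps(1) Suc_eq_plus1)+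
next
  case (exec_Cond_False b s d t s' c)
  from exec_Cond_False.prems show ?case
    by (rule exec_CondE) (metis exec_Cond_False.IH exec_Cond_False.hyps(1) Suc_eq_plus1)+
next
  case (exec_While_False b s c)
  from exec_While_False.prems show ?case
    by (rule exec_WhileE) (use exec_While_False.hyps in simp_all)
next
  case (exec_While_True b s c t s' u1 s1)
  from exec_While_True.prems show ?case
    by (rule exec_WhileE) (metis exec_While_True.IH exec_While_True.hyps(1) Suc_eq_plus1)+
qed

definition halts_within :: "com \<Rightarrow> store \<Rightarrow> nat \<Rightarrow> (store \<Rightarrow> bool) \<Rightarrow> bool" where
  "halts_within c s T Q \<longleftrightarrow> (\<exists>t s'. exec c s t s' \<and> t \<le> T \<and> Q s')"


section \<open>Certifying algorithms for colouring\<close>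

datatype certificate =
    Coloring "nat \<Rightarrow> nat"
  | Critical_Subgraph "nat set"

definition correct_certificate :: "nat \<Rightarrow> nat graph \<Rightarrow> certificate \<Rightarrow> bool" where
  "correct_certificate k G w \<longleftrightarrow>
     (if colorable k G
      then \<exists>c. w = Coloring c \<and> proper_coloring k G c
      else \<exists>S. w = Critical_Subgraph S \<and> S \<subseteq> verts G \<and> vertex_critical (k + 1) (induced G S))"

text \<open>A graph with vertex set \<open>{..<n}\<close> is presented to a program by the number \<open>n\<close> and its
  adjacency matrix, stored row by row.\<close>
definition graph_store :: "nat \<Rightarrow> nat graph \<Rightarrow> store" where
  "graph_store n G = (\<lambda>_ _. 0)
     (''n'' := (\<lambda>_. 0)(0 := n),
      ''adj'' := (\<lambda>i. if i < n * n \<and> {i div n, i mod n} \<in> edges G then 1 else 0))"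

primrec certificate_tag :: "certificate \<Rightarrow> nat" where
  "certificate_tag (Coloring c) = 1"
| "certificate_tag (Critical_Subgraph S) = 0"

primrec certificate_word :: "certificate \<Rightarrow> nat \<Rightarrow> nat" where
  "certificate_word (Coloring c) v = c v"
| "certificate_word (Critical_Subgraph S) v = (if v \<in> S then 1 else 0)"

definition holds_certificate :: "nat \<Rightarrow> store \<Rightarrow> certificate \<Rightarrow> bool" where
  "holds_certificate n s w \<longleftrightarrow>
     s ''ans'' 0 = certificate_tag w \<and> (\<forall>v<n. s ''cert'' v = certificate_word w v)"

definition verifier_store :: "nat \<Rightarrow> nat graph \<Rightarrow> certificate \<Rightarrow> store" where
  "verifier_store n G w = (graph_store n G)
     (''ans'' := (\<lambda>_. 0)(0 := certificate_tag w),
      ''cert'' := (\<lambda>v. if v < n then certificate_word w v else 0))"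

text \<open>The number \<open>n\<close> of vertices and the length of the input are polynomially related, so
  running times are bounded by polynomials in \<open>n\<close>.\<close>
definition poly_time_outputs_certificate :: "nat \<Rightarrow> nat graph set \<Rightarrow> com \<Rightarrow> bool" where
  "poly_time_outputs_certificate k \<G> A \<longleftrightarrow>
     (\<exists>p :: nat poly. \<forall>n. \<forall>G\<in>\<G>. verts G = {..<n} \<longrightarrow>
        halts_within A (graph_store n G) (poly p n)
          (\<lambda>s. \<exists>w. holds_certificate n s w \<and> correct_certificate k G w))"

text \<open>The verifier has to decide correctness of every candidate certificate. Candidates
  with \<open>S\<close> not contained in the vertex set are excluded because the store cannot represent
  them.\<close>
definition poly_time_verifies_certificate :: "nat \<Rightarrow> nat graph set \<Rightarrow> com \<Rightarrow> bool" where
  "poly_time_verifies_certificate k \<G> B \<longleftrightarrow>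
     (\<exists>p :: nat poly. \<forall>n. \<forall>G\<in>\<G>. verts G = {..<n} \<longrightarrow>
        (\<forall>w. (\<forall>S. w = Critical_Subgraph S \<longrightarrow> S \<subseteq> verts G) \<longrightarrow>
          halts_within B (verifier_store n G w) (poly p n)
            (\<lambda>s. s ''ans'' 0 = 1 \<longleftrightarrow> correct_certificate k G w)))"

definition poly_time_certifying_coloring :: "nat \<Rightarrow> nat graph set \<Rightarrow> com \<Rightarrow> bool" where
  "poly_time_certifying_coloring k \<G> A \<longleftrightarrow>
     poly_time_outputs_certificate k \<G> A \<and> (\<exists>B. poly_time_verifies_certificate k \<G> B)"

end

theory Submission
  imports Defs
begin

text \<open>
  Fix \<open>k\<close>. Since the class is hereditary, it is enough to decide \<open>k\<close>-colourability in polynomial time and to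
  find a colouring when there is one. A graph that is not \<open>k\<close>-colourable is then shrunk to a critical
  subgraph by deleting vertices as long as the rest is not \<open>k\<close>-colourable (\<open>runs_shrink\<close>), and a
  claimed critical subgraph is verified by deciding colourability of it and of its vertex-deleted subgraphs
  (\<open>runs_check_critical\<close>).

  The decision procedure guesses a bounded number of anchor vertices and, for each possible adjacency
  pattern to the anchors, a list of colours; then it colours first-fit from these lists. For fixed \<open>k\<close> there are
  polynomially many guesses. Every colouring found in this way is proper, so the point is that some guess
  succeeds whenever the graph is \<open>k\<close>-colourable.

  This is a structural fact about (co-gem, dart)-free graphs. If the graph has no induced \<open>P\<^sub>4\<close>, first-fit
  with full lists is optimal. Otherwise an induced \<open>P\<^sub>4\<close> dominates the graph, because there is no
  co-gem. As there is no dart, neighbourhoods are \<open>(P\<^sub>3 + P\<^sub>1)\<close>-free; around any three independent vertices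
  such a neighbourhood splits off a disjoint union of cliques that is complete to the rest of the
  neighbourhood (\<open>piece_P3_free\<close>, \<open>piece_complete\<close>). So, apart from boundedly many vertices, the graph is covered
  by boundedly many such pieces. Given a \<open>k\<close>-colouring, boundedly many representatives of its colours, taken as
  anchors, restrict the colours at the other vertices so much that adjacent vertices with a common colour in
  their lists lie in one clique of a piece; and as each anchor is mixed on at most one clique of a piece
  (\<open>mixed_clique\<close>), one can arrange that such vertices have the same list. This is \<open>anchors\<close>. With such lists
  first-fit does not get stuck, by the clique argument for \<open>P\<^sub>4\<close>-free graphs (\<open>greedy_not_stuck\<close>).
\<close>

section \<open>Few anchors determine good lists\<close>

text \<open>
  Lists with these two properties are the ones that first-fit colouring can work with: vertices
  that compete for a colour have the same list, and the vertices with a given list induce a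
  \<open>P\<^sub>4\<close>-free graph, on which first-fit uses as few colours as possible.
\<close>
definition list_good :: "'a set \<Rightarrow> ('a \<Rightarrow> 'a \<Rightarrow> bool) \<Rightarrow> ('a \<Rightarrow> nat set) \<Rightarrow> bool" where
  "list_good S E L \<longleftrightarrow>
     (\<forall>u\<in>S. \<forall>v\<in>S. E u v \<and> L u \<inter> L v \<noteq> {} \<longrightarrow> L u = L v) \<and>
     (\<forall>a\<in>S. \<forall>b\<in>S. \<forall>c\<in>S. \<forall>d\<in>S. L a = L b \<and> L b = L c \<and> L c = L d \<and> E a b \<and> E b c \<and> E c d \<longrightarrow>
        E a c \<or> E a d \<or> E b d)"

text \<open>
  All of \<open>X\<close> if it has fewer than \<open>r\<close> elements, so a vertex of \<open>X\<close> that was not picked shows that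
  \<open>r\<close> elements were.
\<close>
definition pick :: "nat \<Rightarrow> 'a set \<Rightarrow> 'a set" where
  "pick r X = (SOME Y. Y \<subseteq> X \<and> card Y = min r (card X))"

lemma pick_spec: "pick r X \<subseteq> X \<and> card (pick r X) = min r (card X)"
proof -
  have "\<exists>Y\<subseteq>X. card Y = min r (card X)"
    by (metis min.cobounded2 obtain_subset_with_card_n)
  then show ?thesis unfolding pick_def by (rule someI2_ex) auto
qed

lemma pick_subset: "pick r X \<subseteq> X"
  using pick_spec[of r X] by (rule conjunct1)

lemma card_pick: "card (pick r X) \<le> r"
  using pick_spec[of r X] by simp

lemma pick_small:
  assumes "finite X" "x \<in> X" "x \<notin> pick r X"
  shows "card (pick r X) = r"
proof -
  have "pick r X \<noteq> X" using assms by blast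
  then have "card (pick r X) < card X"
    by (meson assms(1) pick_subset psubset_card_mono psubsetI)
  then show ?thesis using pick_spec[of r X] by simp
qed

lemma pick_nonempty:
  assumes "finite X" "X \<noteq> {}" "r > 0"
  shows "pick r X \<noteq> {}"
proof -
  have "card X > 0" using assms by (simp add: card_gt_0_iff)
  then have "card (pick r X) > 0" using assms(3) pick_spec[of r X] by simp
  then show ?thesis by auto
qed

text \<open>
  The induced path and the isolated vertex of a co-gem are distinct as soon as the adjacencies are
  as listed; of the dart only the inequality of the two ends \<open>x\<close>, \<open>z\<close> has to be said. Here \<open>p\<close> is the
  centre of the dart, so that its neighbourhood contains no \<open>P\<^sub>3 + P\<^sub>1\<close>.
\<close>
locale cogem_dart_free =
  fixes S :: "'a set" and E :: "'a \<Rightarrow> 'a \<Rightarrow> bool"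
  assumes fin: "finite S"
    and sym: "E u v \<Longrightarrow> E v u"
    and irr: "\<not> E u u"
    and cogem: "\<lbrakk>a \<in> S; b \<in> S; c \<in> S; d \<in> S; e \<in> S; E a b; E b c; E c d; \<not> E a c; \<not> E a d; \<not> E b d;
        \<not> E e a; \<not> E e b; \<not> E e c; \<not> E e d\<rbrakk> \<Longrightarrow> False"
    and dart: "\<lbrakk>p \<in> S; x \<in> S; y \<in> S; z \<in> S; u \<in> S; E p x; E p y; E p z; E p u;
        E x y; E y z; x \<noteq> z; \<not> E x z; \<not> E u x; \<not> E u y; \<not> E u z\<rbrakk> \<Longrightarrow> False"
begin

text \<open>
  For three independent neighbours of \<open>p\<close> this is a component of the complement of \<open>N(p)\<close>: it is a
  disjoint union of cliques, and the rest of \<open>N(p)\<close> is complete to it.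
\<close>
definition piece :: "'a \<Rightarrow> 'a set \<Rightarrow> 'a set" where
  "piece p I = {x \<in> S. E p x \<and> \<not> (\<forall>t\<in>I. E x t)}"

definition triple :: "'a \<Rightarrow> 'a set \<Rightarrow> bool" where
  "triple p I \<longleftrightarrow> p \<in> S \<and> card I = 3 \<and> I \<subseteq> S \<and> (\<forall>t\<in>I. E p t) \<and> (\<forall>t\<in>I. \<forall>u\<in>I. \<not> E t u)"

lemma third:
  assumes "card I = 3"
  obtains t where "t \<in> I" "t \<noteq> u" "t \<noteq> v"
proof -
  have "card {u, v} < card I" using assms by (simp add: card_insert_if)
  then have "\<not> I \<subseteq> {u, v}" by (metis card_mono finite.emptyI finite.insertI leD)
  then show ?thesis using that by blast
qed

text \<open>
  With two neighbours in \<open>I\<close>, the vertex \<open>x\<close> would be the middle of a \<open>P\<^sub>3\<close> in \<open>N(p)\<close> from which the third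
  vertex of \<open>I\<close>, not adjacent to \<open>x\<close>, is isolated.
\<close>
lemma near_unique:
  assumes I: "triple p I" and x: "x \<in> piece p I"
    and t: "t \<in> I" "t = x \<or> E x t" and u: "u \<in> I" "u = x \<or> E x u"
  shows "t = u"
proof (rule ccontr)
  assume ne: "t \<noteq> u"
  have a: "E x t" "E x u"
    using I t u ne sym unfolding triple_def by metis+
  obtain w where w: "w \<in> I" "\<not> E x w" using x by (auto simp: piece_def)
  show False
    using dart[of p t x u w] I x t u w a ne sym unfolding triple_def piece_def by blast
qed

text \<open>
  So each clique of the piece belongs to at most one vertex of \<open>I\<close>; this leaves vertices of \<open>I\<close> that are
  isolated from any one or two given cliques.
\<close>
lemma near_same:
  assumes I: "triple p I" and x: "x \<in> piece p I" and y: "y \<in> piece p I" and xy: "E x y"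
    and t: "t \<in> I" "t = x \<or> E x t"
  shows "t = y \<or> E y t"
proof (rule ccontr)
  assume n: "\<not> (t = y \<or> E y t)"
  then have xt: "E x t" using t xy sym by blast
  obtain u where u: "u \<in> I" "u \<noteq> t" "\<not> (u = y \<or> E y u)"
  proof -
    obtain u1 where u1: "u1 \<in> I" "u1 \<noteq> t" using third[of I t t] I unfolding triple_def by metis
    obtain u2 where u2: "u2 \<in> I" "u2 \<noteq> t" "u2 \<noteq> u1" using third[of I t u1] I unfolding triple_def by metis
    show ?thesis using near_unique[OF I y] u1 u2 that by metis
  qed
  have ux: "\<not> (u = x \<or> E x u)" using near_unique[OF I x] u t by metis
  show False
    using dart[of p t x y u] I x y t u ux xt xy n sym unfolding triple_def piece_def by blast
qed

lemma far_exists: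
  assumes I: "triple p I" and x: "x \<in> piece p I" and y: "y \<in> piece p I"
  obtains t where "t \<in> I" "t \<noteq> x" "\<not> E x t" "t \<noteq> y" "\<not> E y t"
proof -
  have I3: "card I = 3" using I by (simp add: triple_def)
  obtain t1 where t1: "t1 \<in> I" using third[OF I3] by metis
  obtain u where u: "u \<in> I" "\<And>t. t \<in> I \<Longrightarrow> t = x \<or> E x t \<Longrightarrow> t = u"
    using near_unique[OF I x] t1 by metis
  obtain v where v: "v \<in> I" "\<And>t. t \<in> I \<Longrightarrow> t = y \<or> E y t \<Longrightarrow> t = v"
    using near_unique[OF I y] t1 by metis
  obtain t where t: "t \<in> I" "t \<noteq> u" "t \<noteq> v" using third[OF I3] by metis
  then show ?thesis using that u v by blast
qed

text \<open>
  A vertex of \<open>I\<close> away from a \<open>P\<^sub>3\<close> of the piece would complete it to \<open>P\<^sub>3 + P\<^sub>1\<close> in \<open>N(p)\<close>.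
\<close>
lemma piece_P3_free:
  assumes I: "triple p I" and Q: "x \<in> piece p I" "y \<in> piece p I" "z \<in> piece p I"
    and e: "E x y" "E y z" "x \<noteq> z"
  shows "E x z"
proof (rule ccontr)
  assume n: "\<not> E x z"
  obtain t where t: "t \<in> I" "t \<noteq> y" "\<not> E y t" using far_exists[OF I Q(2) Q(2)] by metis
  have "\<not> E x t" "\<not> E z t"
    using near_same[OF I Q(1) Q(2) e(1) t(1)] near_same[OF I Q(3) Q(2) sym[OF e(2)] t(1)] t by blast+
  then show False
    using dart[of p x y z t] I Q e n t sym unfolding triple_def piece_def by blast
qed

text \<open>
  A vertex \<open>d\<close> of \<open>N(p)\<close> outside the piece is adjacent to all of \<open>I\<close>, and two vertices of \<open>I\<close> that are
  not adjacent to \<open>x\<close> form with \<open>d\<close> a \<open>P\<^sub>3\<close>.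
\<close>
lemma piece_complete:
  assumes I: "triple p I" and x: "x \<in> piece p I" and d: "d \<in> S" "E p d" "d \<notin> piece p I"
  shows "E d x"
proof (rule ccontr)
  assume n: "\<not> E d x"
  have dI: "E d t" if "t \<in> I" for t using d that by (auto simp: piece_def)
  have I3: "card I = 3" using I by (simp add: triple_def)
  obtain t where t: "t \<in> I" "t \<noteq> x" "\<not> E x t" using far_exists[OF I x x] by metis
  obtain u1 where u1: "u1 \<in> I" "u1 \<noteq> t" using third[OF I3] by metis
  obtain u2 where u2: "u2 \<in> I" "u2 \<noteq> t" "u2 \<noteq> u1" using third[OF I3] by metis
  obtain u where u: "u \<in> I" "u \<noteq> t" "\<not> E x u" using near_unique[OF I x] u1 u2 by metis
  show False
    using dart[of p t d u x] I x d t u n dI sym unfolding triple_def piece_def by blast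
qed

text \<open>
  For a disjoint union \<open>Q\<close> of cliques, the union of the cliques that \<open>z\<close> does not treat uniformly,
  without \<open>z\<close> itself.
\<close>
definition mixed :: "'a \<Rightarrow> 'a set \<Rightarrow> 'a set" where
  "mixed z Q = {w \<in> Q. w \<noteq> z \<and> (\<exists>w'\<in>Q. w' \<noteq> z \<and> E w w' \<and> (E z w \<longleftrightarrow> \<not> E z w'))}"

text \<open>
  Only one clique of a piece can be mixed for \<open>z\<close>. If two were, with neighbours \<open>a\<close>, \<open>b\<close> and non-neighbours
  \<open>a'\<close>, \<open>b'\<close> of \<open>z\<close>, a vertex \<open>t\<close> of \<open>I\<close> away from both cliques would finish a co-gem: the path \<open>a', a, z, b\<close>
  with \<open>t\<close>, or the path \<open>t, z, a, a'\<close> with \<open>b'\<close>, according to whether \<open>z\<close> and \<open>t\<close> are adjacent.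
\<close>
lemma mixed_clique:
  assumes I: "triple p I" and z: "z \<in> S" and u: "u \<in> mixed z (piece p I)"
    and w: "w \<in> mixed z (piece p I)" and "u \<noteq> w"
  shows "E u w"
proof (rule ccontr)
  assume n: "\<not> E u w"
  let ?Q = "piece p I"
  from u obtain u' where u': "u \<in> ?Q" "u \<noteq> z" "u' \<in> ?Q" "u' \<noteq> z" "E u u'" "E z u \<longleftrightarrow> \<not> E z u'"
    unfolding mixed_def by blast
  from w obtain w' where w': "w \<in> ?Q" "w \<noteq> z" "w' \<in> ?Q" "w' \<noteq> z" "E w w'" "E z w \<longleftrightarrow> \<not> E z w'"
    unfolding mixed_def by blast
  note P3 = piece_P3_free[OF I]
  have uw: "\<not> E u w" "\<not> E u w'" "\<not> E u' w" "\<not> E u' w'" "u \<noteq> w'" "u' \<noteq> w" "u' \<noteq> w'"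
    using P3 u' w' n \<open>u \<noteq> w\<close> sym by metis+
  obtain a a' where a: "a \<in> ?Q" "a' \<in> ?Q" "a \<in> {u, u'}" "a' \<in> {u, u'}" "E a a'" "E z a" "\<not> E z a'" "a' \<noteq> z"
    using u' sym by blast
  obtain b b' where b: "b \<in> ?Q" "b' \<in> ?Q" "b \<in> {w, w'}" "b' \<in> {w, w'}" "E b b'" "E z b" "\<not> E z b'" "b' \<noteq> z"
    using w' sym by blast
  have ab: "\<not> E a b" "\<not> E a' b" "\<not> E a b'" "\<not> E a' b'" using a b uw by auto
  have zQ: "z \<notin> ?Q" using P3[of z a a'] a by blast
  have zp: "z \<noteq> p" using a by (auto simp: piece_def)
  have "\<not> E p z" using piece_complete[OF I a(2) z _ zQ] a by blast
  obtain t where t: "t \<in> I" "t \<noteq> a" "\<not> E a t" "t \<noteq> b" "\<not> E b t" using far_exists[OF I a(1) b(1)] by metis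
  have t': "\<not> E a' t" "\<not> E b' t" "t \<noteq> a'" "t \<noteq> b'"
    using near_same[OF I a(2) a(1) sym[OF a(5)] t(1)] near_same[OF I b(2) b(1) sym[OF b(5)] t(1)] t by blast+
  have S: "a \<in> S" "a' \<in> S" "b \<in> S" "b' \<in> S" "t \<in> S" using a b t I by (auto simp: piece_def triple_def)
  show False
  proof (cases "E z t")
    case True
    then show False
      using cogem[of t z a a' b'] S z a b t t' ab sym by blast
  next
    case False
    then show False
      using cogem[of a' a z b t] S z a b t t' ab sym by blast
  qed
qed

text \<open>
  A mixed clique is mixed as a whole, so anchoring it leaves none of its vertices behind.
\<close>
lemma mixed_absorbs:
  assumes I: "triple p I" and t: "t \<in> mixed z (piece p I)" and w: "w \<in> piece p I" "E t w" "w \<noteq> z"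
  shows "w \<in> mixed z (piece p I)"
proof -
  from t obtain t' where t': "t \<in> piece p I" "t \<noteq> z" "t' \<in> piece p I" "t' \<noteq> z" "E t t'" "E z t \<longleftrightarrow> \<not> E z t'"
    unfolding mixed_def by blast
  have "w = t' \<or> E w t'" using piece_P3_free[OF I w(1) t'(1) t'(3)] w t' sym by blast
  moreover have "E t' t" "E w t" using t' w sym by blast+
  ultimately show ?thesis unfolding mixed_def using t' w by (cases "E z w = E z t") auto
qed

lemma card_clique_le:
  fixes col :: "'a \<Rightarrow> nat"
  assumes "K \<subseteq> S" and "\<And>u v. u \<in> K \<Longrightarrow> v \<in> K \<Longrightarrow> u \<noteq> v \<Longrightarrow> E u v"
    and "\<And>v. v \<in> K \<Longrightarrow> col v \<in> J" and "finite J"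
    and "\<And>u v. u \<in> S \<Longrightarrow> v \<in> S \<Longrightarrow> E u v \<Longrightarrow> col u \<noteq> col v"
  shows "card K \<le> card J"
proof (rule card_inj_on_le[of col])
  show "inj_on col K" using assms(1,2,5) unfolding inj_on_def by blast
  show "col ` K \<subseteq> J" using assms(3) by blast
qed (rule assms(4))

end

text \<open>
  The two summands bound \<open>T1\<close> and \<open>T2\<close> in the proof below: four vertices of an induced path, for each of
  them and each colour at most \<open>4 + k\<close> representatives, and then for each vertex of \<open>T1\<close> and each of
  at most \<open>4 * k\<close> pieces one mixed clique with at most \<open>k\<close> vertices.
\<close>
definition anchor_bound :: "nat \<Rightarrow> nat" where
  "anchor_bound k = (4 + 4 * (k * (4 + k))) + (4 + 4 * (k * (4 + k))) * (4 * (k * k))"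

lemma card_UN_bound:
  assumes "finite A" "card A \<le> a" "\<And>i. i \<in> A \<Longrightarrow> card (f i) \<le> b"
  shows "card (\<Union>i\<in>A. f i) \<le> a * b"
proof -
  have "card (\<Union>i\<in>A. f i) \<le> (\<Sum>i\<in>A. card (f i))" by (rule card_UN_le[OF assms(1)])
  also have "\<dots> \<le> card A * b" using sum_bounded_above[of A "\<lambda>i. card (f i)" b] assms(3) by simp
  also have "\<dots> \<le> a * b" using assms(2) by simp
  finally show ?thesis .
qed

context cogem_dart_free
begin

text \<open>
  The lists of a \<open>k\<close>-colourable graph in the class, read off from a colouring \<open>col\<close>. An induced path \<open>P\<close> on
  four vertices dominates the graph by co-gem-freeness. A colour class with more than three vertices
  in \<open>N(p)\<close> lies in one piece, and smaller ones are made anchors, so every other vertex is in a piece of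
  some \<open>p \<in> P\<close>. A vertex may use a colour if it is not adjacent to an anchor of that colour, and if
  the colour occurs in \<open>col\<close> on the same side of each \<open>p \<in> P\<close> and in each piece of the vertex. Two
  adjacent vertices that may both use a colour \<open>j\<close> then lie in the same pieces, hence in the same clique:
  a co-gem through representatives of \<open>j\<close> forbids that some \<open>p\<close> separates them, and a representative of \<open>j\<close>
  in a piece is adjacent to all vertices of \<open>N(p)\<close> outside that piece. Their lists could only differ if an
  anchor were mixed on their clique, and the cliques for which this happens are anchors as well (\<open>T2\<close>).
\<close>
theorem anchors:
  fixes col :: "'a \<Rightarrow> nat"
  assumes colk: "\<And>v. v \<in> S \<Longrightarrow> col v < k"
    and proper: "\<And>u v. u \<in> S \<Longrightarrow> v \<in> S \<Longrightarrow> E u v \<Longrightarrow> col u \<noteq> col v"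
  shows "\<exists>T L. T \<subseteq> S \<and> card T \<le> anchor_bound k \<and> list_good S E L \<and>
     (\<forall>v\<in>S. col v \<in> L v \<and> L v \<subseteq> {..<k}) \<and>
     (\<forall>v\<in>S. \<forall>w\<in>S. (\<forall>t\<in>T. (v = t \<longleftrightarrow> w = t) \<and> (E v t \<longleftrightarrow> E w t)) \<longrightarrow> L v = L w)"
proof (cases "\<exists>a\<in>S. \<exists>b\<in>S. \<exists>c\<in>S. \<exists>d\<in>S. E a b \<and> E b c \<and> E c d \<and> \<not> E a c \<and> \<not> E a d \<and> \<not> E b d")
  case False
  then show ?thesis
    by (intro exI[of _ "{}"] exI[of _ "\<lambda>_. {..<k}"]) (auto simp: list_good_def colk)
next
  case True
  then obtain p1 p2 p3 p4 where p: "p1 \<in> S" "p2 \<in> S" "p3 \<in> S" "p4 \<in> S" "E p1 p2" "E p2 p3" "E p3 p4"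
      "\<not> E p1 p3" "\<not> E p1 p4" "\<not> E p2 p4"
    by blast
  define P where "P = {p1, p2, p3, p4}"
  have PS: "P \<subseteq> S" and finP: "finite P" and cardP: "card P \<le> 4"
    using p by (auto simp: P_def card_insert_if)
  have dom: "\<exists>p\<in>P. E p w" if "w \<in> S" for w
    using cogem[of p1 p2 p3 p4 w] p that sym unfolding P_def by blast
  define N where "N p = {x \<in> S. E p x}" for p
  define M where "M p = {x \<in> S. x \<noteq> p \<and> \<not> E p x}" for p
  define C where "C j = {x \<in> S. col x = j}" for j
  define I where "I p j = pick 3 (N p \<inter> C j)" for p j
  define Q where "Q p j = piece p (I p j)" for p j
  have finNC: "finite (N p \<inter> X)" "finite (M p \<inter> X)" "finite (Q p j \<inter> X)" for p j X
    using fin by (auto simp: N_def M_def Q_def piece_def)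
  have trip: "triple p (I p j)" if "p \<in> P" "card (I p j) = 3" for p j
  proof -
    have "I p j \<subseteq> N p \<inter> C j" unfolding I_def by (rule pick_subset)
    then show ?thesis using that PS proper unfolding triple_def N_def C_def by blast
  qed
  (* The representatives: enough of C j in N(p), one of C j among the non-neighbours of p, and one
     of C j in each piece of p. *)
  define T0 where "T0 p j = I p j \<union> pick 1 (M p \<inter> C j) \<union> (\<Union>i<k. pick 1 (Q p i \<inter> C j))" for p j
  define T1 where "T1 = P \<union> (\<Union>p\<in>P. \<Union>j<k. T0 p j)"
  define T2 where "T2 = (\<Union>z\<in>T1. \<Union>p\<in>P. \<Union>j\<in>{j. j < k \<and> card (I p j) = 3}. mixed z (Q p j))"
  have T0S: "T0 p j \<subseteq> S" for p j
    using pick_subset[of 3 "N p \<inter> C j"] pick_subset[of 1 "M p \<inter> C j"] pick_subset[of 1 "Q p i \<inter> C j" for i]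
    unfolding T0_def I_def C_def by blast
  have T1S: "T1 \<subseteq> S" using T0S PS unfolding T1_def by blast
  have finT1: "finite T1" using T1S fin by (rule finite_subset)
  have T2S: "T2 \<subseteq> S" unfolding T2_def mixed_def Q_def piece_def by blast
  have cT0: "card (T0 p j) \<le> 4 + k" for p j
  proof -
    have "card (\<Union>i<k. pick 1 (Q p i \<inter> C j)) \<le> k * 1"
      by (rule card_UN_bound) (auto intro: card_pick)
    moreover have "card (I p j) \<le> 3" "card (pick 1 (M p \<inter> C j)) \<le> 1"
      unfolding I_def by (rule card_pick)+
    moreover have "card (T0 p j) \<le> card (I p j) + card (pick 1 (M p \<inter> C j)) + card (\<Union>i<k. pick 1 (Q p i \<inter> C j))"
      unfolding T0_def by (meson add_mono card_Un_le le_refl order_trans)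
    ultimately show ?thesis by simp
  qed
  have cT1: "card T1 \<le> 4 + 4 * (k * (4 + k))"
  proof -
    have "card (\<Union>p\<in>P. \<Union>j<k. T0 p j) \<le> 4 * (k * (4 + k))"
      by (intro card_UN_bound finP cardP) (auto intro: cT0)
    then show ?thesis unfolding T1_def
      by (meson add_mono card_Un_le order_trans cardP)
  qed
  have cmix: "card (mixed z (Q p j)) \<le> k" if "z \<in> T1" "p \<in> P" "card (I p j) = 3" for z p j
  proof -
    have "card (mixed z (Q p j)) \<le> card {..<k}"
    proof (rule card_clique_le)
      show "mixed z (Q p j) \<subseteq> S" by (auto simp: mixed_def Q_def piece_def)
      show "E u v" if "u \<in> mixed z (Q p j)" "v \<in> mixed z (Q p j)" "u \<noteq> v" for u v
        using mixed_clique[OF trip] that \<open>p \<in> P\<close> \<open>card (I p j) = 3\<close> \<open>z \<in> T1\<close> T1S unfolding Q_def by blast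
      show "col v \<in> {..<k}" if "v \<in> mixed z (Q p j)" for v
        using that colk by (auto simp: mixed_def Q_def piece_def)
    qed (use proper in auto)
    then show ?thesis by simp
  qed
  have cT2: "card T2 \<le> (4 + 4 * (k * (4 + k))) * (4 * (k * k))"
    unfolding T2_def
  proof (intro card_UN_bound finT1 cT1 finP cardP)
    show "card {j. j < k \<and> card (I p j) = 3} \<le> k" for p
      using card_mono[of "{..<k}" "{j. j < k \<and> card (I p j) = 3}"] by auto
  qed (auto intro: cmix)
  define T where "T = T1 \<union> T2"
  have cT: "card T \<le> anchor_bound k"
    unfolding T_def anchor_bound_def by (rule order_trans[OF card_Un_le add_mono[OF cT1 cT2]])
  (* T2 is coloured by hand only; the lists of the other vertices are computed from T1 alone, so
     that adding T2 to the anchors does not create new mixed cliques. *)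
  define L1 where "L1 w = {j. j < k \<and> (\<forall>z\<in>T1. col z = j \<longrightarrow> \<not> E w z) \<and>
      (\<forall>p\<in>P. (E p w \<longrightarrow> N p \<inter> C j \<noteq> {}) \<and> (\<not> E p w \<longrightarrow> M p \<inter> C j \<noteq> {}) \<and>
        (\<forall>i<k. card (I p i) = 3 \<longrightarrow> w \<in> Q p i \<longrightarrow> Q p i \<inter> C j \<noteq> {}))}" for w
  define L where "L w = (if w \<in> T then {col w} else L1 w)" for w
  have colL1: "col w \<in> L1 w" if "w \<in> S" "w \<notin> T1" for w
  proof -
    have wC: "w \<in> C (col w)" and wP: "\<And>p. p \<in> P \<Longrightarrow> w \<noteq> p" using that by (auto simp: C_def T1_def)
    have "N p \<inter> C (col w) \<noteq> {}" if "E p w" for p using that wC \<open>w \<in> S\<close> by (auto simp: N_def)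
    moreover have "M p \<inter> C (col w) \<noteq> {}" if "p \<in> P" "\<not> E p w" for p
      using that wC wP[of p] \<open>w \<in> S\<close> unfolding M_def by blast
    moreover have "\<not> E w z" if "z \<in> T1" "col z = col w" for z
      using that proper[of w z] \<open>w \<in> S\<close> T1S by auto
    moreover have "Q p i \<inter> C (col w) \<noteq> {}" if "w \<in> Q p i" for p i using that wC by blast
    ultimately show ?thesis
      unfolding L1_def using colk[OF \<open>w \<in> S\<close>] by simp
  qed
  have in_piece: "\<exists>p\<in>P. \<exists>j<k. card (I p j) = 3 \<and> w \<in> Q p j" if w: "w \<in> S" "w \<notin> T1" for w
  proof -
    obtain q where q: "q \<in> P" "E q w" using dom w by blast
    let ?j = "col w"
    have jk: "?j < k" using colk w by blast
    have wN: "w \<in> N q \<inter> C ?j" using q w by (auto simp: N_def C_def)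
    have "T0 q ?j \<subseteq> T1" using q jk unfolding T1_def by blast
    then have IT: "I q ?j \<subseteq> T1" unfolding T0_def by blast
    then have "w \<notin> I q ?j" using w by blast
    then have c3: "card (I q ?j) = 3"
      unfolding I_def using pick_small[OF finNC(1) wN] by blast
    then obtain t where t: "t \<in> I q ?j" by (metis card.empty ex_in_conv zero_neq_numeral)
    then have "t \<in> S" "col t = ?j" using pick_subset[of 3 "N q \<inter> C ?j"] unfolding I_def C_def by blast+
    then have "\<not> E w t" using proper w by metis
    then have "w \<in> Q q ?j" using t q w unfolding Q_def piece_def by blast
    then show ?thesis using q jk c3 by blast
  qed
  (* If v is in N(q) and w is not, then representatives x and y of the colour j on the two sides of q
     give the co-gem with path w, v, q, x and isolated vertex y. *)
  have same_nbr: "E q w" if v: "v \<in> S" "v \<notin> T1" and w: "w \<in> S" "w \<notin> T1" and vw: "E v w"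
      and j: "j \<in> L1 v" "j \<in> L1 w" and q: "q \<in> P" "E q v" for v w j q
  proof (rule ccontr)
    assume n: "\<not> E q w"
    have jk: "j < k" using j by (simp add: L1_def)
    have sub: "T0 q j \<subseteq> T1" using q jk unfolding T1_def by blast
    have "N q \<inter> C j \<noteq> {}" "M q \<inter> C j \<noteq> {}" using j q n unfolding L1_def by blast+
    then have "I q j \<noteq> {}" "pick 1 (M q \<inter> C j) \<noteq> {}"
      unfolding I_def using pick_nonempty[OF finNC(1)] pick_nonempty[OF finNC(2)] by simp_all
    then obtain x y where xI: "x \<in> I q j" and yM: "y \<in> pick 1 (M q \<inter> C j)" by blast
    have x: "x \<in> N q \<inter> C j" using pick_subset[of 3 "N q \<inter> C j"] xI unfolding I_def by blast
    have y: "y \<in> M q \<inter> C j" using pick_subset[of 1 "M q \<inter> C j"] yM by blast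
    have xyT: "x \<in> T1" "y \<in> T1" using xI yM sub unfolding T0_def by blast+
    have cj: "col x = j" "col y = j" using x y by (auto simp: C_def)
    have ne: "\<not> E v x" "\<not> E v y" "\<not> E w x" "\<not> E w y" using j xyT cj unfolding L1_def by blast+
    have xy: "\<not> E x y" using proper[of x y] x y cj by (auto simp: C_def)
    have "q \<in> S" using q PS by blast
    moreover have "E q x" "\<not> E q y" "x \<in> S" "y \<in> S" using x y by (auto simp: N_def M_def)
    ultimately show False
      using cogem[of w v q x y] v w vw q n ne xy sym by blast
  qed
  have same_piece: "w \<in> Q q i" if v: "v \<in> S" "v \<notin> T1" and w: "w \<in> S" "w \<notin> T1" and vw: "E v w"
      and j: "j \<in> L1 v" "j \<in> L1 w" and q: "q \<in> P" "i < k" "card (I q i) = 3" "v \<in> Q q i" for v w j q i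
  proof (rule ccontr)
    assume n: "w \<notin> Q q i"
    have jk: "j < k" using j by (simp add: L1_def)
    have "E q v" using q by (auto simp: Q_def piece_def)
    then have qw: "E q w" using same_nbr[OF v w vw j q(1)] by blast
    have "Q q i \<inter> C j \<noteq> {}" using j q unfolding L1_def by blast
    then have "pick 1 (Q q i \<inter> C j) \<noteq> {}" using pick_nonempty[OF finNC(3)] by simp
    then obtain x where x1: "x \<in> pick 1 (Q q i \<inter> C j)" by blast
    then have x: "x \<in> Q q i \<inter> C j" by (rule subsetD[OF pick_subset])
    have "x \<in> T0 q j" using x1 q(2) unfolding T0_def by blast
    then have "x \<in> T1" using q(1) jk unfolding T1_def by blast
    moreover have "col x = j" using x by (simp add: C_def)
    ultimately have "\<not> E w x" using j unfolding L1_def by blast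
    then show False
      using piece_complete[OF trip[OF q(1,3)], of x w] x w qw n unfolding Q_def by blast
  qed
  (* An anchor of T2 shares no colour with an adjacent vertex outside T: that vertex would belong to
     the same mixed clique. *)
  have L1_in_T: "w \<in> T" if v: "v \<in> S" "v \<notin> T1" "v \<in> T" and w: "w \<in> S" "w \<notin> T1" and vw: "E v w"
      and j: "j \<in> L1 v" "j \<in> L1 w" for v w j
  proof -
    have "v \<in> T2" using v by (simp add: T_def)
    then obtain z q i where z: "z \<in> T1" "q \<in> P" "i < k" "card (I q i) = 3" "v \<in> mixed z (Q q i)"
      unfolding T2_def by blast
    then have "v \<in> Q q i" by (simp add: mixed_def)
    then have "w \<in> Q q i" using same_piece[OF v(1,2) w vw j z(2-4)] by blast
    then have "w \<in> mixed z (Q q i)"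
      using mixed_absorbs[OF trip[OF z(2,4)], of v z w] z w vw unfolding Q_def by blast
    then show ?thesis using z unfolding T_def T2_def by blast
  qed
  have conflict: "v \<notin> T \<and> w \<notin> T" if v: "v \<in> S" and w: "w \<in> S" and vw: "E v w" and j: "j \<in> L v" "j \<in> L w" for v w j
  proof -
    have half: False if v: "v \<in> S" and w: "w \<in> S" and vw: "E v w" and j: "j \<in> L v" "j \<in> L w" and vT: "v \<in> T" for v w j
    proof -
      have cv: "col v = j" using j vT by (simp add: L_def)
      have wT: "w \<notin> T" using proper[OF v w vw] cv j by (auto simp: L_def)
      then have wL: "j \<in> L1 w" "w \<notin> T1" using j by (auto simp: L_def T_def)
      have "v \<notin> T1" using wL(1) cv sym[OF vw] unfolding L1_def by blast
      then show False
        using L1_in_T[OF v _ vT w wL(2) vw _ wL(1)] colL1[OF v] cv wT by blast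
    qed
    show ?thesis using half[OF v w vw j] half[OF w v sym[OF vw] j(2,1)] by blast
  qed
  have stay: "w \<in> Q q i" if "v \<in> S" "w \<in> S" "E v w" "j \<in> L v" "j \<in> L w" "q \<in> P" "i < k" "card (I q i) = 3" "v \<in> Q q i" for v w j q i
    using conflict[OF that(1-5)] same_piece[of v w j q i] that by (auto simp: L_def T_def)
  have L1_cong: "L1 v = L1 w" if "v \<in> S" "w \<in> S" and eq: "\<And>z. z \<in> T1 \<Longrightarrow> E v z \<longleftrightarrow> E w z" for v w
  proof -
    have "E p v \<longleftrightarrow> E p w" if "p \<in> P" for p using eq[of p] that sym unfolding T1_def by blast
    moreover have "v \<in> Q p i \<longleftrightarrow> w \<in> Q p i" if "p \<in> P" "i < k" for p i
    proof -
      have "I p i \<subseteq> T1" using that unfolding T1_def T0_def by blast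
      then show ?thesis using eq \<open>v \<in> S\<close> \<open>w \<in> S\<close> \<open>p \<in> P \<Longrightarrow> E p v \<longleftrightarrow> E p w\<close>[OF that(1)]
        unfolding Q_def piece_def by blast
    qed
    ultimately show ?thesis unfolding L1_def using eq by auto
  qed
  have same_list: "L v = L w" if "v \<in> S" "w \<in> S" "E v w" and j: "j \<in> L v" "j \<in> L w" for v w j
  proof -
    have nT: "v \<notin> T" "w \<notin> T" using conflict[OF that] by blast+
    then obtain q i where q: "q \<in> P" "i < k" "card (I q i) = 3" "v \<in> Q q i"
      using in_piece[of v] \<open>v \<in> S\<close> by (auto simp: T_def)
    have wQ: "w \<in> Q q i" using stay[OF that q] .
    have "E v z \<longleftrightarrow> E w z" if z: "z \<in> T1" for z
    proof (rule ccontr)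
      assume "(E v z) \<noteq> (E w z)"
      then have Ez: "E z v \<longleftrightarrow> \<not> E z w" using sym by blast
      then have "v \<in> mixed z (Q q i)"
        unfolding mixed_def T_def using q wQ z nT Ez \<open>E v w\<close> by (auto simp: T_def)
      then have "v \<in> T" unfolding T_def T2_def using q z by blast
      then show False using nT by blast
    qed
    then have "L1 v = L1 w" using L1_cong that by blast
    then show ?thesis using nT by (simp add: L_def)
  qed
  have colL: "col v \<in> L v" if "v \<in> S" for v
    using colL1[OF that] by (auto simp: L_def T_def)
  have P4: "E a c" if S: "a \<in> S" "b \<in> S" "c \<in> S" and l: "L a = L b" "L b = L c" and e: "E a b" "E b c" "a \<noteq> c" for a b c
  proof -
    have j: "col a \<in> L a" "col a \<in> L b" "col a \<in> L c" using colL S l by auto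
    have "a \<notin> T" using conflict[OF S(1,2) e(1) j(1,2)] by blast
    then obtain q i where q: "q \<in> P" "i < k" "card (I q i) = 3" "a \<in> Q q i"
      using in_piece[of a] S by (auto simp: T_def)
    have b: "b \<in> Q q i" using stay[OF S(1,2) e(1) j(1,2) q] .
    have c: "c \<in> Q q i" using stay[OF S(2,3) e(2) j(2,3) q(1-3) b] .
    show ?thesis using piece_P3_free[OF trip[OF q(1,3)]] q(4) b c e unfolding Q_def by blast
  qed
  have good: "list_good S E L"
    unfolding list_good_def
  proof (intro conjI ballI impI)
    show "L u = L v" if "u \<in> S" "v \<in> S" "E u v \<and> L u \<inter> L v \<noteq> {}" for u v
      using same_list that by blast
    show "E a c \<or> E a d \<or> E b d" if "a \<in> S" "b \<in> S" "c \<in> S" "d \<in> S"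
      "L a = L b \<and> L b = L c \<and> L c = L d \<and> E a b \<and> E b c \<and> E c d" for a b c d
      using P4[of a b c] that by metis
  qed
  have Lk: "L v \<subseteq> {..<k}" if "v \<in> S" for v
    using colk[OF that] by (auto simp: L_def L1_def)
  have cong: "L v = L w" if "v \<in> S" "w \<in> S" "\<forall>t\<in>T. (v = t \<longleftrightarrow> w = t) \<and> (E v t \<longleftrightarrow> E w t)" for v w
  proof (cases "v \<in> T")
    case True
    then show ?thesis using that by auto
  next
    case False
    then have "w \<notin> T" using that by auto
    moreover have "L1 v = L1 w" by (rule L1_cong) (use that in \<open>auto simp: T_def\<close>)
    ultimately show ?thesis using False by (simp add: L_def)
  qed
  have TS: "T \<subseteq> S" using T1S T2S by (simp add: T_def)
  show ?thesis
  proof (intro exI conjI ballI impI)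
    show "L v = L w" if "v \<in> S" "w \<in> S" "\<forall>t\<in>T. (v = t \<longleftrightarrow> w = t) \<and> (E v t \<longleftrightarrow> E w t)" for v w
      using that by (rule cong)
  qed (fact TS cT good colL Lk)+
qed

end

section \<open>First-fit colouring with lists\<close>

text \<open>
  \<open>f\<close> is the first-fit colouring of the vertices below \<open>w\<close>: the colour of \<open>v\<close> is free at \<open>v\<close>, and the
  smaller colours in its list are not.
\<close>
definition greedy :: "nat set \<Rightarrow> (nat \<Rightarrow> nat \<Rightarrow> bool) \<Rightarrow> (nat \<Rightarrow> nat set) \<Rightarrow> (nat \<Rightarrow> nat) \<Rightarrow> nat \<Rightarrow> bool" where
  "greedy S E L f w \<longleftrightarrow> (\<forall>v\<in>S. v < w \<longrightarrow> f v \<in> L v \<and>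
     (\<forall>j\<in>L v. j \<le> f v \<longrightarrow> (j < f v \<longleftrightarrow> (\<exists>u\<in>S. u < v \<and> E v u \<and> f u = j))))"

text \<open>
  First-fit is optimal on \<open>P\<^sub>4\<close>-free graphs, for any order of the vertices. If all colours of \<open>L w\<close> are
  blocked, then the vertices with the list \<open>L w\<close> contain a clique with \<open>w\<close> and one vertex of each colour of
  \<open>L w\<close>. It has more vertices than \<open>L w\<close> has colours, which the proper colouring \<open>col\<close> does not allow.
\<close>
theorem greedy_not_stuck:
  assumes fin: "finite S" and sym: "\<And>u v. E u v \<Longrightarrow> E v u" and irr: "\<And>u. \<not> E u u"
    and colL: "\<And>v. v \<in> S \<Longrightarrow> col v \<in> L v" and finL: "\<And>v. v \<in> S \<Longrightarrow> finite (L v)"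
    and proper: "\<And>u v. u \<in> S \<Longrightarrow> v \<in> S \<Longrightarrow> E u v \<Longrightarrow> col u \<noteq> col v"
    and good: "list_good S E L" and gr: "greedy S E L f w" and w: "w \<in> S"
  shows "\<exists>j\<in>L w. \<forall>u\<in>S. u < w \<and> E w u \<longrightarrow> f u \<noteq> j"
proof (rule ccontr)
  assume stuck: "\<not> ?thesis"
  let ?A = "L w"
  define g where "g v = (if v = w then Max ?A + 1 else f v)" for v
  have fA: "finite ?A" using finL w .
  have grv: "f v \<in> L v" "\<And>j. j \<in> L v \<Longrightarrow> j \<le> f v \<Longrightarrow> j < f v \<longleftrightarrow> (\<exists>u\<in>S. u < v \<and> E v u \<and> f u = j)"
    if "v \<in> S" "v < w" for v using gr that unfolding greedy_def by blast+
  have fproper: "f u \<noteq> f v" if "u \<in> S" "v \<in> S" "u < w" "v < w" "E u v" for u v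
  proof -
    have *: "f a \<noteq> f b" if "a \<in> S" "b \<in> S" "a < b" "b < w" "E b a" for a b
      using grv(1)[of b] grv(2)[of b "f b"] that by blast
    have "u \<noteq> v" using that irr by blast
    then show ?thesis using *[of u v] *[of v u] that sym by (metis linorder_neqE_nat)
  qed
  define V where "V = {v \<in> S. L v = ?A \<and> v < w}"
  have down: "\<exists>u\<in>V. E v u \<and> f u = j" if v: "v \<in> insert w V" and j: "j \<in> ?A" "v = w \<or> j < f v" for v j
  proof -
    have vS: "v \<in> S" "L v = ?A" "v \<le> w" using v w by (auto simp: V_def)
    have "\<exists>u\<in>S. u < v \<and> E v u \<and> f u = j"
    proof (cases "v = w")
      case True
      then show ?thesis using stuck j by blast
    next
      case False
      then show ?thesis using grv(2)[of v j] vS j by auto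
    qed
    then obtain u where u: "u \<in> S" "u < v" "E v u" "f u = j" by blast
    then have "j \<in> L u" using grv(1)[of u] vS by auto
    then have "L v = L u" using good u vS j unfolding list_good_def by blast
    then show ?thesis using u vS by (auto simp: V_def)
  qed
  have P4: "E a c \<or> E a d \<or> E b d"
    if "a \<in> insert w V" "b \<in> insert w V" "c \<in> insert w V" "d \<in> insert w V" "E a b" "E b c" "E c d" for a b c d
  proof -
    have "a \<in> S" "b \<in> S" "c \<in> S" "d \<in> S" "L a = L b" "L b = L c" "L c = L d"
      using that w by (auto simp: V_def)
    then show ?thesis using good that unfolding list_good_def by blast
  qed
  have finV: "finite V" using fin by (simp add: V_def)
  (* A clique with one vertex of every colour above i extends to colour i: every vertex of it has a
     neighbour of colour i, and a vertex of colour i with the most neighbours in the clique misses none,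
     because otherwise two vertices of colour i and two of the clique form an induced path. *)
  have clique: "\<exists>K. K \<subseteq> insert w V \<and> w \<in> K \<and> (\<forall>u\<in>K. \<forall>v\<in>K. u \<noteq> v \<longrightarrow> E u v) \<and> f ` (K - {w}) = B \<and> card K = card B + 1"
    if "finite B" "B \<subseteq> ?A" "\<forall>j\<in>?A. \<forall>i\<in>B. i \<le> j \<longrightarrow> j \<in> B" for B
    using that
  proof (induction "card B" arbitrary: B)
    case 0
    then have "B = {}" by simp
    then show ?case by (intro exI[of _ "{w}"]) auto
  next
    case (Suc r)
    then have ne: "B \<noteq> {}" by auto
    define i where "i = Min B"
    have iB: "i \<in> B" using ne Suc by (simp add: i_def)
    have imin: "i < j" if "j \<in> B - {i}" for j
    proof -
      have "i \<le> j" using that Suc unfolding i_def by simp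
      then show ?thesis using that by auto
    qed
    have cB: "r = card (B - {i})" using Suc(2) iB Suc(3) by simp
    have up: "\<forall>j\<in>?A. \<forall>i'\<in>B - {i}. i' \<le> j \<longrightarrow> j \<in> B - {i}"
      using Suc(5) imin by fastforce
    have fB: "finite (B - {i})" and sB: "B - {i} \<subseteq> ?A" using Suc(3,4) by auto
    obtain K where K: "K \<subseteq> insert w V" "w \<in> K" "\<forall>u\<in>K. \<forall>v\<in>K. u \<noteq> v \<longrightarrow> E u v"
        "f ` (K - {w}) = B - {i}" "card K = card (B - {i}) + 1"
      using Suc(1)[OF cB fB sB up] by blast
    have finK: "finite K" using K(1) finV finite_subset by blast
    have iA: "i \<in> ?A" using iB Suc(4) by blast
    have nb: "\<exists>u\<in>V. E v u \<and> f u = i" if "v \<in> K" for v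
    proof (rule down)
      show "v = w \<or> i < f v" using K(4) that imin by blast
    qed (use that K(1) iA in auto)
    define U where "U = {u \<in> V. f u = i}"
    have "U \<noteq> {}" using nb K(2) by (auto simp: U_def)
    have finU: "finite U" using finV by (simp add: U_def)
    obtain u where u: "u \<in> U" "\<And>u'. u' \<in> U \<Longrightarrow> card {v \<in> K. E u' v} \<le> card {v \<in> K. E u v}"
    proof -
      let ?d = "\<lambda>u. card {v \<in> K. E u v}"
      have "Max (?d ` U) \<in> ?d ` U" using finU \<open>U \<noteq> {}\<close> by (intro Max_in) auto
      then obtain u where "u \<in> U" "?d u = Max (?d ` U)" by auto
      moreover have "?d u' \<le> Max (?d ` U)" if "u' \<in> U" for u' using finU that by (intro Max_ge) auto
      ultimately show ?thesis using that by simp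
    qed
    have all: "E u v" if v: "v \<in> K" for v
    proof (rule ccontr)
      assume n: "\<not> E u v"
      obtain u' where u': "u' \<in> U" "E v u'" using nb[OF v] by (auto simp: U_def)
      have "\<not> {x \<in> K. E u x} \<subseteq> {x \<in> K. E u' x}"
      proof
        assume "{x \<in> K. E u x} \<subseteq> {x \<in> K. E u' x}"
        moreover have "v \<in> {x \<in> K. E u' x} - {x \<in> K. E u x}" using v u' n sym by blast
        ultimately have "card {x \<in> K. E u x} < card {x \<in> K. E u' x}"
          using finK by (intro psubset_card_mono) auto
        then show False using u(2)[OF u'(1)] by simp
      qed
      then obtain d where d: "d \<in> K" "E u d" "\<not> E u' d" by blast
      have "d \<noteq> v" using d(2) n by auto
      then have dv: "E d v" using K(3) d(1) v by simp
      have uu': "\<not> E u u'" using fproper[of u u'] u u' by (auto simp: U_def V_def)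
      have "u \<in> insert w V" "u' \<in> insert w V" "d \<in> insert w V" "v \<in> insert w V"
        using u(1) u'(1) d(1) v K(1) by (auto simp: U_def)
      then show False
        using P4[of u d v u'] d(2,3) dv u'(2) uu' n sym[of d u'] by blast
    qed
    have uK: "u \<notin> K" using all irr by blast
    have uw: "u \<noteq> w" using uK K(2) by blast
    show ?case
    proof (intro exI[of _ "insert u K"] conjI)
      show "insert u K \<subseteq> insert w V" using K(1) u(1) by (auto simp: U_def)
      have "\<And>v. v \<in> K \<Longrightarrow> E v u" using all sym by blast
      then show "\<forall>x\<in>insert u K. \<forall>v\<in>insert u K. x \<noteq> v \<longrightarrow> E x v" using K(3) all by simp
      have "insert u K - {w} = insert u (K - {w})" using uw by blast
      then show "f ` (insert u K - {w}) = B" using K(4) u(1) iB by (auto simp: U_def)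
      show "card (insert u K) = card B + 1"
        using uK finK K(5) Suc(2) cB by simp
    qed (use K(2) in simp)
  qed
  obtain K where K: "K \<subseteq> insert w V" "\<forall>u\<in>K. \<forall>v\<in>K. u \<noteq> v \<longrightarrow> E u v" "card K = card ?A + 1"
    using clique[OF fA] by blast
  have KS: "K \<subseteq> S" using K(1) w by (auto simp: V_def)
  have "inj_on col K" unfolding inj_on_def using K(2) KS proper by blast
  moreover have "col ` K \<subseteq> ?A" using K(1) colL w by (fastforce simp: V_def)
  ultimately have "card K \<le> card ?A" using fA card_inj_on_le by blast
  then show False using K(3) by simp
qed

section \<open>Programs that halt in polynomial time\<close>
primrec writes :: "com \<Rightarrow> string set" where
  "writes Skip = {}"
| "writes (Assign x a b) = {x}"
| "writes (Seq c d) = writes c \<union> writes d"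
| "writes (Cond b c d) = writes c \<union> writes d"
| "writes (While b c) = writes c"

definition frame :: "com \<Rightarrow> store \<Rightarrow> store \<Rightarrow> bool" where
  "frame c s s' \<longleftrightarrow> (\<forall>x. x \<notin> writes c \<longrightarrow> s' x = s x)"

lemma frameD: "frame c s s' \<Longrightarrow> writes c \<subseteq> X \<Longrightarrow> x \<notin> X \<Longrightarrow> s' x = s x"
  unfolding frame_def by blast

lemma exec_frame: "exec c s t s' \<Longrightarrow> frame c s s'"
  unfolding frame_def by (induction rule: exec.induct) auto

text \<open>
  A relational specification whose time bound is a polynomial in \<open>n\<close> that is existentially quantified
  and uniform in the store. Bounds then compose without being computed: a sequence adds the polynomials
  and a loop multiplies them.
\<close>
definition runs :: "(store \<Rightarrow> bool) \<Rightarrow> com \<Rightarrow> (store \<Rightarrow> store \<Rightarrow> bool) \<Rightarrow> bool" where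
  "runs P c Q \<longleftrightarrow> (\<exists>p :: nat poly. \<forall>s. P s \<longrightarrow> halts_within c s (poly p (s ''n'' 0)) (Q s))"

lemma runs_conseq:
  assumes "runs P c Q" "\<And>s. P' s \<Longrightarrow> P s" "\<And>s s'. P' s \<Longrightarrow> Q s s' \<Longrightarrow> frame c s s' \<Longrightarrow> Q' s s'"
  shows "runs P' c Q'"
proof -
  from assms(1) obtain p where p: "\<And>s. P s \<Longrightarrow> halts_within c s (poly p (s ''n'' 0)) (Q s)"
    unfolding runs_def by blast
  have "halts_within c s (poly p (s ''n'' 0)) (Q' s)" if "P' s" for s
    using p[OF assms(2)[OF that]] assms(3)[OF that] exec_frame unfolding halts_within_def by blast
  then show ?thesis unfolding runs_def by blast
qed

lemma runs_Skip:
  assumes "\<And>s. P s \<Longrightarrow> Q s s"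
  shows "runs P Skip Q"
  unfolding runs_def halts_within_def
proof (intro exI[of _ "[:1:]"] allI impI)
  fix s assume "P s"
  then have "Q s s" by (rule assms)
  then show "\<exists>t s'. exec Skip s t s' \<and> t \<le> poly [:1:] (s ''n'' 0) \<and> Q s s'"
    by (intro exI conjI) (rule exec_Skip, simp, assumption)
qed

lemma runs_Assign:
  assumes "\<And>s. P s \<Longrightarrow> Q s (s(x := (s x)(aval a s := aval b s)))"
  shows "runs P (Assign x a b) Q"
  unfolding runs_def halts_within_def
proof (intro exI[of _ "[:1:]"] allI impI)
  fix s assume "P s"
  then have "Q s (s(x := (s x)(aval a s := aval b s)))" by (rule assms)
  then show "\<exists>t s'. exec (Assign x a b) s t s' \<and> t \<le> poly [:1:] (s ''n'' 0) \<and> Q s s'"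
    by (intro exI conjI) (rule exec_Assign, simp, assumption)
qed

lemma runs_Seq:
  assumes c: "runs P c R" and d: "runs P' d R'" and n: "''n'' \<notin> writes c"
    and pre: "\<And>s s'. P s \<Longrightarrow> R s s' \<Longrightarrow> frame c s s' \<Longrightarrow> P' s'"
    and post: "\<And>s s' s''. P s \<Longrightarrow> R s s' \<Longrightarrow> R' s' s'' \<Longrightarrow> frame c s s' \<Longrightarrow> frame d s' s'' \<Longrightarrow> Q s s''"
  shows "runs P (Seq c d) Q"
proof -
  from c obtain p where p: "\<And>s. P s \<Longrightarrow> halts_within c s (poly p (s ''n'' 0)) (R s)"
    unfolding runs_def by blast
  from d obtain q where q: "\<And>s. P' s \<Longrightarrow> halts_within d s (poly q (s ''n'' 0)) (R' s)"
    unfolding runs_def by blast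
  have "halts_within (Seq c d) s (poly (p + q) (s ''n'' 0)) (Q s)" if P: "P s" for s
  proof -
    obtain t s' where 1: "exec c s t s'" "t \<le> poly p (s ''n'' 0)" "R s s'"
      using p[OF P] unfolding halts_within_def by blast
    have f: "frame c s s'" by (rule exec_frame[OF 1(1)])
    then have sn: "s' ''n'' = s ''n''" using n by (simp add: frame_def)
    obtain u s'' where 2: "exec d s' u s''" "u \<le> poly q (s' ''n'' 0)" "R' s' s''"
      using q[OF pre[OF P 1(3) f]] unfolding halts_within_def by blast
    have "exec (Seq c d) s (t + u) s''" by (rule exec_Seq[OF 1(1) 2(1)])
    moreover have "t + u \<le> poly (p + q) (s ''n'' 0)" using 1(2) 2(2) sn by simp
    ultimately show ?thesis
      using post[OF P 1(3) 2(3) f exec_frame[OF 2(1)]] unfolding halts_within_def by blast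
  qed
  then show ?thesis unfolding runs_def by blast
qed

lemma runs_Assign_Seq:
  assumes d: "runs P' d R'" and "x \<noteq> ''n''"
    and "\<And>s. P s \<Longrightarrow> P' (s(x := (s x)(aval a s := aval b s)))"
    and "\<And>s s''. P s \<Longrightarrow> R' (s(x := (s x)(aval a s := aval b s))) s'' \<Longrightarrow>
      frame d (s(x := (s x)(aval a s := aval b s))) s'' \<Longrightarrow> Q s s''"
  shows "runs P (Seq (Assign x a b) d) Q"
proof (rule runs_Seq[OF _ d])
  show "runs P (Assign x a b) (\<lambda>s s'. s' = s(x := (s x)(aval a s := aval b s)))"
    by (rule runs_Assign) simp
qed (use assms in auto)

lemma runs_Cond:
  assumes c: "runs (\<lambda>s. P s \<and> bval b s) c Q" and d: "runs (\<lambda>s. P s \<and> \<not> bval b s) d Q"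
  shows "runs P (Cond b c d) Q"
proof -
  from c obtain p where p: "\<And>s. P s \<Longrightarrow> bval b s \<Longrightarrow> halts_within c s (poly p (s ''n'' 0)) (Q s)"
    unfolding runs_def by blast
  from d obtain q where q: "\<And>s. P s \<Longrightarrow> \<not> bval b s \<Longrightarrow> halts_within d s (poly q (s ''n'' 0)) (Q s)"
    unfolding runs_def by blast
  have "halts_within (Cond b c d) s (poly (p + q + [:1:]) (s ''n'' 0)) (Q s)" if P: "P s" for s
  proof (cases "bval b s")
    case True
    then obtain t s' where "exec c s t s'" "t \<le> poly p (s ''n'' 0)" "Q s s'"
      using p[OF P] unfolding halts_within_def by blast
    then show ?thesis unfolding halts_within_def
      by (intro exI[of _ "t + 1"] exI[of _ s'] conjI exec_Cond_True[OF True]) auto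
  next
    case False
    then obtain t s' where "exec d s t s'" "t \<le> poly q (s ''n'' 0)" "Q s s'"
      using q[OF P] unfolding halts_within_def by blast
    then show ?thesis unfolding halts_within_def
      by (intro exI[of _ "t + 1"] exI[of _ s'] conjI exec_Cond_False[OF False]) auto
  qed
  then show ?thesis unfolding runs_def by blast
qed

definition For :: "string \<Rightarrow> nat \<Rightarrow> aexp \<Rightarrow> com \<Rightarrow> com" where
  "For x d b c = Seq (Assign x (Const d) (Const 0))
     (While (Less (Cell x (Const d)) b) (Seq c (Assign x (Const d) (Plus (Cell x (Const d)) (Const 1)))))"

lemma writes_For [simp]: "writes (For x d b c) = insert x (writes c)"
  by (auto simp: For_def)

text \<open>
  The invariant \<open>I s i s'\<close> relates the initial store \<open>s\<close> to the store \<open>s'\<close> before round \<open>i\<close>. The counter is a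
  cell \<open>d\<close> of an array, so that nested loops can count in the cells of one array.
\<close>
lemma runs_For:
  assumes body: "runs B c R" and n: "''n'' \<notin> writes c" "x \<noteq> ''n''"
    and N: "\<And>s. P s \<Longrightarrow> N s \<le> poly q (s ''n'' 0)"
    and init: "\<And>s. P s \<Longrightarrow> I s 0 (s(x := (s x)(d := 0)))"
    and bound: "\<And>s i s'. P s \<Longrightarrow> I s i s' \<Longrightarrow> aval b s' = N s"
    and pre: "\<And>s i s'. P s \<Longrightarrow> I s i s' \<Longrightarrow> s' x d = i \<Longrightarrow> i < N s \<Longrightarrow> B s'"
    and step: "\<And>s i s' s''. P s \<Longrightarrow> I s i s' \<Longrightarrow> s' x d = i \<Longrightarrow> i < N s \<Longrightarrow> R s' s'' \<Longrightarrow> frame c s' s'' \<Longrightarrow>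
       s'' x d = i \<and> I s (Suc i) (s''(x := (s'' x)(d := Suc i)))"
    and fin: "\<And>s s'. P s \<Longrightarrow> I s (N s) s' \<Longrightarrow> Q s s'"
  shows "runs P (For x d b c) Q"
proof -
  from body obtain p where p: "\<And>s. B s \<Longrightarrow> halts_within c s (poly p (s ''n'' 0)) (R s)"
    unfolding runs_def by blast
  let ?c = "Seq c (Assign x (Const d) (Plus (Cell x (Const d)) (Const 1)))"
  let ?w = "While (Less (Cell x (Const d)) b) ?c"
  have loop: "halts_within ?w s' (m * (poly p (s ''n'' 0) + 2) + 1) (I s (N s))"
    if "P s" "I s i s'" "s' x d = i" "i + m = N s" "s' ''n'' 0 = s ''n'' 0" for m i s s'
    using that
  proof (induction m arbitrary: i s')
    case 0
    have "\<not> bval (Less (Cell x (Const d)) b) s'" using 0 bound[OF 0(1,2)] by simp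
    then have "exec ?w s' 1 s'" by (rule exec_While_False)
    moreover have "I s (N s) s'" using 0 by simp
    ultimately show ?case unfolding halts_within_def by auto
  next
    case (Suc m)
    have i: "i < N s" using Suc by simp
    have bv: "bval (Less (Cell x (Const d)) b) s'" using Suc bound[OF Suc(2,3)] by simp
    obtain t s1 where 1: "exec c s' t s1" "t \<le> poly p (s' ''n'' 0)" "R s' s1"
      using p[OF pre[OF Suc(2-4) i]] unfolding halts_within_def by blast
    have f: "frame c s' s1" by (rule exec_frame[OF 1(1)])
    have s1: "s1 x d = i" "I s (Suc i) (s1(x := (s1 x)(d := Suc i)))"
      using step[OF Suc(2-4) i 1(3) f] by auto
    let ?s2 = "s1(x := (s1 x)(d := Suc i))"
    have "exec (Assign x (Const d) (Plus (Cell x (Const d)) (Const 1))) s1 1 ?s2"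
      using exec_Assign[of x "Const d" "Plus (Cell x (Const d)) (Const 1)" s1] s1(1) by simp
    then have e: "exec ?c s' (t + 1) ?s2" by (rule exec_Seq[OF 1(1)])
    have sn: "?s2 ''n'' 0 = s ''n'' 0" using f n Suc(6) by (simp add: frame_def)
    have "halts_within ?w ?s2 (m * (poly p (s ''n'' 0) + 2) + 1) (I s (N s))"
      by (rule Suc(1)[OF Suc(2) s1(2) _ _ sn]) (use Suc(5) in simp_all)
    then obtain u s3 where 3: "exec ?w ?s2 u s3" "u \<le> m * (poly p (s ''n'' 0) + 2) + 1" "I s (N s) s3"
      unfolding halts_within_def by blast
    have "exec ?w s' (t + 1 + u + 1) s3" by (rule exec_While_True[OF bv e 3(1)])
    moreover have "t + 1 + u + 1 \<le> Suc m * (poly p (s ''n'' 0) + 2) + 1"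
      using 1(2) 3(2) Suc(6) by simp
    ultimately show ?case using 3(3) unfolding halts_within_def by blast
  qed
  have "halts_within (For x d b c) s (poly (q * (p + [:2:]) + [:2:]) (s ''n'' 0)) (Q s)" if P: "P s" for s
  proof -
    let ?s1 = "s(x := (s x)(d := 0))"
    have e: "exec (Assign x (Const d) (Const 0)) s 1 ?s1"
      using exec_Assign[of x "Const d" "Const 0" s] by simp
    have "halts_within ?w ?s1 (N s * (poly p (s ''n'' 0) + 2) + 1) (I s (N s))"
      by (rule loop[OF P init[OF P]]) (use n(2) in simp_all)
    then obtain u s2 where 2: "exec ?w ?s1 u s2" "u \<le> N s * (poly p (s ''n'' 0) + 2) + 1" "I s (N s) s2"
      unfolding halts_within_def by blast
    have "exec (For x d b c) s (1 + u) s2" unfolding For_def by (rule exec_Seq[OF e 2(1)])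
    moreover have "1 + u \<le> poly (q * (p + [:2:]) + [:2:]) (s ''n'' 0)"
    proof -
      have "N s * (poly p (s ''n'' 0) + 2) \<le> poly q (s ''n'' 0) * (poly p (s ''n'' 0) + 2)"
        using N[OF P] by (rule mult_right_mono) simp
      then show ?thesis using 2(2) by simp
    qed
    ultimately show ?thesis using fin[OF P 2(3)] unfolding halts_within_def by blast
  qed
  then show ?thesis unfolding runs_def by blast
qed

abbreviation Var :: "string \<Rightarrow> aexp" where "Var x \<equiv> Cell x (Const 0)"
abbreviation Put :: "string \<Rightarrow> aexp \<Rightarrow> com" where "Put x a \<equiv> Assign x (Const 0) a"

definition Equal :: "aexp \<Rightarrow> aexp \<Rightarrow> bexp" where
  "Equal a b = Conj (Neg (Less a b)) (Neg (Less b a))"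

lemma bval_Equal [simp]: "bval (Equal a b) s \<longleftrightarrow> aval a s = aval b s"
  by (auto simp: Equal_def)

text \<open>
  Pairs outside the matrix are excluded, because there the index \<open>u * n + v\<close> would reach cells of other rows.
\<close>
definition edge :: "store \<Rightarrow> nat \<Rightarrow> nat \<Rightarrow> bool" where
  "edge s u v \<longleftrightarrow> u < s ''n'' 0 \<and> v < s ''n'' 0 \<and> s ''adj'' (u * s ''n'' 0 + v) = 1"

definition marked :: "store \<Rightarrow> nat set" where
  "marked s = {v. v < s ''n'' 0 \<and> s ''S'' v = 1}"

text \<open>
  Row offsets are tabulated because there is no multiplication. The entry 2 on the diagonal makes
  equality of vertices visible in the adjacency matrix, so one look-up tells whether a vertex is equal
  to an anchor, adjacent to it, or neither.
\<close>
definition ready :: "store \<Rightarrow> bool" where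
  "ready s \<longleftrightarrow> (\<forall>i. s ''adj'' i \<le> 2) \<and> (\<forall>u<s ''n'' 0. s ''row'' u = u * s ''n'' 0) \<and>
     (\<forall>u<s ''n'' 0. \<forall>v<s ''n'' 0. s ''adj'' (u * s ''n'' 0 + v) = 2 \<longleftrightarrow> u = v)"

lemma edge_cong: "s' ''n'' = s ''n'' \<Longrightarrow> s' ''adj'' = s ''adj'' \<Longrightarrow> edge s' = edge s"
  by (auto simp: edge_def fun_eq_iff)
lemma marked_cong: "s' ''n'' = s ''n'' \<Longrightarrow> s' ''S'' = s ''S'' \<Longrightarrow> marked s' = marked s"
  by (auto simp: marked_def)
lemma ready_cong: "s' ''n'' = s ''n'' \<Longrightarrow> s' ''adj'' = s ''adj'' \<Longrightarrow> s' ''row'' = s ''row'' \<Longrightarrow> ready s' = ready s"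
  by (auto simp: ready_def)

definition prepare :: com where
  "prepare = Seq (Put ''r'' (Const 0))
     (For ''v'' 0 (Var ''n'')
       (Seq (Assign ''row'' (Var ''v'') (Var ''r''))
         (Seq (Assign ''adj'' (Plus (Var ''r'') (Var ''v'')) (Const 2))
           (Put ''r'' (Plus (Var ''r'') (Var ''n''))))))"

lemma index_inj:
  fixes n :: nat
  assumes "v < n" "v' < n" "u * n + v = u' * n + v'"
  shows "u = u' \<and> v = v'"
proof -
  have "(u * n + v) div n = (u' * n + v') div n" "(u * n + v) mod n = (u' * n + v') mod n"
    using assms(3) by simp_all
  then show ?thesis using assms(1,2) by simp
qed

lemma runs_prepare:
  "runs (\<lambda>s. \<forall>i. s ''adj'' i \<le> 1) prepare
     (\<lambda>s s'. ready s' \<and> (\<forall>u v. edge s' u v \<longleftrightarrow> u \<noteq> v \<and> edge s u v))"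
proof -
  define B where "B s s' \<longleftrightarrow>
      s' = s(''row'' := (s ''row'')(s ''v'' 0 := s ''r'' 0),
             ''adj'' := (s ''adj'')(s ''r'' 0 + s ''v'' 0 := 2),
             ''r'' := (s ''r'')(0 := s ''r'' 0 + s ''n'' 0))" for s s' :: store
  have body: "runs (\<lambda>_. True) (Seq (Assign ''row'' (Var ''v'') (Var ''r''))
         (Seq (Assign ''adj'' (Plus (Var ''r'') (Var ''v'')) (Const 2))
           (Put ''r'' (Plus (Var ''r'') (Var ''n''))))) B"
    unfolding runs_def halts_within_def
  proof (intro exI[of _ "[:3:]"] allI impI)
    show "\<exists>t s'. exec (Seq (Assign ''row'' (Var ''v'') (Var ''r''))
         (Seq (Assign ''adj'' (Plus (Var ''r'') (Var ''v'')) (Const 2))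
           (Put ''r'' (Plus (Var ''r'') (Var ''n''))))) s t s' \<and> t \<le> poly [:3:] (s ''n'' 0) \<and> B s s'" for s
      by (rule exI, rule exI, rule conjI, rule exec_Seq, rule exec_Assign, rule exec_Seq, rule exec_Assign,
          rule exec_Assign) (auto simp: B_def)
  qed
  define I where "I s i s' \<longleftrightarrow> s' ''n'' = s ''n'' \<and> s' ''r'' 0 = i * s ''n'' 0 \<and> i \<le> s ''n'' 0 \<and>
      (\<forall>u<i. s' ''row'' u = u * s ''n'' 0) \<and>
      (\<forall>j. s' ''adj'' j = (if \<exists>u<i. j = u * s ''n'' 0 + u then 2 else s ''adj'' j))" for s s' :: store and i
  show ?thesis unfolding prepare_def
  proof (rule runs_Assign_Seq)
    show "runs (\<lambda>s. (\<forall>i. s ''adj'' i \<le> 1) \<and> s ''r'' 0 = 0) (For ''v'' 0 (Var ''n'')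
       (Seq (Assign ''row'' (Var ''v'') (Var ''r''))
         (Seq (Assign ''adj'' (Plus (Var ''r'') (Var ''v'')) (Const 2))
           (Put ''r'' (Plus (Var ''r'') (Var ''n'')))))) (\<lambda>s s'. (\<forall>i. s ''adj'' i \<le> 1) \<and> I s (s ''n'' 0) s')"
    proof (rule runs_For[OF body, where N = "\<lambda>s. s ''n'' 0" and q = "[:0, 1:]" and I = I])
      fix s i s' s''
      assume *: "(\<forall>i. s ''adj'' i \<le> 1) \<and> s ''r'' 0 = 0" "I s i s'" "s' ''v'' 0 = i" "i < s ''n'' 0" "B s' s''"
      have "s'' ''row'' u = u * s ''n'' 0" if "u < Suc i" for u
        using * that by (cases "u = i") (auto simp: B_def I_def)
      moreover have "s'' ''adj'' j = (if \<exists>u<Suc i. j = u * s ''n'' 0 + u then 2 else s ''adj'' j)" for j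
        using * by (auto simp: B_def I_def less_Suc_eq)
      ultimately show "s'' ''v'' 0 = i \<and> I s (Suc i) (s''(''v'' := (s'' ''v'')(0 := Suc i)))"
        using * unfolding B_def I_def by simp
    qed (auto simp: I_def)
  next
    fix s s'' :: store
    assume s: "\<forall>i. s ''adj'' i \<le> 1"
    let ?t = "s(''r'' := (s ''r'')(aval (Const 0) s := aval (Const 0) s))"
    assume "(\<forall>i. ?t ''adj'' i \<le> 1) \<and> I ?t (?t ''n'' 0) s''"
    then have i: "s'' ''n'' = s ''n''" "\<And>u. u < s ''n'' 0 \<Longrightarrow> s'' ''row'' u = u * s ''n'' 0"
      "\<And>j. s'' ''adj'' j = (if \<exists>u<s ''n'' 0. j = u * s ''n'' 0 + u then 2 else s ''adj'' j)"
      by (auto simp: I_def)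
    have adj: "s'' ''adj'' (u * s ''n'' 0 + v) = (if u = v then 2 else s ''adj'' (u * s ''n'' 0 + v))"
      if "u < s ''n'' 0" "v < s ''n'' 0" for u v
    proof -
      have "(\<exists>x<s ''n'' 0. u * s ''n'' 0 + v = x * s ''n'' 0 + x) \<longleftrightarrow> u = v"
        using index_inj[of v "s ''n'' 0"] that by metis
      then show ?thesis by (simp add: i(3))
    qed
    have small: "s'' ''adj'' j \<le> 2" for j
      using s[rule_format, of j] by (simp add: i(3))
    have ne: "s ''adj'' j \<noteq> 2" for j using s[rule_format, of j] by linarith
    show "ready s'' \<and> (\<forall>u v. edge s'' u v \<longleftrightarrow> u \<noteq> v \<and> edge s u v)"
      unfolding ready_def edge_def i(1) using small adj i(2) ne by (auto split: if_splits)
  qed auto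
qed

section \<open>Deciding colourability by guessing anchors and lists\<close>

text \<open>
  The first \<open>m\<close> cells of \<open>g\<close> hold the guessed anchors. The code of a vertex is its row of adjacencies to
  the anchors, read as a number to base 3; vertices of equal code have to get equal lists.
\<close>
primrec code_exp :: "nat \<Rightarrow> aexp" where
  "code_exp 0 = Const 0"
| "code_exp (Suc i) = Plus (Plus (code_exp i) (code_exp i))
     (Plus (code_exp i) (Cell ''adj'' (Plus (Cell ''row'' (Var ''w'')) (Cell ''g'' (Const i)))))"

primrec code :: "store \<Rightarrow> nat \<Rightarrow> nat \<Rightarrow> nat" where
  "code s w 0 = 0"
| "code s w (Suc i) = 3 * code s w i + s ''adj'' (s ''row'' w + s ''g'' i)"

lemma aval_code_exp [simp]: "aval (code_exp m) s = code s (s ''w'' 0) m"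
  by (induction m) auto

lemma code_cong:
  "s' ''adj'' = s ''adj'' \<Longrightarrow> s' ''row'' = s ''row'' \<Longrightarrow> s' ''g'' = s ''g'' \<Longrightarrow> code s' w m = code s w m"
  by (induction m) auto

lemma code_less: "(\<And>i. s ''adj'' i \<le> 2) \<Longrightarrow> code s w m < 3 ^ m"
proof (induction m)
  case (Suc m)
  then have "code s w m + 1 \<le> 3 ^ m" "s ''adj'' (s ''row'' w + s ''g'' m) \<le> 2" by auto
  then show ?case by simp
qed simp

lemma code_inj:
  assumes "\<And>i. s ''adj'' i \<le> 2" and "code s w m = code s w' m" and "i < m"
  shows "s ''adj'' (s ''row'' w + s ''g'' i) = s ''adj'' (s ''row'' w' + s ''g'' i)"
  using assms(2,3)
proof (induction m)
  case (Suc m)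
  have "s ''adj'' (s ''row'' w + s ''g'' m) < 3" "s ''adj'' (s ''row'' w' + s ''g'' m) < 3"
    using assms(1) by (simp_all add: less_Suc_eq_le numeral_3_eq_3 numeral_2_eq_2)
  then have "code s w m = code s w' m"
    "s ''adj'' (s ''row'' w + s ''g'' m) = s ''adj'' (s ''row'' w' + s ''g'' m)"
    using Suc.prems(1) index_inj[of _ 3 _ "code s w m" "code s w' m"] by (auto simp: mult.commute)
  then show ?case using Suc by (cases "i = m") auto
qed simp

definition blocks :: "store \<Rightarrow> nat \<Rightarrow> nat \<Rightarrow> nat \<Rightarrow> bool" where
  "blocks s w j u \<longleftrightarrow> s ''S'' u = 1 \<and> s ''adj'' (s ''row'' w + u) = 1 \<and> s ''col'' u = j"

text \<open>
  Tells whether an earlier neighbour of the vertex \<open>w\<close> has colour \<open>j\<close>.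
\<close>
definition scan :: "nat \<Rightarrow> com" where
  "scan j = Seq (Put ''blk'' (Const 0))
     (For ''v'' 0 (Var ''w'')
       (Cond (Conj (Equal (Cell ''S'' (Var ''v'')) (Const 1))
               (Conj (Equal (Cell ''adj'' (Plus (Cell ''row'' (Var ''w'')) (Var ''v''))) (Const 1))
                 (Equal (Cell ''col'' (Var ''v'')) (Const j))))
         (Put ''blk'' (Const 1)) Skip))"

lemma writes_scan [simp]: "writes (scan j) = {''blk'', ''v''}"
  by (auto simp: scan_def)

lemma runs_scan:
  "runs (\<lambda>s. s ''w'' 0 < s ''n'' 0) (scan j)
     (\<lambda>s s'. s' ''blk'' 0 = (if \<exists>u<s ''w'' 0. blocks s (s ''w'' 0) j u then 1 else 0))"
  (is "runs ?P _ ?Q")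
proof -
  let ?c = "Cond (Conj (Equal (Cell ''S'' (Var ''v'')) (Const 1))
               (Conj (Equal (Cell ''adj'' (Plus (Cell ''row'' (Var ''w'')) (Var ''v''))) (Const 1))
                 (Equal (Cell ''col'' (Var ''v'')) (Const j))))
         (Put ''blk'' (Const 1)) Skip"
  have body: "runs (\<lambda>_. True) ?c (\<lambda>s s'. s' ''blk'' 0 = (if blocks s (s ''w'' 0) j (s ''v'' 0) then 1 else s ''blk'' 0))"
    by (intro runs_Cond runs_Assign runs_Skip) (auto simp: blocks_def)
  define I where "I s i s' \<longleftrightarrow> (\<forall>x. x \<noteq> ''blk'' \<longrightarrow> x \<noteq> ''v'' \<longrightarrow> s' x = s x) \<and>
     s' ''blk'' 0 = (if \<exists>u<i. blocks s (s ''w'' 0) j u then 1 else 0)" for s i s'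
  show ?thesis unfolding scan_def
  proof (rule runs_Assign_Seq)
    show "runs (\<lambda>s. ?P s \<and> s ''blk'' 0 = 0) (For ''v'' 0 (Var ''w'') ?c) ?Q"
    proof (rule runs_For[OF body, where N = "\<lambda>s. s ''w'' 0" and q = "[:0, 1:]" and I = I])
      fix s i s' s''
      assume *: "I s i s'" "s' ''v'' 0 = i"
        "s'' ''blk'' 0 = (if blocks s' (s' ''w'' 0) j (s' ''v'' 0) then 1 else s' ''blk'' 0)" "frame ?c s' s''"
      have e: "s' x = s x" if "x \<noteq> ''blk''" "x \<noteq> ''v''" for x
        using *(1) that by (auto simp: I_def)
      have e2: "s'' x = s' x" if "x \<noteq> ''blk''" for x
        using *(4) that by (auto simp: frame_def)
      have b: "blocks s' (s' ''w'' 0) j u = blocks s (s ''w'' 0) j u" for u by (simp add: blocks_def e)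
      have "s'' ''blk'' 0 = (if \<exists>u<Suc i. blocks s (s ''w'' 0) j u then 1 else 0)"
        using *(1-3) unfolding b by (auto simp: I_def less_Suc_eq)
      then show "s'' ''v'' 0 = i \<and> I s (Suc i) (s''(''v'' := (s'' ''v'')(0 := Suc i)))"
        using *(2) e e2 by (simp add: I_def)
    qed (auto simp: I_def)
  qed (auto simp: blocks_def)
qed

definition avail :: "nat \<Rightarrow> store \<Rightarrow> nat \<Rightarrow> bool" where
  "avail m s j \<longleftrightarrow> 0 < s ''g'' (m + j * 3 ^ m + code s (s ''w'' 0) m) \<and>
     \<not> (\<exists>u<s ''w'' 0. blocks s (s ''w'' 0) j u)"

text \<open>
  The colours are tried in decreasing order and each success overwrites the previous one, so \<open>cand\<close> ends as
  the least available colour below \<open>j\<close>.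
\<close>
primrec fit :: "nat \<Rightarrow> nat \<Rightarrow> com" where
  "fit m 0 = Skip"
| "fit m (Suc j) = Seq
     (Cond (Less (Const 0) (Cell ''g'' (Plus (Const (m + j * 3 ^ m)) (code_exp m))))
       (Seq (scan j) (Cond (Equal (Var ''blk'') (Const 0)) (Put ''cand'' (Const j)) Skip)) Skip)
     (fit m j)"

lemma writes_fit: "writes (fit m j) \<subseteq> {''blk'', ''v'', ''cand''}"
  by (induction j) auto

lemma avail_cong:
  assumes "\<And>x. x \<notin> {''blk'', ''v'', ''cand''} \<Longrightarrow> s' x = s x"
  shows "avail m s' j = avail m s j"
  using code_cong[of s' s] by (simp add: avail_def blocks_def assms)

lemma runs_fit:
  "runs (\<lambda>s. s ''w'' 0 < s ''n'' 0) (fit m j)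
     (\<lambda>s s'. (\<exists>i<j. avail m s i \<and> s' ''cand'' 0 = i \<and> (\<forall>i'<i. \<not> avail m s i')) \<or>
        (\<forall>i<j. \<not> avail m s i) \<and> s' ''cand'' 0 = s ''cand'' 0)"
  (is "runs ?P _ (?Q j)")
proof (induction j)
  case 0
  show ?case by (auto intro: runs_Skip)
next
  case (Suc j)
  let ?t = "Cond (Less (Const 0) (Cell ''g'' (Plus (Const (m + j * 3 ^ m)) (code_exp m))))
       (Seq (scan j) (Cond (Equal (Var ''blk'') (Const 0)) (Put ''cand'' (Const j)) Skip)) Skip"
  have upd: "runs (\<lambda>_. True) (Cond (Equal (Var ''blk'') (Const 0)) (Put ''cand'' (Const j)) Skip)
     (\<lambda>s s'. s' ''cand'' 0 = (if s ''blk'' 0 = 0 then j else s ''cand'' 0))"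
    by (intro runs_Cond runs_Assign runs_Skip) auto
  have test: "runs ?P ?t (\<lambda>s s'. s' ''cand'' 0 = (if avail m s j then j else s ''cand'' 0))"
    by (intro runs_Cond runs_Skip runs_Seq[OF runs_conseq[OF runs_scan] upd])
      (auto simp: avail_def frame_def)
  have wt: "writes ?t \<subseteq> {''blk'', ''v'', ''cand''}" by auto
  show ?case unfolding fit.simps
  proof (rule runs_Seq[OF test Suc])
    fix s s' :: store
    assume *: "?P s" "frame ?t s s'"
    then show "?P s'" using frameD[OF *(2) wt] by simp
  next
    fix s s' s'' :: store
    assume *: "s' ''cand'' 0 = (if avail m s j then j else s ''cand'' 0)" "?Q j s' s''" "frame ?t s s'"
    have "avail m s' i = avail m s i" for i
      using avail_cong[of s' s] frameD[OF *(3) wt] by blast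
    then show "?Q (Suc j) s s''" using *(1,2) by (cases "avail m s j") (auto simp: less_Suc_eq)
  qed simp
qed

text \<open>
  Above the \<open>m\<close> anchors, \<open>g\<close> holds one table for each colour \<open>j\<close>, with an entry for each code that tells
  whether the vertices with this code have \<open>j\<close> in their lists.
\<close>
definition lists_of :: "nat \<Rightarrow> nat \<Rightarrow> store \<Rightarrow> nat \<Rightarrow> nat set" where
  "lists_of k m s w = {j. j < k \<and> 0 < s ''g'' (m + j * 3 ^ m + code s w m)}"

definition greedy_fails :: "nat set \<Rightarrow> (nat \<Rightarrow> nat \<Rightarrow> bool) \<Rightarrow> (nat \<Rightarrow> nat set) \<Rightarrow> bool" where
  "greedy_fails S E L \<longleftrightarrow> (\<exists>f w. w \<in> S \<and> greedy S E L f w \<and> (\<forall>j\<in>L w. \<exists>u\<in>S. u < w \<and> E w u \<and> f u = j))"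

lemma greedy_Suc:
  assumes "greedy S E L f i" "c \<in> L i"
    and "\<And>j. j \<in> L i \<Longrightarrow> j \<le> c \<Longrightarrow> j < c \<longleftrightarrow> (\<exists>u\<in>S. u < i \<and> E i u \<and> f u = j)"
  shows "greedy S E L (f(i := c)) (Suc i)"
  unfolding greedy_def
proof (intro ballI impI)
  fix v assume v: "v \<in> S" "v < Suc i"
  have e: "(\<exists>u\<in>S. u < v \<and> E v u \<and> (f(i := c)) u = j) \<longleftrightarrow> (\<exists>u\<in>S. u < v \<and> E v u \<and> f u = j)" for j
    using v by (intro bex_cong refl) auto
  show "(f(i := c)) v \<in> L v \<and> (\<forall>j\<in>L v. j \<le> (f(i := c)) v \<longrightarrow>
      (j < (f(i := c)) v \<longleftrightarrow> (\<exists>u\<in>S. u < v \<and> E v u \<and> (f(i := c)) u = j)))"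
  proof (cases "v = i")
    case True
    then show ?thesis unfolding e using assms(2,3) by simp
  next
    case False
    then have "v < i" using v by simp
    then show ?thesis unfolding e using assms(1) v(1) False unfolding greedy_def by simp
  qed
qed

lemma greedy_Suc_skip: "greedy S E L f i \<Longrightarrow> i \<notin> S \<Longrightarrow> greedy S E L f (Suc i)"
  unfolding greedy_def using less_Suc_eq by auto

definition proper_col :: "nat \<Rightarrow> store \<Rightarrow> bool" where
  "proper_col k s \<longleftrightarrow> (\<forall>v\<in>marked s. s ''col'' v < k \<and> (\<forall>u\<in>marked s. u < v \<and> edge s v u \<longrightarrow> s ''col'' u \<noteq> s ''col'' v))"

lemma greedy_proper:
  assumes "greedy (marked s) E (lists_of k m s) f n" "v \<in> marked s" "v < n"
  shows "f v < k" and "u \<in> marked s \<Longrightarrow> u < v \<Longrightarrow> E v u \<Longrightarrow> f u \<noteq> f v"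
proof -
  have 1: "f v \<in> lists_of k m s v" "\<And>j. j \<in> lists_of k m s v \<Longrightarrow> j \<le> f v \<Longrightarrow>
      j < f v \<longleftrightarrow> (\<exists>u\<in>marked s. u < v \<and> E v u \<and> f u = j)"
    using assms unfolding greedy_def by blast+
  show "f v < k" using 1(1) by (simp add: lists_of_def)
  show "u \<in> marked s \<Longrightarrow> u < v \<Longrightarrow> E v u \<Longrightarrow> f u \<noteq> f v" using 1(2)[OF 1(1)] by blast
qed

definition color_next :: "nat \<Rightarrow> nat \<Rightarrow> com" where
  "color_next k m = Cond (Equal (Cell ''S'' (Var ''w'')) (Const 1))
     (Seq (Put ''cand'' (Const k)) (Seq (fit m k)
       (Cond (Less (Var ''cand'') (Const k)) (Assign ''col'' (Var ''w'') (Var ''cand'')) (Put ''ok'' (Const 0)))))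
     Skip"

definition attempt :: "nat \<Rightarrow> nat \<Rightarrow> com" where
  "attempt k m = Seq (Put ''ok'' (Const 1))
     (Seq (For ''w'' 0 (Var ''n'') (color_next k m)) (Put ''found'' (Var ''ok'')))"

lemma writes_color_next: "writes (color_next k m) \<subseteq> {''blk'', ''v'', ''cand'', ''col'', ''ok''}"
  using writes_fit[of m k] by (auto simp: color_next_def)

definition next_spec :: "nat \<Rightarrow> nat \<Rightarrow> store \<Rightarrow> store \<Rightarrow> bool" where
  "next_spec k m s s' \<longleftrightarrow>
     (if s ''S'' (s ''w'' 0) = 1 then
       (\<exists>i<k. avail m s i \<and> (\<forall>i'<i. \<not> avail m s i') \<and> s' ''col'' = (s ''col'')(s ''w'' 0 := i) \<and> s' ''ok'' 0 = s ''ok'' 0) \<or>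
       (\<forall>i<k. \<not> avail m s i) \<and> s' ''ok'' 0 = 0
      else s' ''ok'' 0 = s ''ok'' 0 \<and> s' ''col'' = s ''col'')"

lemma runs_color_next: "runs (\<lambda>s. s ''w'' 0 < s ''n'' 0) (color_next k m) (next_spec k m)"
proof -
  let ?P = "\<lambda>s :: store. s ''w'' 0 < s ''n'' 0"
  let ?F = "\<lambda>s s'. s' ''ok'' = s ''ok'' \<and> s' ''col'' = s ''col'' \<and> s' ''w'' = s ''w'' \<and>
     ((\<exists>i<k. avail m s i \<and> s' ''cand'' 0 = i \<and> (\<forall>i'<i. \<not> avail m s i')) \<or>
        (\<forall>i<k. \<not> avail m s i) \<and> s' ''cand'' 0 = s ''cand'' 0)"
  have fit: "runs ?P (fit m k) ?F"
  proof (rule runs_conseq[OF runs_fit])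
    fix s s' :: store assume *: "frame (fit m k) s s'"
      "(\<exists>i<k. avail m s i \<and> s' ''cand'' 0 = i \<and> (\<forall>i'<i. \<not> avail m s i')) \<or>
        (\<forall>i<k. \<not> avail m s i) \<and> s' ''cand'' 0 = s ''cand'' 0"
    have "s' x = s x" if "x \<notin> {''blk'', ''v'', ''cand''}" for x
      by (rule frameD[OF *(1) writes_fit that])
    then have "s' ''ok'' = s ''ok''" "s' ''col'' = s ''col''" "s' ''w'' = s ''w''" by simp_all
    then show "?F s s'" using *(2) by blast
  qed
  let ?put = "Cond (Less (Var ''cand'') (Const k)) (Assign ''col'' (Var ''w'') (Var ''cand'')) (Put ''ok'' (Const 0))"
  have put: "runs (\<lambda>_. True) ?put (\<lambda>s s'. if s ''cand'' 0 < k
      then s' ''col'' = (s ''col'')(s ''w'' 0 := s ''cand'' 0) \<and> s' ''ok'' 0 = s ''ok'' 0 else s' ''ok'' 0 = 0)"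
    by (intro runs_Cond runs_Assign) auto
  have both: "runs (\<lambda>s. ?P s \<and> s ''cand'' 0 = k) (Seq (fit m k) ?put)
     (\<lambda>s s'. (\<exists>i<k. avail m s i \<and> (\<forall>i'<i. \<not> avail m s i') \<and> s' ''col'' = (s ''col'')(s ''w'' 0 := i) \<and> s' ''ok'' 0 = s ''ok'' 0) \<or>
       (\<forall>i<k. \<not> avail m s i) \<and> s' ''ok'' 0 = 0)"
  proof (rule runs_Seq[OF _ put])
    show "runs (\<lambda>s. ?P s \<and> s ''cand'' 0 = k) (fit m k) ?F"
      by (rule runs_conseq[OF fit]) auto
    show "''n'' \<notin> writes (fit m k)" using writes_fit[of m k] by auto
  next
    fix s s' s'' :: store
    assume *: "?P s \<and> s ''cand'' 0 = k" "?F s s'"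
      "if s' ''cand'' 0 < k then s'' ''col'' = (s' ''col'')(s' ''w'' 0 := s' ''cand'' 0) \<and> s'' ''ok'' 0 = s' ''ok'' 0
       else s'' ''ok'' 0 = 0"
    show "(\<exists>i<k. avail m s i \<and> (\<forall>i'<i. \<not> avail m s i') \<and> s'' ''col'' = (s ''col'')(s ''w'' 0 := i) \<and> s'' ''ok'' 0 = s ''ok'' 0) \<or>
       (\<forall>i<k. \<not> avail m s i) \<and> s'' ''ok'' 0 = 0"
    proof (cases "\<exists>i<k. avail m s i")
      case True
      then have "s' ''cand'' 0 < k" "avail m s (s' ''cand'' 0)" "\<forall>i'<s' ''cand'' 0. \<not> avail m s i'"
        using *(2) by auto
      then show ?thesis using *(2,3) by auto
    next
      case False
      then have "s' ''cand'' 0 = k" using *(1,2) by metis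
      then show ?thesis using *(3) False by auto
    qed
  qed auto
  have "runs (\<lambda>s. ?P s \<and> bval (Equal (Cell ''S'' (Var ''w'')) (Const 1)) s)
      (Seq (Put ''cand'' (Const k)) (Seq (fit m k) ?put)) (next_spec k m)"
  proof (rule runs_Assign_Seq[OF both])
    fix s s'' :: store
    let ?t = "s(''cand'' := (s ''cand'')(aval (Const 0) s := aval (Const k) s))"
    have a: "avail m ?t i = avail m s i" for i by (rule avail_cong) auto
    assume *: "?P s \<and> bval (Equal (Cell ''S'' (Var ''w'')) (Const 1)) s"
      "(\<exists>i<k. avail m ?t i \<and> (\<forall>i'<i. \<not> avail m ?t i') \<and> s'' ''col'' = (?t ''col'')(?t ''w'' 0 := i) \<and> s'' ''ok'' 0 = ?t ''ok'' 0) \<or>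
       (\<forall>i<k. \<not> avail m ?t i) \<and> s'' ''ok'' 0 = 0"
    have t: "?t ''col'' = s ''col''" "?t ''w'' = s ''w''" "?t ''ok'' = s ''ok''" by simp_all
    show "next_spec k m s s''" using * unfolding a t next_spec_def by auto
  qed auto
  then show ?thesis unfolding color_next_def
    by (intro runs_Cond runs_Skip) (auto simp: next_spec_def)
qed

text \<open>
  A colouring that the attempt completes is proper whatever was guessed, since first-fit never gives a
  vertex the colour of an earlier neighbour. So a wrong guess can only fail.
\<close>
lemma runs_attempt:
  "runs ready (attempt k m) (\<lambda>s s'.
     (s' ''found'' 0 = 1 \<longrightarrow> proper_col k s') \<and>
     (\<not> greedy_fails (marked s) (edge s) (lists_of k m s) \<longrightarrow> s' ''found'' 0 = 1))"
proof -
  let ?W = "{''blk'', ''v'', ''cand'', ''col'', ''ok'', ''w''}"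
  define I where "I s i s' \<longleftrightarrow> (\<forall>x. x \<notin> ?W \<longrightarrow> s' x = s x) \<and> i \<le> s ''n'' 0 \<and>
     (s' ''ok'' 0 = 1 \<and> greedy (marked s) (edge s) (lists_of k m s) (s' ''col'') i \<or>
      s' ''ok'' 0 = 0 \<and> greedy_fails (marked s) (edge s) (lists_of k m s))" for s i s'
  have loop: "runs (\<lambda>s. ready s \<and> s ''ok'' 0 = 1) (For ''w'' 0 (Var ''n'') (color_next k m)) (\<lambda>s. I s (s ''n'' 0))"
  proof (rule runs_For[OF runs_color_next, where N = "\<lambda>s. s ''n'' 0" and q = "[:0, 1:]" and I = I])
    show "''n'' \<notin> writes (color_next k m)" using writes_color_next by fastforce
  next
    fix s i s' s''
    assume *: "ready s \<and> s ''ok'' 0 = 1" "I s i s'" "s' ''w'' 0 = i" "i < s ''n'' 0" "next_spec k m s' s''"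
      "frame (color_next k m) s' s''"
    have e: "s' x = s x" if "x \<notin> ?W" for x using *(2) that by (simp add: I_def)
    have e2: "s'' x = s' x" if "x \<notin> {''blk'', ''v'', ''cand'', ''col'', ''ok''}" for x
      by (rule frameD[OF *(6) writes_color_next that])
    let ?M = "marked s" and ?E = "edge s" and ?L = "lists_of k m s"
    have iM: "s' ''S'' i = 1 \<longleftrightarrow> i \<in> ?M" using *(4) by (simp add: e marked_def)
    have cd: "code s' i m = code s i m" by (rule code_cong) (auto simp: e)
    have av: "avail m s' j \<longleftrightarrow> j \<in> ?L i \<and> \<not> (\<exists>u\<in>?M. u < i \<and> ?E i u \<and> s' ''col'' u = j)" if "j < k" for j
    proof -
      have "blocks s' i j u \<longleftrightarrow> u \<in> ?M \<and> ?E i u \<and> s' ''col'' u = j" if "u < i" for u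
        using that *(1,4) by (auto simp: blocks_def e marked_def edge_def ready_def)
      then show ?thesis using that by (auto simp: avail_def *(3) cd lists_of_def e)
    qed
    have "s'' ''ok'' 0 = 1 \<and> greedy ?M ?E ?L (s'' ''col'') (Suc i) \<or> s'' ''ok'' 0 = 0 \<and> greedy_fails ?M ?E ?L"
    proof (cases "i \<in> ?M")
      case False
      then have "s'' ''ok'' 0 = s' ''ok'' 0" "s'' ''col'' = s' ''col''"
        using *(5) iM by (simp_all add: next_spec_def *(3))
      then show ?thesis using *(2) greedy_Suc_skip[OF _ False] by (auto simp: I_def)
    next
      case True
      show ?thesis
      proof (cases "\<exists>c<k. avail m s' c")
        case True
        then obtain c where c: "c < k" "avail m s' c" "\<forall>i'<c. \<not> avail m s' i'"
          "s'' ''col'' = (s' ''col'')(i := c)" "s'' ''ok'' 0 = s' ''ok'' 0"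
          using *(5) \<open>i \<in> ?M\<close> iM by (auto simp: next_spec_def *(3))
        have "greedy ?M ?E ?L (s'' ''col'') (Suc i)" if "greedy ?M ?E ?L (s' ''col'') i"
          unfolding c(4)
        proof (rule greedy_Suc[OF that])
          show "c \<in> ?L i" using av c(1,2) by blast
          show "j < c \<longleftrightarrow> (\<exists>u\<in>?M. u < i \<and> ?E i u \<and> s' ''col'' u = j)" if "j \<in> ?L i" "j \<le> c" for j
          proof (cases "j = c")
            case True
            then show ?thesis using av[OF c(1)] c(2) by auto
          next
            case False
            then have "j < c" using that by simp
            then show ?thesis using av[of j] c(1,3) that by auto
          qed
        qed
        then show ?thesis using *(2) c(5) by (auto simp: I_def)
      next
        case False
        then have "s'' ''ok'' 0 = 0"
          using *(5) \<open>i \<in> ?M\<close> iM by (auto simp: next_spec_def *(3))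
        moreover have "greedy_fails ?M ?E ?L" if "greedy ?M ?E ?L (s' ''col'') i"
        proof -
          have "\<exists>u\<in>?M. u < i \<and> ?E i u \<and> s' ''col'' u = j" if "j \<in> ?L i" for j
          proof -
            have "j < k" using that by (simp add: lists_of_def)
            then show ?thesis using av[of j] False that by blast
          qed
          then show ?thesis using that \<open>i \<in> ?M\<close> unfolding greedy_fails_def by blast
        qed
        ultimately show ?thesis using *(2) by (auto simp: I_def)
      qed
    qed
    then show "s'' ''w'' 0 = i \<and> I s (Suc i) (s''(''w'' := (s'' ''w'')(0 := Suc i)))"
      using *(3,4) e e2 by (simp add: I_def)
  qed (auto simp: I_def greedy_def)
  show ?thesis unfolding attempt_def
  proof (rule runs_Assign_Seq[OF runs_Seq[OF loop]])
    show "runs (\<lambda>_. True) (Put ''found'' (Var ''ok'')) (\<lambda>s s'. s' = s(''found'' := (s ''found'')(0 := s ''ok'' 0)))"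
      by (rule runs_Assign) simp
    show "''n'' \<notin> writes (For ''w'' 0 (Var ''n'') (color_next k m))" using writes_color_next by fastforce
  next
    fix s s' s''
    assume *: "ready s \<and> s ''ok'' 0 = 1" "I s (s ''n'' 0) s'" "s'' = s'(''found'' := (s' ''found'')(0 := s' ''ok'' 0))"
    have s': "s' x = s x" if "x \<notin> ?W" for x using *(2) that by (simp add: I_def)
    have ok: "s' ''ok'' 0 = 1 \<and> greedy (marked s) (edge s) (lists_of k m s) (s' ''col'') (s ''n'' 0) \<or>
      s' ''ok'' 0 = 0 \<and> greedy_fails (marked s) (edge s) (lists_of k m s)"
      using *(2) unfolding I_def by blast
    have s'': "s'' x = s' x" if "x \<noteq> ''found''" for x using that by (simp add: *(3))
    have fo: "s'' ''found'' 0 = s' ''ok'' 0" by (simp add: *(3))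
    have e: "marked s'' = marked s" "edge s'' = edge s"
      by (rule marked_cong edge_cong; simp add: s'' s')+
    have "proper_col k s''" if "s'' ''found'' 0 = 1"
    proof -
      have g: "greedy (marked s) (edge s) (lists_of k m s) (s' ''col'') (s ''n'' 0)"
        using ok fo that by auto
      have c: "s'' ''col'' = s' ''col''" by (simp add: s'')
      show ?thesis unfolding proper_col_def e c
        using greedy_proper[OF g] by (auto simp: marked_def)
    qed
    moreover have "s'' ''found'' 0 = 1" if "\<not> greedy_fails (marked s) (edge s) (lists_of k m s)"
      using ok fo that by auto
    ultimately show "(s'' ''found'' 0 = 1 \<longrightarrow> proper_col k s'') \<and>
       (\<not> greedy_fails (marked s) (edge s) (lists_of k m s) \<longrightarrow> s'' ''found'' 0 = 1)" by blast
  next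
    fix s :: store assume "ready s"
    then show "ready (s(''ok'' := (s ''ok'')(aval (Const 0) s := aval (Const 1) s))) \<and>
      (s(''ok'' := (s ''ok'')(aval (Const 0) s := aval (Const 1) s))) ''ok'' 0 = 1"
      by (simp add: ready_def)
  next
    fix s s'' :: store
    let ?t = "s(''ok'' := (s ''ok'')(aval (Const 0) s := aval (Const 1) s))"
    have "marked ?t = marked s" "edge ?t = edge s" "lists_of k m ?t = lists_of k m s"
      using code_cong[of ?t s _ m] by (auto simp: marked_def edge_def lists_of_def fun_eq_iff)
    moreover assume "(s'' ''found'' 0 = 1 \<longrightarrow> proper_col k s'') \<and>
       (\<not> greedy_fails (marked ?t) (edge ?t) (lists_of k m ?t) \<longrightarrow> s'' ''found'' 0 = 1)"
    ultimately show "(s'' ''found'' 0 = 1 \<longrightarrow> proper_col k s'') \<and>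
       (\<not> greedy_fails (marked s) (edge s) (lists_of k m s) \<longrightarrow> s'' ''found'' 0 = 1)" by simp
  qed auto
qed

text \<open>
  Nested loops over all values below \<open>n + 2\<close> of the first \<open>d\<close> cells of \<open>g\<close>. This range contains all vertices and
  the table entries 0 and 1, even if \<open>n = 0\<close>.
\<close>
primrec search :: "nat \<Rightarrow> nat \<Rightarrow> nat \<Rightarrow> com" where
  "search k m 0 = Cond (Equal (Var ''found'') (Const 1)) Skip (attempt k m)"
| "search k m (Suc d) = For ''g'' d (Plus (Var ''n'') (Const 2)) (search k m d)"

abbreviation scratch :: "string set" where
  "scratch \<equiv> {''blk'', ''v'', ''cand'', ''col'', ''ok'', ''w'', ''found'', ''g''}"

lemma writes_search: "writes (search k m d) \<subseteq> scratch"
  using writes_color_next[of k m] by (induction d) (auto simp: attempt_def)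

lemma search_frame:
  assumes "frame (search k m d) s s'" "x \<notin> scratch"
  shows "s' x = s x"
  by (rule frameD[OF assms(1) writes_search assms(2)])

text \<open>
  The outcome of the attempt if \<open>g\<close> held the guess \<open>h\<close>; this is what the loops of the search compare their
  progress with, while the cells of \<open>g\<close> change.
\<close>
definition success :: "nat \<Rightarrow> nat \<Rightarrow> store \<Rightarrow> (nat \<Rightarrow> nat) \<Rightarrow> bool" where
  "success k m s h \<longleftrightarrow> \<not> greedy_fails (marked s) (edge s) (lists_of k m (s(''g'' := h)))"

lemma success_cong:
  assumes "\<And>x. x \<notin> scratch \<Longrightarrow> s' x = s x"
  shows "success k m s' h = success k m s h"
proof -
  have "code (s'(''g'' := h)) w m = code (s(''g'' := h)) w m" for w
    by (rule code_cong) (auto simp: assms)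
  then have "lists_of k m (s'(''g'' := h)) = lists_of k m (s(''g'' := h))"
    by (simp add: lists_of_def fun_eq_iff)
  moreover have "marked s' = marked s" "edge s' = edge s" by (auto intro!: marked_cong edge_cong simp: assms)
  ultimately show ?thesis by (simp add: success_def)
qed

lemma runs_search:
  "runs (\<lambda>s. ready s \<and> (s ''found'' 0 = 1 \<longrightarrow> proper_col k s)) (search k m d)
     (\<lambda>s s'. (s' ''found'' 0 = 1 \<longrightarrow> proper_col k s') \<and> (s ''found'' 0 = 1 \<longrightarrow> s' ''found'' 0 = 1) \<and>
        (\<forall>e\<ge>d. s' ''g'' e = s ''g'' e) \<and>
        (\<forall>h. (\<forall>e\<ge>d. h e = s ''g'' e) \<and> (\<forall>e<d. h e < s ''n'' 0 + 2) \<and> success k m s h \<longrightarrow> s' ''found'' 0 = 1))"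
  (is "runs ?P _ (?Q d)")
proof (induction d)
  case 0
  have "runs (\<lambda>s. ?P s \<and> \<not> bval (Equal (Var ''found'') (Const 1)) s) (attempt k m) (?Q 0)"
  proof (rule runs_conseq[OF runs_attempt])
    fix s s' :: store
    assume *: "?P s \<and> \<not> bval (Equal (Var ''found'') (Const 1)) s" "frame (attempt k m) s s'"
      "(s' ''found'' 0 = 1 \<longrightarrow> proper_col k s') \<and>
       (\<not> greedy_fails (marked s) (edge s) (lists_of k m s) \<longrightarrow> s' ''found'' 0 = 1)"
    have w: "writes (attempt k m) \<subseteq> {''blk'', ''v'', ''cand'', ''col'', ''ok'', ''w'', ''found''}"
      using writes_color_next[of k m] by (auto simp: attempt_def)
    have g: "s' ''g'' = s ''g''" using frameD[OF *(2) w] by simp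
    have "h = s ''g''" if "\<forall>e\<ge>0. h e = s ''g'' e" for h using that by (simp add: fun_eq_iff)
    then have sg: "success k m s h \<longleftrightarrow> \<not> greedy_fails (marked s) (edge s) (lists_of k m s)"
      if "\<forall>e\<ge>0. h e = s ''g'' e" for h
    proof -
      have "h = s ''g''" using that by (simp add: fun_eq_iff)
      then have "s(''g'' := h) = s" by simp
      then show ?thesis unfolding success_def by (simp only:)
    qed
    show "?Q 0 s s'" using * g sg by auto
  qed auto
  then show ?case by (auto intro!: runs_Cond runs_Skip)
next
  case (Suc d)
  define I where "I s i s' \<longleftrightarrow> (\<forall>x. x \<notin> scratch \<longrightarrow> s' x = s x) \<and>
     (s' ''found'' 0 = 1 \<longrightarrow> proper_col k s') \<and> (s ''found'' 0 = 1 \<longrightarrow> s' ''found'' 0 = 1) \<and>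
     (\<forall>e>d. s' ''g'' e = s ''g'' e) \<and>
     (\<forall>h. (\<forall>e>d. h e = s ''g'' e) \<and> (\<forall>e<d. h e < s ''n'' 0 + 2) \<and> h d < i \<and> success k m s h \<longrightarrow> s' ''found'' 0 = 1)"
    for s i s'
  have pc: "proper_col k (s(''g'' := h)) = proper_col k s" for s h
  proof -
    have "marked (s(''g'' := h)) = marked s" "edge (s(''g'' := h)) = edge s"
      by (rule marked_cong edge_cong; simp)+
    then show ?thesis by (simp add: proper_col_def)
  qed
  show ?case unfolding search.simps
  proof (rule runs_For[OF Suc, where N = "\<lambda>s. s ''n'' 0 + 2" and q = "[:2, 1:]" and I = I])
    show "''n'' \<notin> writes (search k m d)" using writes_search by fastforce
  next
    fix s i s' assume *: "?P s" "I s i s'"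
    then have e: "s' x = s x" if "x \<notin> scratch" for x using that by (simp add: I_def)
    have "ready s' = ready s" by (rule ready_cong) (simp_all add: e)
    moreover have "s' ''found'' 0 = 1 \<longrightarrow> proper_col k s'" using *(2) unfolding I_def by blast
    ultimately show "?P s'" using *(1) by blast
  next
    fix s i s' s''
    assume *: "?P s" "I s i s'" "s' ''g'' d = i" "?Q d s' s''" "frame (search k m d) s' s''"
    have e: "s' x = s x" if "x \<notin> scratch" for x using *(2) that by (simp add: I_def)
    have e2: "s'' x = s' x" if "x \<notin> scratch" for x using search_frame[OF *(5)] that .
    have sc: "success k m s' h = success k m s h" for h by (rule success_cong) (rule e)
    have q: "\<And>e. e \<ge> d \<Longrightarrow> s'' ''g'' e = s' ''g'' e" "s'' ''found'' 0 = 1 \<longrightarrow> proper_col k s''"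
      "s' ''found'' 0 = 1 \<longrightarrow> s'' ''found'' 0 = 1" using *(4) by simp_all
    have i12: "s ''found'' 0 = 1 \<longrightarrow> s' ''found'' 0 = 1" "\<forall>e>d. s' ''g'' e = s ''g'' e"
      using *(2) unfolding I_def by blast+
    have found: "s'' ''found'' 0 = 1" if h: "\<forall>e>d. h e = s ''g'' e" "\<forall>e<d. h e < s ''n'' 0 + 2" "h d < Suc i" "success k m s h" for h
    proof (cases "h d = i")
      case True
      have "h e = s' ''g'' e" if "e \<ge> d" for e
      proof (cases "e = d")
        case True
        then show ?thesis using \<open>h d = i\<close> *(3) by simp
      next
        case False
        then show ?thesis using that h(1) *(2) unfolding I_def by simp
      qed
      then have "(\<forall>e\<ge>d. h e = s' ''g'' e) \<and> (\<forall>e<d. h e < s' ''n'' 0 + 2) \<and> success k m s' h"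
        using h(2,4) sc e by simp
      then show ?thesis using *(4) by blast
    next
      case False
      then have "h d < i" using h(3) by simp
      then have "s' ''found'' 0 = 1" using *(2) h(1,2,4) unfolding I_def by blast
      then show ?thesis using q by simp
    qed
    have "I s (Suc i) (s''(''g'' := (s'' ''g'')(d := Suc i)))"
      unfolding I_def
    proof (intro conjI)
      show "\<forall>x. x \<notin> scratch \<longrightarrow> (s''(''g'' := (s'' ''g'')(d := Suc i))) x = s x" using e e2 by simp
      show "(s''(''g'' := (s'' ''g'')(d := Suc i))) ''found'' 0 = 1 \<longrightarrow> proper_col k (s''(''g'' := (s'' ''g'')(d := Suc i)))"
        unfolding pc using q(2) by simp
      show "s ''found'' 0 = 1 \<longrightarrow> (s''(''g'' := (s'' ''g'')(d := Suc i))) ''found'' 0 = 1"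
        using q(3) i12 by simp
      show "\<forall>e>d. (s''(''g'' := (s'' ''g'')(d := Suc i))) ''g'' e = s ''g'' e"
        using q(1) i12 by simp
      show "\<forall>h. (\<forall>e>d. h e = s ''g'' e) \<and> (\<forall>e<d. h e < s ''n'' 0 + 2) \<and> h d < Suc i \<and> success k m s h \<longrightarrow>
         (s''(''g'' := (s'' ''g'')(d := Suc i))) ''found'' 0 = 1"
        using found by auto
    qed
    then show "s'' ''g'' d = i \<and> I s (Suc i) (s''(''g'' := (s'' ''g'')(d := Suc i)))"
      using q(1) *(3) by simp
  next
    fix s s' assume *: "?P s" "I s (s ''n'' 0 + 2) s'"
    have "s' ''found'' 0 = 1"
      if h: "\<forall>e\<ge>Suc d. h e = s ''g'' e" "\<forall>e<Suc d. h e < s ''n'' 0 + 2" "success k m s h" for h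
    proof -
      have "(\<forall>e>d. h e = s ''g'' e) \<and> (\<forall>e<d. h e < s ''n'' 0 + 2) \<and> h d < s ''n'' 0 + 2 \<and> success k m s h"
        using h by (simp add: Suc_le_eq less_Suc_eq)
      then show ?thesis using *(2) unfolding I_def by blast
    qed
    moreover have "\<forall>e\<ge>Suc d. s' ''g'' e = s ''g'' e" using *(2) unfolding I_def Suc_le_eq by blast
    moreover have "(s' ''found'' 0 = 1 \<longrightarrow> proper_col k s') \<and> (s ''found'' 0 = 1 \<longrightarrow> s' ''found'' 0 = 1)"
      using *(2) unfolding I_def by blast
    ultimately show "?Q (Suc d) s s'" by blast
  next
    fix s assume "?P s"
    then show "I s 0 (s(''g'' := (s ''g'')(d := 0)))" using pc by (simp add: I_def)
  qed (auto simp: I_def)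
qed

definition digits :: "nat \<Rightarrow> nat" where
  "digits k = anchor_bound k + k * 3 ^ anchor_bound k"

definition decide :: "nat \<Rightarrow> com" where
  "decide k = Seq (Put ''found'' (Const 0)) (search k (anchor_bound k) (digits k))"

lemma writes_decide: "writes (decide k) \<subseteq> scratch"
  using writes_search[of k] by (auto simp: decide_def)

definition colorable_on :: "nat \<Rightarrow> nat set \<Rightarrow> (nat \<Rightarrow> nat \<Rightarrow> bool) \<Rightarrow> bool" where
  "colorable_on k S E \<longleftrightarrow> (\<exists>c. (\<forall>v\<in>S. c v < k) \<and> (\<forall>u\<in>S. \<forall>v\<in>S. E u v \<longrightarrow> c u \<noteq> c v))"

lemma list_good_cong:
  assumes "\<And>v. v \<in> S \<Longrightarrow> L v = L' v" "list_good S E L"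
  shows "list_good S E L'"
  using assms(2) unfolding list_good_def by (simp add: assms(1))

text \<open>
  The guess that succeeds: the anchors and lists that \<open>anchors\<close> yields for some proper colouring. Unused
  anchor cells are filled with 0; this refines the codes but keeps the lists a function of the code.
\<close>
lemma good_guess:
  fixes k :: nat
  defines "m \<equiv> anchor_bound k"
  assumes r: "ready s" and free: "cogem_dart_free (marked s) (edge s)" and col: "colorable_on k (marked s) (edge s)"
  shows "\<exists>h. (\<forall>e\<ge>digits k. h e = s ''g'' e) \<and> (\<forall>e<digits k. h e < s ''n'' 0 + 2) \<and> success k m s h"
proof -
  let ?M = "marked s" and ?E = "edge s" and ?n = "s ''n'' 0"
  interpret cogem_dart_free ?M ?E by (rule free)
  from col obtain c where c: "\<And>v. v \<in> ?M \<Longrightarrow> c v < k" "\<And>u v. u \<in> ?M \<Longrightarrow> v \<in> ?M \<Longrightarrow> ?E u v \<Longrightarrow> c u \<noteq> c v"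
    unfolding colorable_on_def by blast
  have "\<exists>T L. T \<subseteq> ?M \<and> card T \<le> m \<and> list_good ?M ?E L \<and> (\<forall>v\<in>?M. c v \<in> L v \<and> L v \<subseteq> {..<k}) \<and>
     (\<forall>v\<in>?M. \<forall>w\<in>?M. (\<forall>t\<in>T. (v = t \<longleftrightarrow> w = t) \<and> (?E v t \<longleftrightarrow> ?E w t)) \<longrightarrow> L v = L w)"
    unfolding m_def by (rule anchors) (fact c)+
  then obtain T L where T: "T \<subseteq> ?M" "card T \<le> m" and L: "list_good ?M ?E L"
      "\<forall>v\<in>?M. c v \<in> L v \<and> L v \<subseteq> {..<k}"
    and same: "\<forall>v\<in>?M. \<forall>w\<in>?M. (\<forall>t\<in>T. (v = t \<longleftrightarrow> w = t) \<and> (?E v t \<longleftrightarrow> ?E w t)) \<longrightarrow> L v = L w"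
    by (elim exE conjE)
  obtain ts where ts: "set ts = T" "length ts \<le> m"
  proof -
    obtain xs where "set xs = T" "distinct xs"
      using finite_distinct_list[OF finite_subset[OF T(1) fin]] by blast
    then show thesis using that T(2) distinct_card[of xs] by simp
  qed
  have Tn: "t < ?n" if "t \<in> T" for t using T(1) that by (auto simp: marked_def)
  define a where "a e = (if e < length ts then ts ! e else 0)" for e
  define cd where "cd w = code (s(''g'' := a)) w m" for w
  have adj2: "s ''adj'' i \<le> 2" for i using r by (simp add: ready_def)
  have cd3: "cd w < 3 ^ m" for w unfolding cd_def by (rule code_less) (simp add: adj2)
  have cdL: "L v = L w" if v: "v \<in> ?M" and w: "w \<in> ?M" and eq: "cd v = cd w" for v w
  proof (rule same[rule_format, OF v w])
    fix t assume t: "t \<in> T"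
    obtain e where e: "e < length ts" "ts ! e = t" using t ts(1) by (metis in_set_conv_nth)
    have "s ''adj'' (s ''row'' v + a e) = s ''adj'' (s ''row'' w + a e)"
      using code_inj[of "s(''g'' := a)" v m w e] eq e ts(2) adj2 unfolding cd_def by simp
    then have "s ''adj'' (v * ?n + t) = s ''adj'' (w * ?n + t)"
      using r v w e by (simp add: ready_def marked_def a_def)
    moreover have "v < ?n" "w < ?n" using v w by (auto simp: marked_def)
    ultimately show "(v = t \<longleftrightarrow> w = t) \<and> (?E v t \<longleftrightarrow> ?E w t)"
      using r Tn[OF t] unfolding ready_def edge_def by metis
  qed
  (* The entry for colour j and code c is at position j * 3 ^ m + c; vertices of equal code have equal
     lists, so it does not matter which vertex of that code is consulted. *)
  define tab where "tab e = (if \<exists>w\<in>?M. cd w = e mod 3 ^ m \<and> e div 3 ^ m \<in> L w then 1 else 0 :: nat)" for e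
  define h where "h e = (if e < m then a e else if e < digits k then tab (e - m) else s ''g'' e)" for e
  have code_h: "code (s(''g'' := h)) w m = cd w" for w
  proof -
    have "code (s(''g'' := h)) w i = code (s(''g'' := a)) w i" if "i \<le> m" for i
      using that by (induction i) (auto simp: h_def)
    then show ?thesis by (simp add: cd_def)
  qed
  have lists: "lists_of k m (s(''g'' := h)) v = L v" if v: "v \<in> ?M" for v
  proof -
    have "0 < h (m + j * 3 ^ m + cd v) \<longleftrightarrow> j \<in> L v" if j: "j < k" for j
    proof -
      have "j * 3 ^ m + cd v < (j + 1) * 3 ^ m" using cd3[of v] by simp
      also have "\<dots> \<le> k * 3 ^ m" using j by (intro mult_right_mono) auto
      finally have "m + j * 3 ^ m + cd v < digits k" by (simp add: digits_def m_def)
      then have "h (m + j * 3 ^ m + cd v) = tab (j * 3 ^ m + cd v)" by (simp add: h_def add.assoc)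
      moreover have "(j * 3 ^ m + cd v) mod 3 ^ m = cd v" "(j * 3 ^ m + cd v) div 3 ^ m = j"
        using cd3[of v] by simp_all
      ultimately have "0 < h (m + j * 3 ^ m + cd v) \<longleftrightarrow> (\<exists>w\<in>?M. cd w = cd v \<and> j \<in> L w)"
        by (simp add: tab_def)
      then show ?thesis using cdL[OF v] v by metis
    qed
    then show ?thesis using L(2)[rule_format, OF v] by (auto simp: lists_of_def code_h)
  qed
  have "success k m s h"
    unfolding success_def greedy_fails_def
  proof
    let ?L = "lists_of k m (s(''g'' := h))"
    assume "\<exists>f w. w \<in> ?M \<and> greedy ?M ?E ?L f w \<and> (\<forall>j\<in>?L w. \<exists>u\<in>?M. u < w \<and> ?E w u \<and> f u = j)"
    then obtain f w where fw: "w \<in> ?M" "greedy ?M ?E ?L f w" "\<forall>j\<in>?L w. \<exists>u\<in>?M. u < w \<and> ?E w u \<and> f u = j"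
      by blast
    have "\<exists>j\<in>?L w. \<forall>u\<in>?M. u < w \<and> ?E w u \<longrightarrow> f u \<noteq> j"
    proof (rule greedy_not_stuck[OF fin _ irr _ _ c(2) _ fw(2,1)])
      show "?E u v \<Longrightarrow> ?E v u" for u v by (rule sym)
      show "c v \<in> ?L v" "finite (?L v)" if "v \<in> ?M" for v
        using L(2)[rule_format, OF that] lists[OF that] finite_subset[of "L v" "{..<k}"] by auto
      show "list_good ?M ?E ?L" by (rule list_good_cong[OF _ L(1)]) (simp add: lists)
    qed
    then show False using fw(3) by blast
  qed
  moreover have "h e < ?n + 2" if "e < digits k" for e
  proof -
    have "a e < ?n + 2" using Tn[of "ts ! e"] ts(1) by (auto simp: a_def)
    then show ?thesis using that by (simp add: h_def tab_def)
  qed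
  moreover have "h e = s ''g'' e" if "e \<ge> digits k" for e
    using that by (auto simp: h_def digits_def m_def)
  ultimately show ?thesis by blast
qed

definition proper_on :: "nat \<Rightarrow> nat set \<Rightarrow> (nat \<Rightarrow> nat \<Rightarrow> bool) \<Rightarrow> (nat \<Rightarrow> nat) \<Rightarrow> bool" where
  "proper_on k S E c \<longleftrightarrow> (\<forall>v\<in>S. c v < k) \<and> (\<forall>u\<in>S. \<forall>v\<in>S. E u v \<longrightarrow> c u \<noteq> c v)"

theorem runs_decide:
  "runs (\<lambda>s. ready s \<and> cogem_dart_free (marked s) (edge s)) (decide k)
     (\<lambda>s s'. (s' ''found'' 0 = 1 \<longleftrightarrow> colorable_on k (marked s) (edge s)) \<and>
        (s' ''found'' 0 = 1 \<longrightarrow> proper_on k (marked s) (edge s) (s' ''col'')))"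
  unfolding decide_def
proof (rule runs_Assign_Seq[OF runs_search])
  fix s s'' :: store
  let ?t = "s(''found'' := (s ''found'')(aval (Const 0) s := aval (Const 0) s))"
  let ?m = "anchor_bound k"
  assume P: "ready s \<and> cogem_dart_free (marked s) (edge s)"
  have t: "marked ?t = marked s" "edge ?t = edge s" by (auto intro!: marked_cong edge_cong)
  have rt: "ready ?t" using P by (simp add: ready_def)
  interpret cogem_dart_free "marked s" "edge s" using P by blast
  assume Q: "(s'' ''found'' 0 = 1 \<longrightarrow> proper_col k s'') \<and> (?t ''found'' 0 = 1 \<longrightarrow> s'' ''found'' 0 = 1) \<and>
        (\<forall>e\<ge>digits k. s'' ''g'' e = ?t ''g'' e) \<and>
        (\<forall>h. (\<forall>e\<ge>digits k. h e = ?t ''g'' e) \<and> (\<forall>e<digits k. h e < ?t ''n'' 0 + 2) \<and> success k ?m ?t h \<longrightarrow> s'' ''found'' 0 = 1)"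
  assume F: "frame (search k ?m (digits k)) ?t s''"
  have e: "s'' x = s x" if "x \<notin> scratch" for x
    using search_frame[OF F that] that by simp
  have se: "marked s'' = marked s" "edge s'' = edge s" by (auto intro!: marked_cong edge_cong simp: e)
  have 1: "proper_on k (marked s) (edge s) (s'' ''col'')" if "s'' ''found'' 0 = 1"
    unfolding proper_on_def
  proof (intro conjI ballI impI)
    have pc: "proper_col k s''" using Q that by blast
    show "s'' ''col'' v < k" if "v \<in> marked s" for v using pc that by (simp add: proper_col_def se)
    show "s'' ''col'' u \<noteq> s'' ''col'' v" if "u \<in> marked s" "v \<in> marked s" "edge s u v" for u v
    proof -
      have "u \<noteq> v" using that irr by blast
      then show ?thesis using pc that sym[OF that(3)] unfolding proper_col_def se
        by (metis linorder_neqE_nat)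
    qed
  qed
  have 2: "s'' ''found'' 0 = 1" if "colorable_on k (marked s) (edge s)"
    using good_guess[OF rt, of k] that P Q unfolding t by blast
  show "(s'' ''found'' 0 = 1 \<longleftrightarrow> colorable_on k (marked s) (edge s)) \<and>
        (s'' ''found'' 0 = 1 \<longrightarrow> proper_on k (marked s) (edge s) (s'' ''col''))"
    using 1 2 unfolding proper_on_def colorable_on_def by blast
qed (auto simp: ready_def)

definition copy :: "string \<Rightarrow> string \<Rightarrow> com" where
  "copy x y = For ''v'' 0 (Var ''n'') (Assign y (Var ''v'') (Cell x (Var ''v'')))"

lemma writes_copy [simp]: "writes (copy x y) = {''v'', y}"
  by (simp add: copy_def)

lemma runs_copy:
  assumes "x \<noteq> y" "x \<noteq> ''v''" "y \<noteq> ''v''" "y \<noteq> ''n''"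
  shows "runs P (copy x y) (\<lambda>s s'. \<forall>v<s ''n'' 0. s' y v = s x v)"
  unfolding copy_def
proof (rule runs_For[where N = "\<lambda>s. s ''n'' 0" and q = "[:0, 1:]" and
      I = "\<lambda>s i s'. s' ''n'' = s ''n'' \<and> s' x = s x \<and> (\<forall>v<i. s' y v = s x v)"])
  show "runs (\<lambda>_. True) (Assign y (Var ''v'') (Cell x (Var ''v'')))
     (\<lambda>s s'. s' = s(y := (s y)(s ''v'' 0 := s x (s ''v'' 0))))"
    by (rule runs_Assign) simp
qed (use assms in \<open>auto simp: less_Suc_eq\<close>)

text \<open>
  A loop that clears the flag \<open>res\<close> if one of the tests \<open>C s i\<close> fails. The tests depend only on arrays that the
  loop leaves alone, so they can be read in the initial store.
\<close>
lemma runs_all: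
  fixes C :: "store \<Rightarrow> nat \<Rightarrow> bool"
  assumes body: "runs B c (\<lambda>s s'. s' ''res'' 0 = (if C s (s x 0) then s ''res'' 0 else 0))"
    and W: "writes c \<subseteq> W" "x \<notin> W" "''n'' \<notin> W" "x \<noteq> ''n''" "x \<noteq> ''res''"
    and C: "\<And>s s'. (\<And>y. y \<notin> insert x W \<Longrightarrow> s' y = s y) \<Longrightarrow> C s' = C s"
    and B: "\<And>s s'. P s \<Longrightarrow> (\<And>y. y \<notin> insert x W \<Longrightarrow> s' y = s y) \<Longrightarrow> s' x 0 < s ''n'' 0 \<Longrightarrow> B s'"
  shows "runs P (For x 0 (Var ''n'') c)
     (\<lambda>s s'. s' ''res'' 0 = (if \<forall>i<s ''n'' 0. C s i then s ''res'' 0 else 0))"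
proof (rule runs_For[OF body, where N = "\<lambda>s. s ''n'' 0" and q = "[:0, 1:]" and
      I = "\<lambda>s i s'. (\<forall>y. y \<notin> insert x W \<longrightarrow> s' y = s y) \<and>
        s' ''res'' 0 = (if \<forall>j<i. C s j then s ''res'' 0 else 0)"])
  show "''n'' \<notin> writes c" using W by blast
  show "aval (Var ''n'') s' = s ''n'' 0"
    if "(\<forall>y. y \<notin> insert x W \<longrightarrow> s' y = s y) \<and> s' ''res'' 0 = (if \<forall>j<i. C s j then s ''res'' 0 else 0)" for s i s'
    using that W by simp
  show "B s'" if "P s" "(\<forall>y. y \<notin> insert x W \<longrightarrow> s' y = s y) \<and> s' ''res'' 0 = (if \<forall>j<i. C s j then s ''res'' 0 else 0)"
     "s' x 0 = i" "i < s ''n'' 0" for s i s'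
    using B[OF that(1)] that(2-4) by simp
next
  fix s i s' s''
  assume *: "(\<forall>y. y \<notin> insert x W \<longrightarrow> s' y = s y) \<and> s' ''res'' 0 = (if \<forall>j<i. C s j then s ''res'' 0 else 0)"
    "s' x 0 = i" "s'' ''res'' 0 = (if C s' (s' x 0) then s' ''res'' 0 else 0)" "frame c s' s''"
  have Ce: "C s' = C s" by (rule C) (use *(1) in blast)
  have e: "s'' y = s' y" if "y \<notin> W" for y by (rule frameD[OF *(4) W(1) that])
  have "s'' ''res'' 0 = (if \<forall>j<Suc i. C s j then s ''res'' 0 else 0)"
    using *(1-3) unfolding Ce by (auto simp: less_Suc_eq)
  then show "s'' x 0 = i \<and> (\<forall>y. y \<notin> insert x W \<longrightarrow> (s''(x := (s'' x)(0 := Suc i))) y = s y) \<and>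
     (s''(x := (s'' x)(0 := Suc i))) ''res'' 0 = (if \<forall>j<Suc i. C s j then s ''res'' 0 else 0)"
    using *(1,2) e W by auto
qed (use W in auto)

section \<open>The certifier and the verifier\<close>

text \<open>
  The vertex set under examination is kept in \<open>cert\<close>, where the certificate will be read, and copied to
  \<open>S\<close> before each call of the decision procedure, which may delete a vertex there.
\<close>
definition chosen :: "store \<Rightarrow> nat set" where
  "chosen s = {v. v < s ''n'' 0 \<and> s ''cert'' v = 1}"

lemma chosen_cong: "s' ''n'' = s ''n'' \<Longrightarrow> s' ''cert'' = s ''cert'' \<Longrightarrow> chosen s' = chosen s"
  by (simp add: chosen_def)

text \<open>
  The class is hereditary, so the decision procedure applies to all induced subgraphs.
\<close>
lemma cogem_dart_free_subset:
  assumes "cogem_dart_free S E" "S' \<subseteq> S"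
  shows "cogem_dart_free S' E"
proof -
  interpret cogem_dart_free S E by (rule assms(1))
  show ?thesis
  proof (unfold_locales)
    show "finite S'" using fin assms(2) finite_subset by blast
    show "E u v \<Longrightarrow> E v u" for u v by (rule sym)
    show "\<not> E u u" for u by (rule irr)
  next
    fix a b c d e assume *: "a \<in> S'" "b \<in> S'" "c \<in> S'" "d \<in> S'" "e \<in> S'"
      "E a b" "E b c" "E c d" "\<not> E a c" "\<not> E a d" "\<not> E b d" "\<not> E e a" "\<not> E e b" "\<not> E e c" "\<not> E e d"
    show False by (rule cogem[of a b c d e]) (use * assms(2) in auto)
  next
    fix p x y z u assume *: "p \<in> S'" "x \<in> S'" "y \<in> S'" "z \<in> S'" "u \<in> S'" "E p x" "E p y" "E p z" "E p u"
        "E x y" "E y z" "x \<noteq> z" "\<not> E x z" "\<not> E u x" "\<not> E u y" "\<not> E u z"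
    show False by (rule dart[of p x y z u]) (use * assms(2) in auto)
  qed
qed

abbreviation work :: "string set" where
  "work \<equiv> insert ''S'' scratch"

definition decide_chosen :: "nat \<Rightarrow> com" where
  "decide_chosen k = Seq (copy ''cert'' ''S'') (decide k)"

definition decide_without :: "nat \<Rightarrow> com" where
  "decide_without k = Seq (copy ''cert'' ''S'') (Seq (Assign ''S'' (Var ''x'') (Const 0)) (decide k))"

lemma writes_decide_chosen: "writes (decide_chosen k) \<subseteq> work"
  and writes_decide_without: "writes (decide_without k) \<subseteq> work"
  using writes_decide[of k] by (simp_all add: decide_chosen_def decide_without_def subset_insertI2)

definition admissible :: "store \<Rightarrow> bool" where
  "admissible s \<longleftrightarrow> ready s \<and> cogem_dart_free {..<s ''n'' 0} (edge s)"

lemma admissible_cong: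
  assumes "s' ''n'' = s ''n''" "s' ''adj'' = s ''adj''" "s' ''row'' = s ''row''"
  shows "admissible s' = admissible s"
  using ready_cong[OF assms] edge_cong[OF assms(1,2)] assms(1) by (simp add: admissible_def)

lemma admissible_subset:
  assumes "admissible s" "S \<subseteq> {..<s ''n'' 0}"
  shows "cogem_dart_free S (edge s)"
  using assms cogem_dart_free_subset unfolding admissible_def by blast

lemma runs_decide_admissible:
  "runs admissible (decide k)
     (\<lambda>s s'. (s' ''found'' 0 = 1 \<longleftrightarrow> colorable_on k (marked s) (edge s)) \<and>
        (s' ''found'' 0 = 1 \<longrightarrow> proper_on k (marked s) (edge s) (s' ''col'')))"
proof (rule runs_conseq[OF runs_decide])
  fix s assume "admissible s"
  then show "ready s \<and> cogem_dart_free (marked s) (edge s)"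
    using admissible_subset[of s "marked s"] by (auto simp: admissible_def marked_def)
qed auto

lemma runs_decide_chosen:
  "runs admissible (decide_chosen k)
     (\<lambda>s s'. (s' ''found'' 0 = 1 \<longleftrightarrow> colorable_on k (chosen s) (edge s)) \<and>
        (s' ''found'' 0 = 1 \<longrightarrow> proper_on k (chosen s) (edge s) (s' ''col'')))"
  unfolding decide_chosen_def
proof (rule runs_Seq[OF runs_copy runs_decide_admissible])
  fix s s' :: store assume "admissible s" "frame (copy ''cert'' ''S'') s s'"
  then show "admissible s'" using admissible_cong[of s' s] by (simp add: frame_def)
next
  fix s s' s'' :: store
  assume *: "\<forall>v<s ''n'' 0. s' ''S'' v = s ''cert'' v" "frame (copy ''cert'' ''S'') s s'"
    "(s'' ''found'' 0 = 1 \<longleftrightarrow> colorable_on k (marked s') (edge s')) \<and>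
     (s'' ''found'' 0 = 1 \<longrightarrow> proper_on k (marked s') (edge s') (s'' ''col''))"
  have n: "s' ''n'' = s ''n''" "s' ''adj'' = s ''adj''" using *(2) by (simp_all add: frame_def)
  have "marked s' = chosen s" using *(1) by (auto simp: marked_def chosen_def n)
  moreover have "edge s' = edge s" by (rule edge_cong[OF n])
  ultimately show "(s'' ''found'' 0 = 1 \<longleftrightarrow> colorable_on k (chosen s) (edge s)) \<and>
        (s'' ''found'' 0 = 1 \<longrightarrow> proper_on k (chosen s) (edge s) (s'' ''col''))"
    using *(3) by simp
qed simp_all

lemma runs_decide_without:
  "runs admissible (decide_without k)
     (\<lambda>s s'. s' ''found'' 0 = 1 \<longleftrightarrow> colorable_on k (chosen s - {s ''x'' 0}) (edge s))"
  unfolding decide_without_def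
proof (rule runs_Seq[OF runs_copy runs_Assign_Seq[OF runs_decide_admissible]])
  fix s s' :: store assume "admissible s" "frame (copy ''cert'' ''S'') s s'"
  then show "admissible s'" using admissible_cong[of s' s] by (simp add: frame_def)
next
  fix s :: store assume "admissible s"
  then show "admissible (s(''S'' := (s ''S'')(aval (Var ''x'') s := aval (Const 0) s)))"
    using admissible_cong[of "s(''S'' := (s ''S'')(aval (Var ''x'') s := aval (Const 0) s))" s] by simp
next
  fix s s'' :: store
  let ?t = "s(''S'' := (s ''S'')(aval (Var ''x'') s := aval (Const 0) s))"
  assume *: "(s'' ''found'' 0 = 1 \<longleftrightarrow> colorable_on k (marked ?t) (edge ?t)) \<and>
     (s'' ''found'' 0 = 1 \<longrightarrow> proper_on k (marked ?t) (edge ?t) (s'' ''col''))"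
  have "marked ?t = marked s - {s ''x'' 0}" by (auto simp: marked_def)
  moreover have "edge ?t = edge s" by (rule edge_cong) simp_all
  ultimately show "s'' ''found'' 0 = 1 \<longleftrightarrow> colorable_on k (marked s - {s ''x'' 0}) (edge s)"
    using * by simp
next
  fix s s' s'' :: store
  assume *: "\<forall>v<s ''n'' 0. s' ''S'' v = s ''cert'' v" "frame (copy ''cert'' ''S'') s s'"
    "s'' ''found'' 0 = 1 \<longleftrightarrow> colorable_on k (marked s' - {s' ''x'' 0}) (edge s')"
  have n: "s' ''n'' = s ''n''" "s' ''adj'' = s ''adj''" "s' ''x'' = s ''x''" using *(2) by (simp_all add: frame_def)
  have "marked s' = chosen s" using *(1) by (auto simp: marked_def chosen_def n)
  moreover have "edge s' = edge s" by (rule edge_cong[OF n(1,2)])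
  ultimately show "s'' ''found'' 0 = 1 \<longleftrightarrow> colorable_on k (chosen s - {s ''x'' 0}) (edge s)"
    using *(3) n(3) by simp
qed simp_all

definition critical_on :: "nat \<Rightarrow> nat set \<Rightarrow> (nat \<Rightarrow> nat \<Rightarrow> bool) \<Rightarrow> bool" where
  "critical_on k S E \<longleftrightarrow> \<not> colorable_on k S E \<and> (\<forall>v\<in>S. colorable_on k (S - {v}) E)"

lemma colorable_on_subset: "colorable_on k S E \<Longrightarrow> S' \<subseteq> S \<Longrightarrow> colorable_on k S' E"
  unfolding colorable_on_def by blast

definition shrink :: "nat \<Rightarrow> com" where
  "shrink k = For ''x'' 0 (Var ''n'') (Seq (decide_without k)
     (Cond (Equal (Var ''found'') (Const 1)) Skip (Assign ''cert'' (Var ''x'') (Const 0))))"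

lemma writes_shrink: "writes (shrink k) \<subseteq> insert ''x'' (insert ''cert'' work)"
  using writes_decide_without[of k] by (simp add: shrink_def subset_insertI2)

text \<open>
  One pass through the vertices suffices: if \<open>v\<close> had to be kept because the current graph without \<open>v\<close> was
  colourable, the same is true of every smaller graph reached later.
\<close>
lemma runs_shrink:
  "runs (\<lambda>s. admissible s \<and> (\<forall>v<s ''n'' 0. s ''cert'' v = 1) \<and> \<not> colorable_on k (chosen s) (edge s)) (shrink k)
     (\<lambda>s s'. (\<forall>v<s ''n'' 0. s' ''cert'' v \<le> 1) \<and> critical_on k (chosen s') (edge s))"
proof -
  let ?c = "Seq (decide_without k) (Cond (Equal (Var ''found'') (Const 1)) Skip (Assign ''cert'' (Var ''x'') (Const 0)))"
  have wb: "writes ?c \<subseteq> insert ''cert'' work"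
    using writes_decide_without[of k] by (simp add: subset_insertI2)
  have upd: "runs (\<lambda>_. True) (Cond (Equal (Var ''found'') (Const 1)) Skip (Assign ''cert'' (Var ''x'') (Const 0)))
     (\<lambda>s s'. s' ''cert'' = (if s ''found'' 0 = 1 then s ''cert'' else (s ''cert'')(s ''x'' 0 := 0)))"
    by (intro runs_Cond runs_Skip runs_Assign) auto
  have body: "runs admissible ?c (\<lambda>s s'. s' ''cert'' = (if colorable_on k (chosen s - {s ''x'' 0}) (edge s)
      then s ''cert'' else (s ''cert'')(s ''x'' 0 := 0)))"
  proof (rule runs_Seq[OF runs_decide_without upd])
    show "''n'' \<notin> writes (decide_without k)" by (rule contra_subsetD[OF writes_decide_without]) simp
    fix s s' s'' :: store
    assume *: "s' ''found'' 0 = 1 \<longleftrightarrow> colorable_on k (chosen s - {s ''x'' 0}) (edge s)"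
      "s'' ''cert'' = (if s' ''found'' 0 = 1 then s' ''cert'' else (s' ''cert'')(s' ''x'' 0 := 0))"
      "frame (decide_without k) s s'"
    have "s' ''cert'' = s ''cert''" "s' ''x'' = s ''x''"
      by (rule frameD[OF *(3) writes_decide_without]; simp)+
    then show "s'' ''cert'' = (if colorable_on k (chosen s - {s ''x'' 0}) (edge s)
      then s ''cert'' else (s ''cert'')(s ''x'' 0 := 0))" using *(1,2) by simp
  qed simp
  define I where "I s i s' \<longleftrightarrow> (\<forall>y. y \<notin> insert ''x'' (insert ''cert'' work) \<longrightarrow> s' y = s y) \<and>
     (\<forall>v<s ''n'' 0. s' ''cert'' v \<le> 1 \<and> (i \<le> v \<longrightarrow> s' ''cert'' v = 1)) \<and>
     \<not> colorable_on k (chosen s') (edge s) \<and>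
     (\<forall>v\<in>chosen s'. v < i \<longrightarrow> colorable_on k (chosen s' - {v}) (edge s))" for s i s'
  show ?thesis unfolding shrink_def
  proof (rule runs_For[OF body, where N = "\<lambda>s. s ''n'' 0" and q = "[:0, 1:]" and I = I])
    show "''n'' \<notin> writes ?c" by (rule contra_subsetD[OF wb]) simp
  next
    fix s i s' assume *: "admissible s \<and> (\<forall>v<s ''n'' 0. s ''cert'' v = 1) \<and> \<not> colorable_on k (chosen s) (edge s)" "I s i s'"
    have "\<forall>y. y \<notin> insert ''x'' (insert ''cert'' work) \<longrightarrow> s' y = s y" using *(2) unfolding I_def by (rule conjunct1)
    note e = this[rule_format]
    show "admissible s'" using *(1) admissible_cong[of s' s] by (simp add: e)
    show "aval (Var ''n'') s' = s ''n'' 0" by (simp add: e)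
  next
    fix s i s' s''
    assume *: "I s i s'" "s' ''x'' 0 = i" "i < s ''n'' 0"
      "s'' ''cert'' = (if colorable_on k (chosen s' - {s' ''x'' 0}) (edge s') then s' ''cert'' else (s' ''cert'')(s' ''x'' 0 := 0))"
      "frame ?c s' s''"
    have "\<forall>y. y \<notin> insert ''x'' (insert ''cert'' work) \<longrightarrow> s' y = s y" using *(1) unfolding I_def by (rule conjunct1)
    note e = this[rule_format]
    have e2: "s'' y = s' y" if "y \<notin> insert ''cert'' work" for y by (rule frameD[OF *(5) wb that])
    have ed: "edge s' = edge s" by (rule edge_cong) (simp_all add: e)
    have i: "\<forall>v<s ''n'' 0. s' ''cert'' v \<le> 1 \<and> (i \<le> v \<longrightarrow> s' ''cert'' v = 1)"
      "\<not> colorable_on k (chosen s') (edge s)"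
      "\<forall>v\<in>chosen s'. v < i \<longrightarrow> colorable_on k (chosen s' - {v}) (edge s)"
      using *(1) unfolding I_def by blast+
    let ?t = "s''(''x'' := (s'' ''x'')(0 := Suc i))"
    have n: "s'' ''n'' = s' ''n''" by (simp add: e2)
    have ct: "chosen ?t = chosen s''" by (rule chosen_cong) simp_all
    have "(\<forall>v<s ''n'' 0. s'' ''cert'' v \<le> 1 \<and> (Suc i \<le> v \<longrightarrow> s'' ''cert'' v = 1)) \<and>
     \<not> colorable_on k (chosen s'') (edge s) \<and>
     (\<forall>v\<in>chosen s''. v < Suc i \<longrightarrow> colorable_on k (chosen s'' - {v}) (edge s))"
    proof (cases "colorable_on k (chosen s' - {i}) (edge s)")
      case True
      then have c: "s'' ''cert'' = s' ''cert''" using *(4) by (simp add: *(2) ed)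
      have "chosen s'' = chosen s'" by (rule chosen_cong[OF n c])
      then show ?thesis using i True c by (auto simp: less_Suc_eq)
    next
      case False
      then have c: "s'' ''cert'' = (s' ''cert'')(i := 0)" using *(4) by (simp add: *(2) ed)
      have ch: "chosen s'' = chosen s' - {i}" by (auto simp: chosen_def n c)
      have "colorable_on k (chosen s'' - {v}) (edge s)" if "v \<in> chosen s''" "v < Suc i" for v
      proof -
        have "v \<in> chosen s'" "v < i" using that ch by auto
        then have "colorable_on k (chosen s' - {v}) (edge s)" using i(3) by blast
        then show ?thesis by (rule colorable_on_subset) (auto simp: ch)
      qed
      then show ?thesis using i(1) False by (auto simp: c ch)
    qed
    moreover have "\<forall>y. y \<notin> insert ''x'' (insert ''cert'' work) \<longrightarrow> ?t y = s y" using e e2 by simp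
    ultimately have "I s (Suc i) ?t" unfolding I_def ct by simp
    moreover have "s'' ''x'' 0 = i" using *(2) by (simp add: e2)
    ultimately show "s'' ''x'' 0 = i \<and> I s (Suc i) ?t" by blast
  next
    fix s s' assume *: "I s (s ''n'' 0) s'"
    have "s' ''n'' = s ''n''" using * unfolding I_def by simp
    then have "v < s ''n'' 0" if "v \<in> chosen s'" for v using that by (simp add: chosen_def)
    then show "(\<forall>v<s ''n'' 0. s' ''cert'' v \<le> 1) \<and> critical_on k (chosen s') (edge s)"
      using * unfolding I_def critical_on_def by blast
  next
    fix s assume *: "admissible s \<and> (\<forall>v<s ''n'' 0. s ''cert'' v = 1) \<and> \<not> colorable_on k (chosen s) (edge s)"
    have "chosen (s(''x'' := (s ''x'')(0 := 0))) = chosen s" by (rule chosen_cong) simp_all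
    then show "I s 0 (s(''x'' := (s ''x'')(0 := 0)))" using * by (simp add: I_def)
  qed simp_all
qed

definition input :: "store \<Rightarrow> bool" where
  "input s \<longleftrightarrow> (\<forall>i. s ''adj'' i \<le> 1) \<and> cogem_dart_free {..<s ''n'' 0} (edge s)"

lemma writes_prepare: "writes prepare = {''r'', ''v'', ''row'', ''adj''}"
  by (auto simp: prepare_def)

lemma runs_prepare_input:
  "runs input prepare (\<lambda>s s'. admissible s' \<and> edge s' = edge s)"
proof (rule runs_conseq[OF runs_prepare])
  fix s s' :: store
  assume *: "input s" "ready s' \<and> (\<forall>u v. edge s' u v \<longleftrightarrow> u \<noteq> v \<and> edge s u v)" "frame prepare s s'"
  interpret cogem_dart_free "{..<s ''n'' 0}" "edge s" using *(1) by (simp add: input_def)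
  have "edge s' u v = edge s u v" for u v using *(2) irr by (cases "u = v") simp_all
  then have "edge s' = edge s" by (simp add: fun_eq_iff)
  moreover have "s' ''n'' = s ''n''" using *(3) by (simp add: frame_def writes_prepare)
  ultimately show "admissible s' \<and> edge s' = edge s"
    using *(1,2) by (simp add: admissible_def input_def)
qed (simp add: input_def)

definition certify :: "nat \<Rightarrow> com" where
  "certify k = Seq prepare (Seq (For ''x'' 0 (Var ''n'') (Assign ''cert'' (Var ''x'') (Const 1)))
     (Seq (decide_chosen k) (Cond (Equal (Var ''found'') (Const 1))
       (Seq (copy ''col'' ''cert'') (Put ''ans'' (Const 1)))
       (Seq (shrink k) (Put ''ans'' (Const 0))))))"

definition certified :: "nat \<Rightarrow> nat \<Rightarrow> (nat \<Rightarrow> nat \<Rightarrow> bool) \<Rightarrow> store \<Rightarrow> bool" where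
  "certified k n E s' \<longleftrightarrow> (if colorable_on k {..<n} E
     then s' ''ans'' 0 = 1 \<and> proper_on k {..<n} E (s' ''cert'')
     else s' ''ans'' 0 = 0 \<and> (\<forall>v<n. s' ''cert'' v \<le> 1) \<and> critical_on k {v. v < n \<and> s' ''cert'' v = 1} E)"

lemma runs_certify: "runs input (certify k) (\<lambda>s. certified k (s ''n'' 0) (edge s))"
proof -
  define full where "full s \<longleftrightarrow> (\<forall>v<s ''n'' 0. s ''cert'' v = 1)" for s :: store
  have chosen_full: "chosen s = {..<s ''n'' 0}" if "full s" for s
    using that by (auto simp: full_def chosen_def)
  have fill: "runs admissible (For ''x'' 0 (Var ''n'') (Assign ''cert'' (Var ''x'') (Const 1))) (\<lambda>s. full)"
  proof (rule runs_For[where N = "\<lambda>s. s ''n'' 0" and q = "[:0, 1:]" and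
      I = "\<lambda>s i s'. s' ''n'' = s ''n'' \<and> (\<forall>v<i. s' ''cert'' v = 1)"])
    show "runs (\<lambda>_. True) (Assign ''cert'' (Var ''x'') (Const 1))
     (\<lambda>s s'. s' = s(''cert'' := (s ''cert'')(s ''x'' 0 := 1)))"
      by (rule runs_Assign) simp
  qed (auto simp: less_Suc_eq full_def)
  let ?yes = "Seq (copy ''col'' ''cert'') (Put ''ans'' (Const 1))"
  let ?no = "Seq (shrink k) (Put ''ans'' (Const 0))"
  have put: "runs (\<lambda>_. True) (Put ''ans'' (Const j)) (\<lambda>s s'. s' = s(''ans'' := (s ''ans'')(0 := j)))" for j
    by (rule runs_Assign) simp
  define mid where "mid s \<longleftrightarrow> admissible s \<and> full s \<and>
     (s ''found'' 0 = 1 \<longleftrightarrow> colorable_on k {..<s ''n'' 0} (edge s)) \<and>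
     (s ''found'' 0 = 1 \<longrightarrow> proper_on k {..<s ''n'' 0} (edge s) (s ''col''))" for s
  have yes: "runs (\<lambda>s. mid s \<and> bval (Equal (Var ''found'') (Const 1)) s) ?yes (\<lambda>s. certified k (s ''n'' 0) (edge s))"
  proof (rule runs_Seq[OF runs_copy put])
    fix s s' s'' :: store
    assume *: "mid s \<and> bval (Equal (Var ''found'') (Const 1)) s" "\<forall>v<s ''n'' 0. s' ''cert'' v = s ''col'' v"
      "s'' = s'(''ans'' := (s' ''ans'')(0 := 1))"
    have "proper_on k {..<s ''n'' 0} (edge s) (s ''col'')" "colorable_on k {..<s ''n'' 0} (edge s)"
      using *(1) unfolding mid_def by auto
    moreover have "s'' ''ans'' 0 = 1" "\<forall>v<s ''n'' 0. s'' ''cert'' v = s ''col'' v" using *(2,3) by simp_all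
    ultimately show "certified k (s ''n'' 0) (edge s) s''"
      by (simp add: certified_def proper_on_def)
  qed simp_all
  have no: "runs (\<lambda>s. mid s \<and> \<not> bval (Equal (Var ''found'') (Const 1)) s) ?no (\<lambda>s. certified k (s ''n'' 0) (edge s))"
  proof (rule runs_Seq[OF _ put])
    show "runs (\<lambda>s. mid s \<and> \<not> bval (Equal (Var ''found'') (Const 1)) s) (shrink k)
       (\<lambda>s s'. (\<forall>v<s ''n'' 0. s' ''cert'' v \<le> 1) \<and> critical_on k (chosen s') (edge s))"
    proof (rule runs_conseq[OF runs_shrink])
      fix s assume "mid s \<and> \<not> bval (Equal (Var ''found'') (Const 1)) s"
      then show "admissible s \<and> (\<forall>v<s ''n'' 0. s ''cert'' v = 1) \<and> \<not> colorable_on k (chosen s) (edge s)"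
        using chosen_full[of s] by (auto simp: mid_def full_def)
    qed
    show "''n'' \<notin> writes (shrink k)" by (rule contra_subsetD[OF writes_shrink]) simp
  next
    fix s s' s'' :: store
    assume *: "mid s \<and> \<not> bval (Equal (Var ''found'') (Const 1)) s"
      "(\<forall>v<s ''n'' 0. s' ''cert'' v \<le> 1) \<and> critical_on k (chosen s') (edge s)"
      "s'' = s'(''ans'' := (s' ''ans'')(0 := 0))" "frame (shrink k) s s'"
    have n: "s' ''n'' = s ''n''" by (rule frameD[OF *(4) writes_shrink]) simp
    have c: "s'' ''ans'' 0 = 0" "s'' ''cert'' = s' ''cert''" using *(3) by simp_all
    have "\<not> colorable_on k {..<s ''n'' 0} (edge s)" using *(1) by (auto simp: mid_def)
    then show "certified k (s ''n'' 0) (edge s) s''"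
      using *(2) c by (simp add: certified_def chosen_def n)
  qed simp_all
  have last: "runs mid (Cond (Equal (Var ''found'') (Const 1)) ?yes ?no) (\<lambda>s. certified k (s ''n'' 0) (edge s))"
    by (rule runs_Cond[OF yes no])
  have dec: "runs (\<lambda>s. admissible s \<and> full s) (decide_chosen k) (\<lambda>s s'. mid s' \<and> s' ''n'' = s ''n'' \<and> edge s' = edge s)"
  proof (rule runs_conseq[OF runs_decide_chosen])
    fix s s' :: store
    assume *: "admissible s \<and> full s" "frame (decide_chosen k) s s'"
      "(s' ''found'' 0 = 1 \<longleftrightarrow> colorable_on k (chosen s) (edge s)) \<and>
        (s' ''found'' 0 = 1 \<longrightarrow> proper_on k (chosen s) (edge s) (s' ''col''))"
    have e: "s' y = s y" if "y \<notin> work" for y by (rule frameD[OF *(2) writes_decide_chosen that])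
    have ed: "edge s' = edge s" by (rule edge_cong) (simp_all add: e)
    have "admissible s'" using *(1) admissible_cong[of s' s] by (simp add: e)
    moreover have "full s'" using *(1) by (simp add: full_def e)
    ultimately have "mid s'" using *(1,3) chosen_full[of s] by (simp add: mid_def ed e)
    then show "mid s' \<and> s' ''n'' = s ''n'' \<and> edge s' = edge s" by (simp add: ed e)
  qed simp
  have 2: "runs (\<lambda>s. admissible s \<and> full s) (Seq (decide_chosen k) (Cond (Equal (Var ''found'') (Const 1)) ?yes ?no))
     (\<lambda>s. certified k (s ''n'' 0) (edge s))"
  proof (rule runs_Seq[OF dec last])
    show "''n'' \<notin> writes (decide_chosen k)" by (rule contra_subsetD[OF writes_decide_chosen]) simp
  qed auto
  have 3: "runs admissible (Seq (For ''x'' 0 (Var ''n'') (Assign ''cert'' (Var ''x'') (Const 1)))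
     (Seq (decide_chosen k) (Cond (Equal (Var ''found'') (Const 1)) ?yes ?no)))
     (\<lambda>s. certified k (s ''n'' 0) (edge s))"
  proof (rule runs_Seq[OF fill 2])
    fix s s' s'' :: store
    assume *: "admissible s" "full s'" "frame (For ''x'' 0 (Var ''n'') (Assign ''cert'' (Var ''x'') (Const 1))) s s'"
    have e: "s' y = s y" if "y \<notin> {''x'', ''cert''}" for y by (rule frameD[OF *(3) _ that]) simp
    have ed: "edge s' = edge s" by (rule edge_cong) (simp_all add: e)
    show "admissible s' \<and> full s'" using *(1,2) admissible_cong[of s' s] by (simp add: e)
    show "certified k (s ''n'' 0) (edge s) s''" if "certified k (s' ''n'' 0) (edge s') s''"
      using that by (simp add: ed e)
  qed auto
  show ?thesis unfolding certify_def
  proof (rule runs_Seq[OF runs_prepare_input 3])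
    show "''n'' \<notin> writes prepare" by (simp add: writes_prepare)
  next
    fix s s' s'' :: store
    assume *: "admissible s' \<and> edge s' = edge s" "certified k (s' ''n'' 0) (edge s') s''" "frame prepare s s'"
    have "s' ''n'' = s ''n''" using *(3) by (simp add: frame_def writes_prepare)
    then show "certified k (s ''n'' 0) (edge s) s''" using *(1,2) by simp
  qed simp
qed

definition check_vertex :: "nat \<Rightarrow> com" where
  "check_vertex k = Seq (Cond (Less (Cell ''cert'' (Var ''x'')) (Const k)) Skip (Put ''res'' (Const 0)))
     (For ''v'' 0 (Var ''n'') (Cond (Conj (Equal (Cell ''adj'' (Plus (Cell ''row'' (Var ''x'')) (Var ''v''))) (Const 1))
         (Equal (Cell ''cert'' (Var ''x'')) (Cell ''cert'' (Var ''v'')))) (Put ''res'' (Const 0)) Skip))"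

definition check_coloring :: "nat \<Rightarrow> com" where
  "check_coloring k = For ''x'' 0 (Var ''n'') (check_vertex k)"

definition fine :: "nat \<Rightarrow> store \<Rightarrow> nat \<Rightarrow> bool" where
  "fine k s u \<longleftrightarrow> s ''cert'' u < k \<and> (\<forall>v<s ''n'' 0. \<not> (s ''adj'' (s ''row'' u + v) = 1 \<and> s ''cert'' u = s ''cert'' v))"

lemma runs_check_vertex:
  "runs (\<lambda>_. True) (check_vertex k) (\<lambda>s s'. s' ''res'' 0 = (if fine k s (s ''x'' 0) then s ''res'' 0 else 0))"
proof -
  let ?C = "\<lambda>s v. \<not> (s ''adj'' (s ''row'' (s ''x'' 0) + v) = 1 \<and> s ''cert'' (s ''x'' 0) = s ''cert'' v)"
  let ?b = "Cond (Conj (Equal (Cell ''adj'' (Plus (Cell ''row'' (Var ''x'')) (Var ''v''))) (Const 1))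
         (Equal (Cell ''cert'' (Var ''x'')) (Cell ''cert'' (Var ''v'')))) (Put ''res'' (Const 0)) Skip"
  have b: "runs (\<lambda>_. True) ?b (\<lambda>s s'. s' ''res'' 0 = (if ?C s (s ''v'' 0) then s ''res'' 0 else 0))"
    by (intro runs_Cond runs_Skip runs_Assign) auto
  have loop: "runs (\<lambda>_. True) (For ''v'' 0 (Var ''n'') ?b)
     (\<lambda>s s'. s' ''res'' 0 = (if \<forall>i<s ''n'' 0. ?C s i then s ''res'' 0 else 0))"
    by (rule runs_all[where x = "''v''" and C = ?C and W = "{''res''}", OF b]) auto
  have first: "runs (\<lambda>_. True) (Cond (Less (Cell ''cert'' (Var ''x'')) (Const k)) Skip (Put ''res'' (Const 0)))
     (\<lambda>s s'. s' = s(''res'' := (s ''res'')(0 := if s ''cert'' (s ''x'' 0) < k then s ''res'' 0 else 0)))"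
    by (intro runs_Cond runs_Skip runs_Assign) auto
  show ?thesis unfolding check_vertex_def
    by (rule runs_Seq[OF first loop]) (auto simp: fine_def)
qed

lemma runs_check_coloring:
  "runs admissible (check_coloring k)
     (\<lambda>s s'. s' ''res'' 0 = (if proper_on k {..<s ''n'' 0} (edge s) (s ''cert'') then s ''res'' 0 else 0))"
proof (rule runs_conseq)
  show "runs admissible (check_coloring k) (\<lambda>s s'. s' ''res'' 0 = (if \<forall>i<s ''n'' 0. fine k s i then s ''res'' 0 else 0))"
    unfolding check_coloring_def
    by (rule runs_all[where x = "''x''" and C = "fine k" and W = "{''res'', ''v''}", OF runs_check_vertex])
      (auto simp: check_vertex_def fine_def fun_eq_iff)
  fix s s' :: store
  assume *: "admissible s" "s' ''res'' 0 = (if \<forall>i<s ''n'' 0. fine k s i then s ''res'' 0 else 0)"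
  have "(\<forall>i<s ''n'' 0. fine k s i) \<longleftrightarrow> proper_on k {..<s ''n'' 0} (edge s) (s ''cert'')"
    using *(1) by (auto simp: fine_def proper_on_def edge_def admissible_def ready_def)
  then show "s' ''res'' 0 = (if proper_on k {..<s ''n'' 0} (edge s) (s ''cert'') then s ''res'' 0 else 0)"
    using *(2) by simp
qed

definition check_critical :: "nat \<Rightarrow> com" where
  "check_critical k = Seq (Seq (decide_chosen k) (Cond (Equal (Var ''found'') (Const 1)) (Put ''res'' (Const 0)) Skip))
     (For ''x'' 0 (Var ''n'') (Seq (decide_without k)
       (Cond (Conj (Neg (Equal (Var ''found'') (Const 1))) (Equal (Cell ''cert'' (Var ''x'')) (Const 1)))
          (Put ''res'' (Const 0)) Skip)))"

lemma runs_check_critical: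
  "runs admissible (check_critical k)
     (\<lambda>s s'. s' ''res'' 0 = (if critical_on k (chosen s) (edge s) then s ''res'' 0 else 0))"
proof -
  let ?C = "\<lambda>s v. s ''cert'' v = 1 \<longrightarrow> colorable_on k (chosen s - {v}) (edge s)"
  let ?u = "Cond (Conj (Neg (Equal (Var ''found'') (Const 1))) (Equal (Cell ''cert'' (Var ''x'')) (Const 1)))
          (Put ''res'' (Const 0)) Skip"
  let ?W = "insert ''res'' work"
  have u: "runs (\<lambda>_. True) ?u
     (\<lambda>s s'. s' ''res'' 0 = (if s ''cert'' (s ''x'' 0) = 1 \<longrightarrow> s ''found'' 0 = 1 then s ''res'' 0 else 0))"
    by (intro runs_Cond runs_Skip runs_Assign) auto
  have b: "runs admissible (Seq (decide_without k) ?u) (\<lambda>s s'. s' ''res'' 0 = (if ?C s (s ''x'' 0) then s ''res'' 0 else 0))"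
  proof (rule runs_Seq[OF runs_decide_without u])
    show "''n'' \<notin> writes (decide_without k)" by (rule contra_subsetD[OF writes_decide_without]) simp
  next
    fix s s' s'' :: store
    assume *: "s' ''found'' 0 = 1 \<longleftrightarrow> colorable_on k (chosen s - {s ''x'' 0}) (edge s)"
      "s'' ''res'' 0 = (if s' ''cert'' (s' ''x'' 0) = 1 \<longrightarrow> s' ''found'' 0 = 1 then s' ''res'' 0 else 0)"
      "frame (decide_without k) s s'"
    have e: "s' y = s y" if "y \<notin> work" for y by (rule frameD[OF *(3) writes_decide_without that])
    show "s'' ''res'' 0 = (if ?C s (s ''x'' 0) then s ''res'' 0 else 0)"
      using *(1,2) by (simp add: e)
  qed simp
  have loop: "runs admissible (For ''x'' 0 (Var ''n'') (Seq (decide_without k) ?u))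
     (\<lambda>s s'. s' ''res'' 0 = (if \<forall>i<s ''n'' 0. ?C s i then s ''res'' 0 else 0))"
  proof (rule runs_all[where x = "''x''" and C = ?C and W = ?W, OF b])
    show "writes (Seq (decide_without k) ?u) \<subseteq> ?W"
      using writes_decide_without[of k] by (simp add: subset_insertI2)
  next
    fix s s' :: store assume e: "\<And>y. y \<notin> insert ''x'' ?W \<Longrightarrow> s' y = s y"
    have "chosen s' = chosen s" by (rule chosen_cong) (simp_all add: e)
    moreover have "edge s' = edge s" by (rule edge_cong) (simp_all add: e)
    ultimately show "?C s' = ?C s" by (simp add: e)
  next
    fix s s' :: store assume e: "admissible s" "\<And>y. y \<notin> insert ''x'' ?W \<Longrightarrow> s' y = s y"
    show "admissible s'" using e(1) admissible_cong[of s' s] by (simp add: e(2))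
  qed auto
  let ?f = "Cond (Equal (Var ''found'') (Const 1)) (Put ''res'' (Const 0)) Skip"
  have f: "runs (\<lambda>_. True) ?f (\<lambda>s s'. s' ''res'' 0 = (if s ''found'' 0 = 1 then 0 else s ''res'' 0))"
    by (intro runs_Cond runs_Skip runs_Assign) auto
  have wf: "writes (Seq (decide_chosen k) ?f) \<subseteq> ?W"
    using writes_decide_chosen[of k] by (simp add: subset_insertI2)
  have first: "runs admissible (Seq (decide_chosen k) ?f)
     (\<lambda>s s'. s' ''res'' 0 = (if colorable_on k (chosen s) (edge s) then 0 else s ''res'' 0))"
  proof (rule runs_Seq[OF runs_decide_chosen f])
    show "''n'' \<notin> writes (decide_chosen k)" by (rule contra_subsetD[OF writes_decide_chosen]) simp
  next
    fix s s' s'' :: store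
    assume *: "(s' ''found'' 0 = 1 \<longleftrightarrow> colorable_on k (chosen s) (edge s)) \<and>
        (s' ''found'' 0 = 1 \<longrightarrow> proper_on k (chosen s) (edge s) (s' ''col''))"
      "s'' ''res'' 0 = (if s' ''found'' 0 = 1 then 0 else s' ''res'' 0)" "frame (decide_chosen k) s s'"
    have "s' ''res'' = s ''res''" by (rule frameD[OF *(3) writes_decide_chosen]) simp
    then show "s'' ''res'' 0 = (if colorable_on k (chosen s) (edge s) then 0 else s ''res'' 0)"
      using *(1,2) by simp
  qed simp
  show ?thesis unfolding check_critical_def
  proof (rule runs_Seq[OF first loop])
    show "''n'' \<notin> writes (Seq (decide_chosen k) ?f)" by (rule contra_subsetD[OF wf]) simp
  next
    fix s s' :: store
    assume *: "admissible s" "frame (Seq (decide_chosen k) ?f) s s'"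
    have e: "s' y = s y" if "y \<notin> ?W" for y by (rule frameD[OF *(2) wf that])
    show "admissible s'" using *(1) admissible_cong[of s' s] by (simp add: e)
  next
    fix s s' s'' :: store
    assume *: "s' ''res'' 0 = (if colorable_on k (chosen s) (edge s) then 0 else s ''res'' 0)"
      "s'' ''res'' 0 = (if \<forall>i<s' ''n'' 0. ?C s' i then s' ''res'' 0 else 0)" "frame (Seq (decide_chosen k) ?f) s s'"
    have e: "s' y = s y" if "y \<notin> ?W" for y by (rule frameD[OF *(3) wf that])
    have ce: "chosen s' = chosen s" "edge s' = edge s" by (rule chosen_cong edge_cong; simp add: e)+
    have "(\<forall>i<s' ''n'' 0. ?C s' i) \<longleftrightarrow> (\<forall>v\<in>chosen s. colorable_on k (chosen s - {v}) (edge s))"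
      unfolding ce by (auto simp: e chosen_def)
    then show "s'' ''res'' 0 = (if critical_on k (chosen s) (edge s) then s ''res'' 0 else 0)"
      using *(1,2) unfolding critical_on_def by simp
  qed
qed

definition verify :: "nat \<Rightarrow> com" where
  "verify k = Seq prepare (Seq (Put ''res'' (Const 1))
     (Seq (Cond (Equal (Var ''ans'') (Const 1)) (check_coloring k) (check_critical k))
       (Put ''ans'' (Var ''res''))))"

definition valid :: "nat \<Rightarrow> store \<Rightarrow> bool" where
  "valid k s \<longleftrightarrow> (if s ''ans'' 0 = 1 then proper_on k {..<s ''n'' 0} (edge s) (s ''cert'')
      else critical_on k (chosen s) (edge s))"

lemma runs_verify: "runs input (verify k) (\<lambda>s s'. s' ''ans'' 0 = 1 \<longleftrightarrow> valid k s)"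
proof -
  let ?check = "Cond (Equal (Var ''ans'') (Const 1)) (check_coloring k) (check_critical k)"
  have check: "runs admissible ?check (\<lambda>s s'. s' ''res'' 0 = (if valid k s then s ''res'' 0 else 0))"
    by (rule runs_Cond; rule runs_conseq, rule runs_check_coloring runs_check_critical)
      (auto simp: valid_def)
  have wc: "''n'' \<notin> writes ?check"
    using writes_decide_chosen[of k] writes_decide_without[of k]
    by (auto simp: check_coloring_def check_vertex_def check_critical_def)
  have put: "runs (\<lambda>_. True) (Put ''ans'' (Var ''res'')) (\<lambda>s s'. s' ''ans'' 0 = s ''res'' 0)"
    by (rule runs_Assign) simp
  have 1: "runs admissible (Seq ?check (Put ''ans'' (Var ''res'')))
      (\<lambda>s s'. s' ''ans'' 0 = (if valid k s then s ''res'' 0 else 0))"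
    by (rule runs_Seq[OF check put wc]) auto
  have 2: "runs admissible (Seq (Put ''res'' (Const 1)) (Seq ?check (Put ''ans'' (Var ''res''))))
      (\<lambda>s s'. s' ''ans'' 0 = 1 \<longleftrightarrow> valid k s)"
  proof (rule runs_Assign_Seq[OF 1])
    fix s :: store assume "admissible s"
    then show "admissible (s(''res'' := (s ''res'')(aval (Const 0) s := aval (Const 1) s)))"
      using admissible_cong[of "s(''res'' := (s ''res'')(aval (Const 0) s := aval (Const 1) s))" s] by simp
  next
    fix s s'' :: store
    let ?t = "s(''res'' := (s ''res'')(aval (Const 0) s := aval (Const 1) s))"
    have "edge ?t = edge s" "chosen ?t = chosen s" by (rule edge_cong chosen_cong; simp)+
    then have "valid k ?t = valid k s" by (simp add: valid_def)
    moreover assume "s'' ''ans'' 0 = (if valid k ?t then ?t ''res'' 0 else 0)"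
    ultimately show "s'' ''ans'' 0 = 1 \<longleftrightarrow> valid k s" by simp
  qed simp
  show ?thesis unfolding verify_def
  proof (rule runs_Seq[OF runs_prepare_input 2])
    show "''n'' \<notin> writes prepare" by (simp add: writes_prepare)
  next
    fix s s' s'' :: store
    assume *: "admissible s' \<and> edge s' = edge s" "s'' ''ans'' 0 = 1 \<longleftrightarrow> valid k s'" "frame prepare s s'"
    have e: "s' y = s y" if "y \<notin> {''r'', ''v'', ''row'', ''adj''}" for y
      using *(3) that by (simp add: frame_def writes_prepare)
    have "chosen s' = chosen s" by (rule chosen_cong) (simp_all add: e)
    then show "s'' ''ans'' 0 = 1 \<longleftrightarrow> valid k s" using *(1,2) by (simp add: valid_def e)
  qed simp
qed

section \<open>Graphs, their encodings and the main result\<close>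
definition adjacent :: "'a graph \<Rightarrow> 'a \<Rightarrow> 'a \<Rightarrow> bool" where
  "adjacent G u v \<longleftrightarrow> {u, v} \<in> edges G"

lemma adjacent_sym: "adjacent G u v \<Longrightarrow> adjacent G v u"
  by (simp add: adjacent_def insert_commute)

lemma adjacent_verts:
  assumes "simple_graph G" "adjacent G u v"
  shows "u \<in> verts G" "v \<in> verts G" "u \<noteq> v"
proof -
  obtain x y where "{u, v} = {x, y}" "x \<in> verts G" "y \<in> verts G" "x \<noteq> y"
    using assms unfolding simple_graph_def adjacent_def by blast
  then show "u \<in> verts G" "v \<in> verts G" "u \<noteq> v" by (auto simp: doubleton_eq_iff)
qed

lemma simple_graph_induced:
  assumes "simple_graph G" "S \<subseteq> verts G"
  shows "simple_graph (induced G S)"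
proof -
  have "\<exists>u v. e = {u, v} \<and> u \<in> S \<and> v \<in> S \<and> u \<noteq> v" if e: "e \<in> edges G" "e \<subseteq> S" for e
  proof -
    obtain u v where "e = {u, v}" "u \<noteq> v" using assms(1) e(1) unfolding simple_graph_def by blast
    then show ?thesis using e(2) by blast
  qed
  then have "edges (induced G S) \<subseteq> {{u, v} | u v. u \<in> S \<and> v \<in> S \<and> u \<noteq> v}"
    by (auto simp: induced_def)
  moreover have "finite S" using assms finite_subset unfolding simple_graph_def by blast
  ultimately show ?thesis by (simp add: simple_graph_def induced_def)
qed

lemma proper_coloring_iff:
  "proper_coloring k G c \<longleftrightarrow> (\<forall>v\<in>verts G. c v < k) \<and> (\<forall>u\<in>verts G. \<forall>v\<in>verts G. adjacent G u v \<longrightarrow> c u \<noteq> c v)"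
  by (simp add: proper_coloring_def adjacent_def)

lemma colorable_iff:
  assumes "simple_graph G"
  shows "colorable k G \<longleftrightarrow> (\<exists>c. proper_coloring k G c)"
proof -
  have "finite (verts G)" using assms by (simp add: simple_graph_def)
  then obtain f where f: "bij_betw f (verts G) {0..<card (verts G)}"
    using ex_bij_betw_finite_nat by blast
  have "proper_coloring (card (verts G)) G f"
    unfolding proper_coloring_iff
  proof (intro conjI ballI impI)
    show "f v < card (verts G)" if "v \<in> verts G" for v using f that by (auto simp: bij_betw_def)
    show "f u \<noteq> f v" if "u \<in> verts G" "v \<in> verts G" "adjacent G u v" for u v
      using bij_betw_imp_inj_on[OF f] adjacent_verts(3)[OF assms that(3)] that(1,2) by (simp add: inj_on_eq_iff)
  qed
  then have "\<exists>j c. proper_coloring j G c" by blast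
  then have "\<exists>c. proper_coloring (chromatic_number G) G c"
    unfolding chromatic_number_def by (rule LeastI_ex)
  moreover have "proper_coloring k G c" if "proper_coloring m G c" "m \<le> k" for c m
    using that by (auto simp: proper_coloring_def intro: less_le_trans)
  moreover have "chromatic_number G \<le> k" if "\<exists>c. proper_coloring k G c"
    unfolding chromatic_number_def by (rule Least_le[of "\<lambda>k. \<exists>c. proper_coloring k G c", OF that])
  ultimately show ?thesis unfolding colorable_def by blast
qed

lemma proper_coloring_induced:
  "proper_coloring k (induced G S) c \<longleftrightarrow> proper_on k S (adjacent G) c"
  by (auto simp: proper_coloring_def proper_on_def induced_def adjacent_def)

lemma colorable_induced:
  assumes "simple_graph G" "S \<subseteq> verts G"
  shows "colorable k (induced G S) \<longleftrightarrow> colorable_on k S (adjacent G)"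
  using colorable_iff[OF simple_graph_induced[OF assms]]
  by (simp add: proper_coloring_induced colorable_on_def proper_on_def)

text \<open>
  A critical set is not empty, and giving a new colour to one of its vertices shows that \<open>k + 1\<close> colours
  suffice; so the chromatic number is exactly \<open>k + 1\<close>.
\<close>
lemma vertex_critical_induced:
  assumes G: "simple_graph G" and S: "S \<subseteq> verts G"
  shows "vertex_critical (k + 1) (induced G S) \<longleftrightarrow> critical_on k S (adjacent G)"
proof -
  let ?H = "induced G S"
  have vS: "verts ?H = S" by (simp add: induced_def)
  have del: "delete_vertex ?H v = induced G (S - {v})" for v
    by (auto simp: delete_vertex_def induced_def)
  have col: "chromatic_number (induced G S') \<le> j \<longleftrightarrow> colorable_on j S' (adjacent G)" if "S' \<subseteq> S" for S' j
    using colorable_induced[OF G, of S' j] that S by (simp add: colorable_def)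
  have "colorable_on (k + 1) S (adjacent G)" if crit: "critical_on k S (adjacent G)"
  proof -
    have "S \<noteq> {}" using crit by (auto simp: critical_on_def colorable_on_def)
    then obtain v where v: "v \<in> S" by blast
    then obtain c where c: "\<forall>u\<in>S - {v}. c u < k" "\<forall>u\<in>S - {v}. \<forall>w\<in>S - {v}. adjacent G u w \<longrightarrow> c u \<noteq> c w"
      using crit unfolding critical_on_def colorable_on_def by blast
    have irr: "\<not> adjacent G v v" using adjacent_verts(3)[OF G, of v v] by blast
    let ?c = "c(v := k)"
    have "?c u < k + 1" if "u \<in> S" for u using c(1) that by (cases "u = v") (auto simp: less_Suc_eq)
    moreover have "?c u \<noteq> ?c w" if "u \<in> S" "w \<in> S" "adjacent G u w" for u w
    proof (cases "u = v \<or> w = v")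
      case True
      then show ?thesis using c(1) that irr by (cases "u = v"; cases "w = v") auto
    next
      case False
      then show ?thesis using c(2) that by simp
    qed
    ultimately show ?thesis unfolding colorable_on_def by (intro exI[of _ ?c]) blast
  qed
  then have 1: "critical_on k S (adjacent G) \<Longrightarrow> chromatic_number ?H \<le> k + 1" using col[of S] by blast
  have 2: "chromatic_number (induced G (S - {v})) < k + 1 \<longleftrightarrow> colorable_on k (S - {v}) (adjacent G)" for v
    using col[of "S - {v}" k] by auto
  show ?thesis
    unfolding vertex_critical_def vS del 2
    using 1 col[of S k] unfolding critical_on_def by (auto simp: le_Suc_eq)
qed

lemma iso_from_list:
  fixes H :: "nat graph" and xs :: "'a list"
  assumes "verts H = {0, 1, 2, 3, 4}" "length xs = 5" "distinct xs"
    and "\<And>i j. i < 5 \<Longrightarrow> j < 5 \<Longrightarrow> {i, j} \<in> edges H \<longleftrightarrow> adjacent G (xs ! i) (xs ! j)"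
  shows "graph_iso H (induced G (set xs))"
  unfolding graph_iso_def
proof (intro exI[of _ "\<lambda>i. xs ! i"] conjI ballI)
  have V: "verts H = {..<5}" using assms(1) by auto
  show "bij_betw ((!) xs) (verts H) (verts (induced G (set xs)))"
    unfolding V using assms(2,3) by (simp add: induced_def bij_betw_nth)
  fix i j assume "i \<in> verts H" "j \<in> verts H"
  then show "{i, j} \<in> edges H \<longleftrightarrow> {xs ! i, xs ! j} \<in> edges (induced G (set xs))"
    using assms(2) assms(4)[of i j] unfolding V by (auto simp: induced_def adjacent_def)
qed

lemma cogem_dart_free_graph:
  assumes G: "simple_graph G" and c: "induced_free co_gem G" and d: "induced_free dart G"
  shows "cogem_dart_free (verts G) (adjacent G)"
proof
  note sym = adjacent_sym[of G]
  have irr: "\<not> adjacent G v v" for v using adjacent_verts(3)[OF G, of v v] by blast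
  show "finite (verts G)" using G by (simp add: simple_graph_def)
  show "adjacent G u v \<Longrightarrow> adjacent G v u" for u v by (rule sym)
  show "\<not> adjacent G u u" for u by (rule irr)
  have five: "i = 0 \<or> i = 1 \<or> i = 2 \<or> i = 3 \<or> i = 4" if "i < 5" for i :: nat using that by auto
  fix a b x y e
  assume V: "a \<in> verts G" "b \<in> verts G" "x \<in> verts G" "y \<in> verts G" "e \<in> verts G"
  {
    assume E: "adjacent G a b" "adjacent G b x" "adjacent G x y" "\<not> adjacent G a x" "\<not> adjacent G a y" "\<not> adjacent G b y"
      "\<not> adjacent G e a" "\<not> adjacent G e b" "\<not> adjacent G e x" "\<not> adjacent G e y"
    let ?xs = "[a, b, x, y, e]"
    have nE: "\<not> adjacent G x a" "\<not> adjacent G y a" "\<not> adjacent G y b"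
      "\<not> adjacent G a e" "\<not> adjacent G b e" "\<not> adjacent G x e" "\<not> adjacent G y e"
      "adjacent G b a" "adjacent G x b" "adjacent G y x"
      using E sym by blast+
    have "distinct ?xs" using E nE irr by auto
    have "graph_iso co_gem (induced G (set ?xs))"
    proof (rule iso_from_list)
      fix i j :: nat assume ij: "i < 5" "j < 5"
      show "{i, j} \<in> edges co_gem \<longleftrightarrow> adjacent G (?xs ! i) (?xs ! j)"
        using five[OF ij(1)] five[OF ij(2)]
        by (elim disjE) (simp_all add: co_gem_def doubleton_eq_iff E nE irr)
    qed (use \<open>distinct ?xs\<close> in \<open>simp_all add: co_gem_def\<close>)
    then show False using c V unfolding induced_free_def by (metis empty_subsetI insert_subset list.set)
  }
  {
    assume E: "adjacent G a b" "adjacent G a x" "adjacent G a y" "adjacent G a e" "adjacent G b x" "adjacent G x y"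
      "b \<noteq> y" "\<not> adjacent G b y" "\<not> adjacent G e b" "\<not> adjacent G e x" "\<not> adjacent G e y"
    let ?xs = "[b, a, x, y, e]"
    have nE: "\<not> adjacent G y b" "\<not> adjacent G b e" "\<not> adjacent G x e" "\<not> adjacent G y e"
      "adjacent G b a" "adjacent G x a" "adjacent G y a" "adjacent G e a" "adjacent G x b" "adjacent G y x"
      using E sym by blast+
    have "distinct ?xs" using E nE irr by auto
    have "graph_iso dart (induced G (set ?xs))"
    proof (rule iso_from_list)
      fix i j :: nat assume ij: "i < 5" "j < 5"
      show "{i, j} \<in> edges dart \<longleftrightarrow> adjacent G (?xs ! i) (?xs ! j)"
        using five[OF ij(1)] five[OF ij(2)]
        by (elim disjE) (simp_all add: dart_def doubleton_eq_iff E nE irr)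
    qed (use \<open>distinct ?xs\<close> in \<open>simp_all add: dart_def\<close>)
    then show False using d V unfolding induced_free_def by (metis empty_subsetI insert_subset list.set)
  }
qed

lemma edge_graph_store:
  assumes G: "simple_graph G" and V: "verts G = {..<n}"
    and s: "s ''n'' 0 = n" "s ''adj'' = graph_store n G ''adj''"
  shows "edge s = adjacent G"
proof (intro ext)
  fix u v
  show "edge s u v = adjacent G u v"
  proof (cases "u < n \<and> v < n")
    case True
    then have "u * n + v < n * n"
      using mult_le_mono1[of "Suc u" n n] by (simp add: less_le_trans)
    moreover have "(u * n + v) div n = u" "(u * n + v) mod n = v" using True by simp_all
    ultimately show ?thesis using True by (simp add: edge_def s graph_store_def adjacent_def)
  next
    case False
    then show ?thesis using adjacent_verts[OF G, of u v] V by (auto simp: edge_def s)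
  qed
qed

lemma input_graph_store:
  assumes G: "simple_graph G" "induced_free co_gem G" "induced_free dart G" and V: "verts G = {..<n}"
    and s: "s ''n'' 0 = n" "s ''adj'' = graph_store n G ''adj''"
  shows "input s"
  using cogem_dart_free_graph[OF G] edge_graph_store[OF G(1) V s] V s
  by (simp add: input_def graph_store_def)

abbreviation graph_class :: "nat graph set" where
  "graph_class \<equiv> {G. simple_graph G \<and> induced_free co_gem G \<and> induced_free dart G}"

lemma induced_verts: "simple_graph G \<Longrightarrow> induced G (verts G) = G"
  unfolding simple_graph_def induced_def by (cases G) auto

lemma certify_outputs: "poly_time_outputs_certificate k graph_class (certify k)"
proof -
  obtain p where p: "\<And>s. input s \<Longrightarrow> halts_within (certify k) s (poly p (s ''n'' 0)) (certified k (s ''n'' 0) (edge s))"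
    using runs_certify[of k] unfolding runs_def by blast
  have "halts_within (certify k) (graph_store n G) (poly p n) (\<lambda>s. \<exists>w. holds_certificate n s w \<and> correct_certificate k G w)"
    if G: "G \<in> graph_class" and V: "verts G = {..<n}" for n G
  proof -
    have sg: "simple_graph G" using G by simp
    have sn: "graph_store n G ''n'' 0 = n" by (simp add: graph_store_def)
    have in_s: "input (graph_store n G)"
      using G input_graph_store[OF _ _ _ V sn refl] by simp
    have e: "edge (graph_store n G) = adjacent G" by (rule edge_graph_store[OF sg V sn refl])
    have cG: "colorable k G \<longleftrightarrow> colorable_on k {..<n} (adjacent G)"
      using colorable_induced[OF sg, of "verts G" k] induced_verts[OF sg] V by simp
    have "\<exists>w. holds_certificate n s w \<and> correct_certificate k G w" if s: "certified k n (adjacent G) s" for s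
    proof (cases "colorable k G")
      case True
      then have a: "s ''ans'' 0 = 1" "proper_on k {..<n} (adjacent G) (s ''cert'')"
        using s cG by (simp_all add: certified_def)
      have "proper_coloring k G (s ''cert'')"
        using a(2) proper_coloring_induced[of k G "verts G"] induced_verts[OF sg] V by simp
      then show ?thesis using True a(1)
        by (intro exI[of _ "Coloring (s ''cert'')"]) (auto simp: holds_certificate_def correct_certificate_def)
    next
      case False
      let ?S = "{v. v < n \<and> s ''cert'' v = 1}"
      have a: "s ''ans'' 0 = 0" "\<forall>v<n. s ''cert'' v \<le> 1" "critical_on k ?S (adjacent G)"
        using s cG False by (simp_all add: certified_def)
      have S: "?S \<subseteq> verts G" using V by auto
      have "vertex_critical (k + 1) (induced G ?S)"
        using vertex_critical_induced[OF sg S] a(3) by blast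
      then have "correct_certificate k G (Critical_Subgraph ?S)"
        using False S by (simp add: correct_certificate_def)
      moreover have "holds_certificate n s (Critical_Subgraph ?S)"
      proof -
        have "s ''cert'' v = (if v \<in> ?S then 1 else 0)" if "v < n" for v
        proof -
          have "s ''cert'' v = 0 \<or> s ''cert'' v = 1" using a(2) that by (simp add: le_Suc_eq)
          then show ?thesis using that by auto
        qed
        then show ?thesis using a(1) by (simp add: holds_certificate_def)
      qed
      ultimately show ?thesis by blast
    qed
    then show ?thesis using p[OF in_s] unfolding halts_within_def e sn by blast
  qed
  then show ?thesis unfolding poly_time_outputs_certificate_def by blast
qed

text \<open>
  The graph \<open>G\<close> contains the set \<open>S\<close>, so if \<open>S\<close> is critical then \<open>G\<close> is not \<open>k\<close>-colourable, and the
  test that \<open>S\<close> is critical decides correctness of the certificate.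
\<close>
lemma verify_verifies: "poly_time_verifies_certificate k graph_class (verify k)"
proof -
  obtain p where p: "\<And>s. input s \<Longrightarrow> halts_within (verify k) s (poly p (s ''n'' 0)) (\<lambda>s'. s' ''ans'' 0 = 1 \<longleftrightarrow> valid k s)"
    using runs_verify[of k] unfolding runs_def by blast
  have "halts_within (verify k) (verifier_store n G w) (poly p n) (\<lambda>s. s ''ans'' 0 = 1 \<longleftrightarrow> correct_certificate k G w)"
    if G: "G \<in> graph_class" and V: "verts G = {..<n}" and w: "\<forall>S. w = Critical_Subgraph S \<longrightarrow> S \<subseteq> verts G" for n G w
  proof -
    let ?s = "verifier_store n G w"
    have sg: "simple_graph G" using G by simp
    have sn: "?s ''n'' 0 = n" "?s ''adj'' = graph_store n G ''adj''" by (simp_all add: verifier_store_def graph_store_def)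
    have in_s: "input ?s"
      using G input_graph_store[OF _ _ _ V sn] by simp
    have e: "edge ?s = adjacent G" by (rule edge_graph_store[OF sg V sn])
    have iG: "colorable k G \<longleftrightarrow> colorable_on k {..<n} (adjacent G)"
      using colorable_induced[OF sg, of "verts G" k] induced_verts[OF sg] V by simp
    have "valid k ?s \<longleftrightarrow> correct_certificate k G w"
    proof (cases w)
      case (Coloring c)
      have "proper_on k {..<n} (adjacent G) (?s ''cert'') \<longleftrightarrow> proper_on k {..<n} (adjacent G) c"
        by (simp add: proper_on_def verifier_store_def Coloring)
      also have "\<dots> \<longleftrightarrow> proper_coloring k G c"
        using proper_coloring_induced[of k G "verts G"] induced_verts[OF sg] V by simp
      also have "\<dots> \<longleftrightarrow> correct_certificate k G w"
        using colorable_iff[OF sg, of k] by (auto simp: correct_certificate_def Coloring)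
      finally show ?thesis by (simp add: valid_def e sn(1)) (simp add: verifier_store_def Coloring)
    next
      case (Critical_Subgraph S)
      have S: "S \<subseteq> verts G" using w Critical_Subgraph by blast
      have ch: "chosen ?s = S" using S V
        by (auto simp: chosen_def sn(1)) (auto simp: verifier_store_def Critical_Subgraph split: if_splits)
      have a: "?s ''ans'' 0 = 0" by (simp add: verifier_store_def Critical_Subgraph)
      have "critical_on k S (adjacent G) \<Longrightarrow> \<not> colorable k G"
        using colorable_on_subset[of k "{..<n}" "adjacent G" S] S V iG by (auto simp: critical_on_def)
      then have "correct_certificate k G w \<longleftrightarrow> critical_on k S (adjacent G)"
        using vertex_critical_induced[OF sg S, of k] S
        by (auto simp: correct_certificate_def Critical_Subgraph)
      then show ?thesis by (simp add: valid_def a e ch)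
    qed
    then show ?thesis using p[OF in_s] unfolding sn(1) by simp
  qed
  then show ?thesis unfolding poly_time_verifies_certificate_def by blast
qed

theorem corollary2:
  fixes k :: nat
  assumes "k \<ge> 1"
  shows "\<exists>A. poly_time_certifying_coloring k
           {G. simple_graph G \<and> induced_free co_gem G \<and> induced_free dart G} A"
  using certify_outputs verify_verifies unfolding poly_time_certifying_coloring_def by blast

end
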